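(* Let $\sigma>1$ and suppose the noise density $g$ is known, its Fourier transform does not vanish on $\mathbb{R}$, and $|\Phi^g(u)|\sim c_g|u|^{-\sigma}$ as $|u|\to\infty$ for some $c_g>0$. Let $L>0$, let $\mathcal{T}$ be the parameter set of the context, and assume $f_0\in\mathcal{F}(\overline{\alpha},\overline{r},\beta_0,L)$ for some $\beta_0\in[\underline{\beta},\overline{\beta}]$. Let $N_1=\lceil\log n\rceil$ and let $\underline{\beta}=\beta_1<\beta_2<\dots<\beta_{N_1}=\overline{\beta}$ be equidistant, $\beta_{i+1}-\beta_i=(\overline{\beta}-\underline{\beta})/(N_1-1)$; for $1\le i\le N_1$ put $$h_n^i=\Big(\frac{n}{\sqrt{\log\log n}}\Big)^{-2/(4\beta_i+4\sigma+1)},\qquad t_{n,i}^2=\Big(\frac{n}{\sqrt{\log\log n}}\Big)^{-4\beta_i/(4\beta_i+4\sigma+1)}.$$ Let $N_2=\lceil\log\log n/(\overline{r}-\underline{r})\rceil$ and let $\underline{r}=r_1<r_2<\dots<r_{N_2}=\overline{r}$ be equidistant, $r_{i+1}-r_i=(\overline{r}-\underline{r})/(N_2-1)$; for $1\le i\le N_2$ put $$h_n^{N_1+i}=\Big(\frac{\log n}{2c}\Big)^{-1/r_i},\qquad t_{n,N_1+i}^2=\frac{(\log n)^{(4\sigma+1)/(2r_i)}}{n}\sqrt{\log\log\log n},$$ where $c>0$ is a constant with $c<\underline{\alpha}\exp(-1/\underline{r})$. Let $N=N_1+N_2$, and let $\Delta_n^\star=1$ if $\sup_{1\le i\le N}|T_{n,h_n^i}|\,t_{n,i}^{-2}>\mathcal{C}^\star$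 and $\Delta_n^\star=0$ otherwise. For $\tau=(\alpha,r,\beta)\in\mathcal{T}$ define $$\psi_{n,\tau}=\Big(\frac{n}{\sqrt{\log\log n}}\Big)^{-2\beta/(4\beta+4\sigma+1)}1_{r=0}+\frac{(\log n)^{(4\sigma+1)/(4r)}}{\sqrt n}(\log\log\log n)^{1/4}\,1_{r\in[\underline{r},\overline{r}]},$$ $\Psi_n=\{\psi_{n,\tau}\}_{\tau\in\mathcal{T}}$, and $H_1(\mathcal{C},\Psi_n)=\bigcup_{\tau\in\mathcal{T}}\{f\in\mathcal{F}(\tau,L):\psi_{n,\tau}^{-2}\|f-f_0\|_2^2\ge\mathcal{C}\}$. Then, for any $\epsilon\in(0,1)$ and $\mathcal{C}^\star$ large enough, there exists $\mathcal{C}^0>0$ such that for all $\mathcal{C}>\mathcal{C}^0$ $$\limsup_{n\to\infty}\Big\{\mathbb{P}_{f_0}[\Delta_n^\star=1]+\sup_{f\in H_1(\mathcal{C},\Psi_n)}\mathbb{P}_f[\Delta_n^\star=0]\Big\}\le\epsilon.$$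
   Context: Convolution model: one observes i.i.d. $Y_j=X_j+\varepsilon_j$, $1\le j\le n$, where the $X_j$ are i.i.d. with unknown density $f\in\mathbb{L}_1\cap\mathbb{L}_2(\mathbb{R})$, the $\varepsilon_j$ are i.i.d. with density $g$ and independent of the $X_j$. $\Phi,\Phi^g$ denote the Fourier transforms of $f,g$. $\mathbb{P}_f$ denotes the law of $(Y_1,\dots,Y_n)$ when the $X_j$ have density $f$. $\|\cdot\|_2$ is the $\mathbb{L}_2(\mathbb{R})$-norm and $\langle M,N\rangle=\int M\overline{N}$. Smoothness classes: for $\tau=(\alpha,r,\beta)$ and $L>0$, $$\mathcal{F}(\tau,L)=\mathcal{F}(\alpha,r,\beta,L)=\Big\{f:\mathbb{R}\to\mathbb{R}_+,\ \int f=1,\ \frac1{2\pi}\int|\Phi(u)|^2|u|^{2\beta}\exp(2\alpha|u|^r)\,du\le L\Big\}.$$ Parameter set: $\mathcal{T}=\{\tau=(\alpha,r,\beta):\ \tau\in[\underline{\alpha},+\infty)\times[\underline{r},\overline{r}]\times[\underline{\beta},\overline{\beta}]\}$, where $\underline{\alpha}>0$, $0\le\underline{r}\le\overline{r}\le2$, $0\le\underline{\beta}\le\overline{\beta}$, and either $\underline{r}>0$ and $\alpha\in[\underline{\alpha},\overline{\alpha}]$, or both $\underline{r}=\overline{r}=0$ and $\underline{\beta}>0$. The first $N_1$ points of the grid of the test are used for adaptation with respect to $\beta$ in the case $\overline{r}=\underline{r}=0$, the last $N_2$ points for adaptation with respect to $r$ (whatever the value of $\beta$). Test statistic: for $h>0$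 let $K_h$ be the function with Fourier transform $\Phi^{K_h}(u)=\Phi^g(u)^{-1}1_{|u|\le1/h}$, and $$T_{n,h}=\frac{2}{n(n-1)}\sum_{1\le k<j\le n}\langle K_h(\cdot-Y_k)-f_0,\ K_h(\cdot-Y_j)-f_0\rangle.$$
   Formalization: The r-grid, c and the class of f_0 use constants 0<r_lo≤r_hi, as N_2, h and exp(-1/r_lo) are undefined at 0; the regime r=0 is covered for T only, with f_0 still exponentially smooth (positive r_hi); if r_lo=r_hi the r-grid is a single point. *)

theory Defs
  imports "HOL-Probability.Probability" "HOL-Library.Landau_Symbols"
begin

section \<open>Convolution model\<close>

definition is_prob_density :: "(real \<Rightarrow> real) \<Rightarrow> bool" where
  "is_prob_density f \<longleftrightarrow> (\<forall>x. 0 \<le> f x) \<and> has_bochner_integral lborel f 1"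

definition fourier :: "(real \<Rightarrow> real) \<Rightarrow> real \<Rightarrow> complex" where
  "fourier f u = (CLINT x|lborel. iexp (u * x) * complex_of_real (f x))"

definition L2_norm :: "(real \<Rightarrow> real) \<Rightarrow> real" where
  "L2_norm f = sqrt (LINT x|lborel. (f x)\<^sup>2)"

definition L2_inner :: "(real \<Rightarrow> complex) \<Rightarrow> (real \<Rightarrow> complex) \<Rightarrow> complex" where
  "L2_inner M N = (CLINT x|lborel. M x * cnj (N x))"

text \<open>Law of \<open>(Y\<^sub>1, \<dots>, Y\<^sub>n)\<close>, where \<open>Y\<^sub>j = X\<^sub>j + \<epsilon>\<^sub>j\<close>, all \<open>X\<^sub>j\<close> and \<open>\<epsilon>\<^sub>j\<close> are independent,
  \<open>X\<^sub>j\<close> has density \<open>f\<close> and \<open>\<epsilon>\<^sub>j\<close> has density \<open>g\<close>.\<close>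

definition obs_law :: "(real \<Rightarrow> real) \<Rightarrow> nat \<Rightarrow> (real \<Rightarrow> real) \<Rightarrow> (nat \<Rightarrow> real) measure" where
  "obs_law g n f = PiM {1..n} (\<lambda>_.
     density lborel (\<lambda>x. ennreal (f x)) \<star> density lborel (\<lambda>x. ennreal (g x)))"

section \<open>Smoothness classes and parameter set\<close>

text \<open>Square integrability is the standing assumption that all densities of the unobserved
  variables lie in \<open>L\<^sub>1 \<inter> L\<^sub>2\<close>. For the parameters in use (\<open>\<alpha> > 0\<close> and \<open>r, \<beta> \<ge> 0\<close>) it also follows
  from the integral condition. The latter is an extended nonnegative integral, so that
  it fails when the integral diverges.\<close>

definition smooth_class :: "real \<Rightarrow> real \<Rightarrow> real \<Rightarrow> real \<Rightarrow> (real \<Rightarrow> real) set" where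
  "smooth_class \<alpha> r \<beta> L = {f.
     is_prob_density f \<and> integrable lborel (\<lambda>x. (f x)\<^sup>2) \<and>
     ennreal (1 / (2 * pi)) *
       (\<integral>\<^sup>+u. ennreal ((cmod (fourier f u))\<^sup>2 * \<bar>u\<bar> powr (2 * \<beta>) * exp (2 * \<alpha> * \<bar>u\<bar> powr r)) \<partial>lborel)
     \<le> ennreal L}"

text \<open>The upper bound \<open>\<alpha>u\<close> on \<open>\<alpha>\<close> is imposed only in the exponentially smooth regime \<open>rl > 0\<close>;
  in the polynomial regime \<open>rl = ru = 0\<close> the range of \<open>\<alpha>\<close> is \<open>[\<alpha>l, \<infinity>)\<close>.\<close>

definition param_set ::
  "real \<Rightarrow> real \<Rightarrow> real \<Rightarrow> real \<Rightarrow> real \<Rightarrow> real \<Rightarrow> (real \<times> real \<times> real) set" where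
  "param_set \<alpha>l \<alpha>u rl ru \<beta>l \<beta>u = {(\<alpha>, r, \<beta>).
     \<alpha>l \<le> \<alpha> \<and> (0 < rl \<longrightarrow> \<alpha> \<le> \<alpha>u) \<and> r \<in> {rl..ru} \<and> \<beta> \<in> {\<beta>l..\<beta>u}}"

section \<open>Test statistic\<close>

text \<open>\<open>K\<^sub>h\<close> is given by Fourier inversion: its transform is bounded with compact support, but
  \<open>K\<^sub>h\<close> itself is in general only square integrable.\<close>

definition kernel_ft :: "(real \<Rightarrow> real) \<Rightarrow> real \<Rightarrow> real \<Rightarrow> complex" where
  "kernel_ft g h u = inverse (fourier g u) * indicator {v. \<bar>v\<bar> \<le> 1 / h} u"

definition kernel :: "(real \<Rightarrow> real) \<Rightarrow> real \<Rightarrow> real \<Rightarrow> complex" where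
  "kernel g h x = complex_of_real (1 / (2 * pi)) * (CLINT u|lborel. iexp (- (u * x)) * kernel_ft g h u)"

definition test_stat ::
  "(real \<Rightarrow> real) \<Rightarrow> (real \<Rightarrow> real) \<Rightarrow> nat \<Rightarrow> real \<Rightarrow> (nat \<Rightarrow> real) \<Rightarrow> complex" where
  "test_stat g f0 n h Y = complex_of_real (2 / (real n * (real n - 1))) *
     (\<Sum>j=1..n. \<Sum>k=1..<j.
        L2_inner (\<lambda>x. kernel g h (x - Y k) - complex_of_real (f0 x))
                 (\<lambda>x. kernel g h (x - Y j) - complex_of_real (f0 x)))"

section \<open>Grid\<close>

text \<open>The grids are equidistant and indexed from 1. For \<open>rl = ru\<close>, where the formula for the number of
  points of the \<open>r\<close>-grid divides by zero, that grid is the single point \<open>rl\<close>.\<close>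

definition N1 :: "nat \<Rightarrow> nat" where
  "N1 n = nat \<lceil>ln (real n)\<rceil>"

definition N2 :: "real \<Rightarrow> real \<Rightarrow> nat \<Rightarrow> nat" where
  "N2 rl ru n = (if rl = ru then 1 else nat \<lceil>ln (ln (real n)) / (ru - rl)\<rceil>)"

definition \<beta>_grid :: "real \<Rightarrow> real \<Rightarrow> nat \<Rightarrow> nat \<Rightarrow> real" where
  "\<beta>_grid \<beta>l \<beta>u n i = \<beta>l + (real i - 1) * ((\<beta>u - \<beta>l) / (real (N1 n) - 1))"

definition r_grid :: "real \<Rightarrow> real \<Rightarrow> nat \<Rightarrow> nat \<Rightarrow> real" where
  "r_grid rl ru n i = rl + (real i - 1) * ((ru - rl) / (real (N2 rl ru n) - 1))"

definition bandwidth ::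
  "real \<Rightarrow> real \<Rightarrow> real \<Rightarrow> real \<Rightarrow> real \<Rightarrow> real \<Rightarrow> nat \<Rightarrow> nat \<Rightarrow> real" where
  "bandwidth \<sigma> rl ru \<beta>l \<beta>u c n i =
     (if i \<le> N1 n
      then (real n / sqrt (ln (ln (real n)))) powr (- 2 / (4 * \<beta>_grid \<beta>l \<beta>u n i + 4 * \<sigma> + 1))
      else (ln (real n) / (2 * c)) powr (- 1 / r_grid rl ru n (i - N1 n)))"

definition threshold_sq ::
  "real \<Rightarrow> real \<Rightarrow> real \<Rightarrow> real \<Rightarrow> real \<Rightarrow> nat \<Rightarrow> nat \<Rightarrow> real" where
  "threshold_sq \<sigma> rl ru \<beta>l \<beta>u n i =
     (if i \<le> N1 n
      then (real n / sqrt (ln (ln (real n)))) powr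
             (- 4 * \<beta>_grid \<beta>l \<beta>u n i / (4 * \<beta>_grid \<beta>l \<beta>u n i + 4 * \<sigma> + 1))
      else ln (real n) powr ((4 * \<sigma> + 1) / (2 * r_grid rl ru n (i - N1 n))) / real n
             * sqrt (ln (ln (ln (real n)))))"

definition adaptive_test ::
  "(real \<Rightarrow> real) \<Rightarrow> (real \<Rightarrow> real) \<Rightarrow> real \<Rightarrow> real \<Rightarrow> real \<Rightarrow> real \<Rightarrow> real \<Rightarrow> real \<Rightarrow> real
     \<Rightarrow> nat \<Rightarrow> (nat \<Rightarrow> real) \<Rightarrow> nat" where
  "adaptive_test g f0 \<sigma> rl ru \<beta>l \<beta>u c Cstar n Y =
     (if (SUP i\<in>{1..N1 n + N2 rl ru n}.
            cmod (test_stat g f0 n (bandwidth \<sigma> rl ru \<beta>l \<beta>u c n i) Y)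
              * inverse (threshold_sq \<sigma> rl ru \<beta>l \<beta>u n i)) > Cstar
      then 1 else 0)"

section \<open>Testing rate and alternative\<close>

definition test_rate :: "real \<Rightarrow> real \<Rightarrow> real \<Rightarrow> nat \<Rightarrow> real \<times> real \<times> real \<Rightarrow> real" where
  "test_rate \<sigma> rl ru n = (\<lambda>(\<alpha>, r, \<beta>).
     (real n / sqrt (ln (ln (real n)))) powr (- 2 * \<beta> / (4 * \<beta> + 4 * \<sigma> + 1)) * of_bool (r = 0)
     + ln (real n) powr ((4 * \<sigma> + 1) / (4 * r)) / sqrt (real n)
         * ln (ln (ln (real n))) powr (1 / 4) * of_bool (r \<in> {rl..ru}))"

definition alternative ::
  "(real \<Rightarrow> real) \<Rightarrow> real \<Rightarrow> (real \<times> real \<times> real) set \<Rightarrow> real \<Rightarrow> (real \<times> real \<times> real \<Rightarrow> real)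
     \<Rightarrow> (real \<Rightarrow> real) set" where
  "alternative f0 L \<T> C \<psi> = (\<Union>(\<alpha>, r, \<beta>)\<in>\<T>.
     {f \<in> smooth_class \<alpha> r \<beta> L.
        inverse ((\<psi> (\<alpha>, r, \<beta>))\<^sup>2) * (L2_norm (\<lambda>x. f x - f0 x))\<^sup>2 \<ge> C})"

end

theory Submission
  imports Defs "HOL-Real_Asymp.Real_Asymp"
begin

text \<open>
  By Plancherel, the statistic at bandwidth \<open>h\<close> under \<open>f\<close> equals the energy of \<open>\<Phi>\<^sub>0\<close> on \<open>\<bar>u\<bar> > 1/h\<close>,
  plus the energy of \<open>\<Phi> - \<Phi>\<^sub>0\<close> on \<open>\<bar>u\<bar> \<le> 1/h\<close>, plus a centred linear term and a degenerate
  U-statistic \<open>U\<close> of variance of order \<open>h powr -(4\<sigma>+1) / n\<^sup>2\<close>.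

  Under the null hypothesis the linear term vanishes. There are about \<open>ln n\<close> tests while the thresholds exceed
  the standard deviations by \<open>(ln (ln n)) powr (1/2)\<close> only, so Gaussian tails are needed for \<open>U\<close>. As a sum over
  \<open>j\<close> it is a martingale with differences \<open>D\<^sub>j\<close>, and \<open>exp (x - x\<^sup>2/6) \<le> 1 + x + x\<^sup>2/3\<close> makes
  \<open>exp (\<theta> U - \<theta>\<^sup>2/2 \<Sum>\<^sub>j (D\<^sub>j\<^sup>2 + 2 E(D\<^sub>j\<^sup>2 | past)) / 3)\<close> a supermartingale without any boundedness
  of the \<open>D\<^sub>j\<close>. The sum in the exponent exceeds a constant multiple of its expected size with probability of order
  \<open>h + 1/n\<close> by Chebyshev, because the operator norm of the kernel is smaller than its Hilbert-Schmidt norm by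
  a factor of order \<open>h powr (1/2)\<close>.

  Under the alternative, Chebyshev's inequality is applied to the single test whose grid point is the largest one not
  exceeding the true smoothness.
\<close>

section \<open>Plancherel's theorem\<close>

text \<open>Uniformity over the alternative rests on one number. The characteristic function of an
  observation is \<open>fourier f u * fourier g u\<close>, so its modulus is at most that of
  \<open>fourier g\<close>, which is integrable because \<sigma> > 1. The Schur test then bounds the
  second moment of \<open>ft m\<close> at an observation by \<open>b\<close> times the energy of
  \<open>m\<close>, where \<open>b\<close>, the integral of |\<open>fourier g\<close>|, does not
  depend on \<open>f\<close>. This controls the Hilbert-Schmidt norm of the kernel, its operator
  norm and the linear term alike. A large \<open>Cstar\<close> pays for the size of the grids: the
  Gaussian tails are of order (ln n)^(-2) for each of about ln n tests of the \<beta>-grid and (ln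
  ln n)^(-2) for each of order ln ln n tests of the r-grid, while h + 1/n is at most a negative
  power of n on the first grid and of ln n on the second. With spacings of order 1/ln n and 1/ln ln
  n, neighbouring grid points have thresholds that differ by a bounded factor. The deconvolution
  kernel is in general only square integrable, so the scalar products in the statistic need
  Plancherel's theorem in L2 form.\<close>

definition ft :: "(real \<Rightarrow> complex) \<Rightarrow> real \<Rightarrow> complex" where
  "ft m x = (CLINT u|lborel. iexp (x * u) * m u)"

lemma cnj_borel_measurable [measurable]: "cnj \<in> borel_measurable borel"
  by (intro borel_measurable_continuous_onI continuous_intros)

lemma integrable_iexp_mult:
  assumes "integrable M m" and [measurable]: "f \<in> borel_measurable M"
  shows "integrable M (\<lambda>u. iexp (f u) * m u)"
proof -
  have [measurable]: "m \<in> borel_measurable M" using assms by auto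
  show ?thesis
    by (rule Bochner_Integration.integrable_bound[OF assms(1)]) (auto simp: norm_mult)
qed

lemma ft_measurable [measurable]:
  assumes [measurable]: "m \<in> borel_measurable borel"
  shows "ft m \<in> borel_measurable borel"
  unfolding ft_def by measurable

lemma norm_ft_le: "cmod (ft m x) \<le> (LINT u|lborel. cmod (m u))"
proof -
  have "cmod (ft m x) \<le> (LINT u|lborel. cmod (iexp (x * u) * m u))"
    unfolding ft_def by (rule integral_norm_bound)
  then show ?thesis by (simp add: norm_mult)
qed

lemma ft_add: "integrable lborel m \<Longrightarrow> integrable lborel p \<Longrightarrow> ft (\<lambda>u. m u + p u) x = ft m x + ft p x"
  unfolding ft_def using integrable_iexp_mult[of lborel m "\<lambda>u. x * u"] integrable_iexp_mult[of lborel p "\<lambda>u. x * u"]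
  by (simp add: distrib_left)

lemma ft_diff: "integrable lborel m \<Longrightarrow> integrable lborel p \<Longrightarrow> ft (\<lambda>u. m u - p u) x = ft m x - ft p x"
  unfolding ft_def using integrable_iexp_mult[of lborel m "\<lambda>u. x * u"] integrable_iexp_mult[of lborel p "\<lambda>u. x * u"]
  by (simp add: right_diff_distrib)

lemma ft_cmult: "ft (\<lambda>u. c * m u) x = c * ft m x"
proof -
  have "ft (\<lambda>u. c * m u) x = (CLINT u|lborel. c * (iexp (x * u) * m u))"
    unfolding ft_def by (rule Bochner_Integration.integral_cong) (auto simp: algebra_simps)
  then show ?thesis unfolding ft_def by simp
qed

section \<open>Gaussian averages of the squared transform\<close>

abbreviation "stdn \<equiv> std_normal_distribution"

interpretation stdn: prob_space stdn
  by (rule prob_space_normal_density) simp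

interpretation pnl: pair_sigma_finite stdn "lborel :: real measure" ..

lemma integrable_pair_mult:
  fixes m p :: "real \<Rightarrow> complex"
  assumes "integrable lborel m" "integrable lborel p"
  shows "integrable (lborel \<Otimes>\<^sub>M lborel) (\<lambda>(u, v). m u * p v)"
proof (rule lborel_pair.Fubini_integrable)
  have [measurable]: "m \<in> borel_measurable borel" "p \<in> borel_measurable borel"
    using assms by (auto dest: borel_measurable_integrable)
  show "(\<lambda>(u, v). m u * p v) \<in> borel_measurable (lborel \<Otimes>\<^sub>M lborel)" by measurable
  show "integrable lborel (\<lambda>x. LINT y|lborel. norm (case (x, y) of (u, v) \<Rightarrow> m u * p v))"
    using assms by (simp add: norm_mult)
  show "AE x in lborel. integrable lborel (\<lambda>y. case (x, y) of (u, v) \<Rightarrow> m u * p v)"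
    using assms by simp
qed

text \<open>Writing the squared modulus as a double integral over (u, v) and exchanging it with the
  integral over \<open>M\<close>, the phase of frequency u - v integrates to
  \<open>char M (u - v)\<close>. The identity serves twice: a Gaussian law leads to Plancherel's
  theorem, the law of an observation to the moment bound.\<close>

lemma integral_ft_square_char:
  fixes m :: "real \<Rightarrow> complex"
  assumes "real_distribution M" and m: "integrable lborel m"
  shows "(CLINT x|M. ft m x * cnj (ft m x)) = (CLINT v|lborel. CLINT u|lborel. char M (u - v) * (m u * cnj (m v)))"
proof -
  interpret M: real_distribution M by fact
  interpret P: pair_sigma_finite M "lborel \<Otimes>\<^sub>M lborel :: (real \<times> real) measure" ..
  have [measurable]: "m \<in> borel_measurable borel"
    using m by (auto dest: borel_measurable_integrable)
  let ?P = "lborel \<Otimes>\<^sub>M lborel :: (real \<times> real) measure"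
  define Q where "Q = (\<lambda>(u, v). m u * cnj (m v))"
  have Qi: "integrable ?P Q" unfolding Q_def using integrable_pair_mult[OF m] m by simp
  have Q[measurable]: "Q \<in> borel_measurable (borel \<Otimes>\<^sub>M borel)" unfolding Q_def by measurable
  define F where "F = (\<lambda>x w. iexp ((fst w - snd w) * x) * Q w)"
  have nF: "norm (F x w) = norm (Q w)" for x w unfolding F_def by (simp add: norm_mult)
  have Fm: "case_prod F \<in> borel_measurable (M \<Otimes>\<^sub>M ?P)" unfolding F_def by measurable
  have Fi: "integrable (M \<Otimes>\<^sub>M ?P) (case_prod F)"
  proof (rule P.Fubini_integrable[OF Fm])
    show "AE x in M. integrable ?P (\<lambda>y. case (x, y) of (x, w) \<Rightarrow> F x w)"
      unfolding F_def case_prod_conv by (intro AE_I2 integrable_iexp_mult Qi) measurable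
  qed (simp add: nF)
  have inner1: "(CLINT w|?P. F x w) = ft m x * cnj (ft m x)" for x
  proof -
    have a: "integrable lborel (\<lambda>u. iexp (x * u) * m u)"
      by (intro integrable_iexp_mult m) measurable
    have "integrable ?P (\<lambda>(u, v). (iexp (x * u) * m u) * cnj (iexp (x * v) * m v))"
      by (rule integrable_pair_mult[OF a a[THEN integrable_cnj]])
    from lborel_pair.integral_fst[OF this]
    have "(CLINT w|?P. (case w of (u, v) \<Rightarrow> (iexp (x * u) * m u) * cnj (iexp (x * v) * m v)))
      = (CLINT u|lborel. CLINT v|lborel. (iexp (x * u) * m u) * cnj (iexp (x * v) * m v))"
      by simp
    also have "\<dots> = ft m x * cnj (ft m x)"
      unfolding ft_def by (simp del: complex_cnj_mult)
    also have "(\<lambda>w. case w of (u, v) \<Rightarrow> (iexp (x * u) * m u) * cnj (iexp (x * v) * m v)) = F x"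
      by (auto simp: fun_eq_iff F_def Q_def exp_cnj algebra_simps simp flip: exp_add)
    finally show ?thesis .
  qed
  have inner2: "(CLINT x|M. F x w) = char M (fst w - snd w) * Q w" for w
    unfolding F_def char_def by simp
  have Gi: "integrable ?P (\<lambda>(u, v). char M (u - v) * (m u * cnj (m v)))"
  proof (rule Bochner_Integration.integrable_bound[OF Qi])
    show "AE x in ?P. cmod (case x of (u, v) \<Rightarrow> char M (u - v) * (m u * cnj (m v))) \<le> cmod (Q x)"
      by (intro AE_I2) (auto simp: Q_def norm_mult M.cmod_char_le_1 split: prod.splits intro!: mult_left_le_one_le)
  qed measurable
  have "(CLINT x|M. ft m x * cnj (ft m x)) = (CLINT x|M. CLINT w|?P. F x w)"
    by (simp add: inner1)
  also have "\<dots> = (CLINT w|?P. CLINT x|M. F x w)"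
    using P.Fubini_integral[OF Fi] by simp
  also have "\<dots> = (CLINT w|?P. (case w of (u, v) \<Rightarrow> char M (u - v) * (m u * cnj (m v))))"
    unfolding inner2 by (simp add: Q_def case_prod_beta)
  also have "\<dots> = (CLINT v|lborel. CLINT u|lborel. char M (u - v) * (m u * cnj (m v)))"
    using lborel_pair.integral_snd[OF Gi] by simp
  finally show ?thesis .
qed

lemma gauss_ft:
  fixes m :: "real \<Rightarrow> complex"
  assumes m: "integrable lborel m"
  shows "(CLINT x|stdn. ft m (x / s) * cnj (ft m (x / s)))
    = (CLINT v|lborel. CLINT u|lborel. complex_of_real (exp (- ((u - v) / s)\<^sup>2 / 2)) * (m u * cnj (m v)))"
proof -
  have [measurable]: "m \<in> borel_measurable borel"
    using m by (auto dest: borel_measurable_integrable)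
  let ?M = "distr stdn borel (\<lambda>x. x / s)"
  have M: "real_distribution ?M" by (intro stdn.real_distribution_distr) simp
  have "char ?M t = complex_of_real (exp (- (t / s)\<^sup>2 / 2))" for t
    using fun_cong[OF char_std_normal_distribution, of "t / s"] unfolding char_def
    by (subst integral_distr) auto
  then show ?thesis
    using integral_ft_square_char[OF M m] by (simp add: integral_distr)
qed

text \<open>Autocorrelation. Its value at 0 is the squared L2 norm, which also bounds it everywhere;
  continuity at 0 is what turns Gaussian averages into Plancherel's identity.\<close>

definition acorr :: "(real \<Rightarrow> complex) \<Rightarrow> real \<Rightarrow> complex" where
  "acorr m t = (CLINT v|lborel. m (v + t) * cnj (m v))"

lemma acorr_measurable [measurable]:
  assumes [measurable]: "m \<in> borel_measurable borel"
  shows "acorr m \<in> borel_measurable borel"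
  unfolding acorr_def by measurable

lemma integrable_shift:
  fixes m :: "real \<Rightarrow> 'a::{banach, second_countable_topology}"
  shows "integrable lborel m \<Longrightarrow> integrable lborel (\<lambda>v. m (v + t))"
  using lborel_integrable_real_affine[of m 1 t] by (simp add: add.commute)

lemma integral_shift:
  fixes m :: "real \<Rightarrow> 'a::{banach, second_countable_topology}"
  shows "(LINT v|lborel. m (v + t)) = integral\<^sup>L lborel m"
  using lborel_integral_real_affine[of 1 m t] by (simp add: add.commute)

lemma norm_mult_le_half: "cmod (a * b) \<le> ((cmod a)\<^sup>2 + (cmod b)\<^sup>2) / 2"
  using sum_squares_bound[of "cmod a" "cmod b"] by (simp add: norm_mult)

lemma integrable_mult_L2:
  fixes a b :: "'a \<Rightarrow> complex"
  assumes [measurable]: "a \<in> borel_measurable M" "b \<in> borel_measurable M"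
    and "integrable M (\<lambda>x. (cmod (a x))\<^sup>2)" "integrable M (\<lambda>x. (cmod (b x))\<^sup>2)"
  shows "integrable M (\<lambda>x. a x * b x)"
proof (rule Bochner_Integration.integrable_bound)
  show "integrable M (\<lambda>x. ((cmod (a x))\<^sup>2 + (cmod (b x))\<^sup>2) / 2)" using assms by simp
  show "AE x in M. cmod (a x * b x) \<le> norm (((cmod (a x))\<^sup>2 + (cmod (b x))\<^sup>2) / 2)"
    using norm_mult_le_half by (auto intro!: AE_I2)
qed measurable

lemma acorr_integrable:
  fixes m :: "real \<Rightarrow> complex"
  assumes [measurable]: "m \<in> borel_measurable borel" and m2: "integrable lborel (\<lambda>x. (cmod (m x))\<^sup>2)"
  shows "integrable lborel (\<lambda>v. m (v + t) * cnj (m v))"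
  by (rule integrable_mult_L2) (use m2 integrable_shift[OF m2, of t] in auto)

lemma acorr_norm:
  fixes m :: "real \<Rightarrow> complex"
  assumes [measurable]: "m \<in> borel_measurable borel" and m2: "integrable lborel (\<lambda>x. (cmod (m x))\<^sup>2)"
  shows "(LINT v|lborel. cmod (m (v + t) * cnj (m v))) \<le> (LINT x|lborel. (cmod (m x))\<^sup>2)"
proof -
  have "(LINT v|lborel. cmod (m (v + t) * cnj (m v))) \<le> (LINT v|lborel. ((cmod (m (v + t)))\<^sup>2 + (cmod (m v))\<^sup>2) / 2)"
  proof (rule integral_mono)
    show "cmod (m (v + t) * cnj (m v)) \<le> ((cmod (m (v + t)))\<^sup>2 + (cmod (m v))\<^sup>2) / 2" for v
      using norm_mult_le_half[of "m (v + t)" "cnj (m v)"] by simp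
  qed (use acorr_integrable[OF assms, of t] integrable_shift[OF m2, of t] m2 in auto)
  also have "\<dots> = (LINT x|lborel. (cmod (m x))\<^sup>2)"
    using integrable_shift[OF m2, of t] m2 integral_shift[of "\<lambda>x. (cmod (m x))\<^sup>2" t] by simp
  finally show ?thesis .
qed

lemma norm_acorr_le:
  fixes m :: "real \<Rightarrow> complex"
  assumes [measurable]: "m \<in> borel_measurable borel" and m2: "integrable lborel (\<lambda>x. (cmod (m x))\<^sup>2)"
  shows "cmod (acorr m t) \<le> (LINT x|lborel. (cmod (m x))\<^sup>2)"
  unfolding acorr_def using integral_norm_bound acorr_norm[OF assms] by (rule order_trans)

lemma Re_of_real_mult: "Re (complex_of_real a * z) = a * Re z"
  by simp

text \<open>Substituting u = v + s * z turns the Gaussian weight in u - v into an average of the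
  autocorrelation over the shifts s * z. As s tends to 0 the left side tends to the integral of
  |\<open>ft m\<close>|^2 divided by sqrt (2 * pi), and the right side to sqrt (2 * pi) times the
  squared norm of \<open>m\<close> if the autocorrelation is continuous at 0.\<close>

lemma gauss_ft_acorr:
  fixes m :: "real \<Rightarrow> complex"
  assumes m: "integrable lborel m" and m2: "integrable lborel (\<lambda>x. (cmod (m x))\<^sup>2)" and s: "s > 0"
  shows "(LINT x|lborel. std_normal_density (s * x) * (cmod (ft m x))\<^sup>2)
    = sqrt (2 * pi) * Re (CLINT z|stdn. acorr m (s * z))"
proof -
  have [measurable]: "m \<in> borel_measurable borel"
    using m by (auto dest: borel_measurable_integrable)
  have "(CLINT x|stdn. ft m (x / s) * cnj (ft m (x / s))) = (CLINT x|stdn. complex_of_real ((cmod (ft m (x / s)))\<^sup>2))"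
    by (simp add: complex_norm_square del: of_real_power)
  also have "\<dots> = complex_of_real (LINT x|stdn. (cmod (ft m (x / s)))\<^sup>2)"
    by (rule integral_complex_of_real)
  also have "(LINT x|stdn. (cmod (ft m (x / s)))\<^sup>2) = (LINT x|lborel. std_normal_density x * (cmod (ft m (x / s)))\<^sup>2)"
    by (subst integral_density) auto
  also have "\<dots> = s * (LINT x|lborel. std_normal_density (s * x) * (cmod (ft m x))\<^sup>2)"
    using s by (subst lborel_integral_real_affine[of s _ 0]) auto
  finally have L: "(CLINT x|stdn. ft m (x / s) * cnj (ft m (x / s)))
    = complex_of_real (s * (LINT x|lborel. std_normal_density (s * x) * (cmod (ft m x))\<^sup>2))" .
  have Fi: "integrable (stdn \<Otimes>\<^sub>M lborel) (\<lambda>(z, v). m (v + s * z) * cnj (m v))"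
  proof (rule pnl.Fubini_integrable)
    show "(\<lambda>(z, v). m (v + s * z) * cnj (m v)) \<in> borel_measurable (stdn \<Otimes>\<^sub>M lborel)" by measurable
    show "AE z in stdn. integrable lborel (\<lambda>v. case (z, v) of (z, v) \<Rightarrow> m (v + s * z) * cnj (m v))"
      using acorr_integrable[OF _ m2] by simp
    have "\<bar>LINT v|lborel. cmod (m (v + s * z) * cnj (m v))\<bar> \<le> (LINT x|lborel. (cmod (m x))\<^sup>2)" for z
      using acorr_norm[OF _ m2, of "s * z"] by simp
    then show "integrable stdn (\<lambda>z. LINT v|lborel. norm (case (z, v) of (z, v) \<Rightarrow> m (v + s * z) * cnj (m v)))"
      by (intro stdn.integrable_const_bound[where B="LINT x|lborel. (cmod (m x))\<^sup>2"]) auto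
  qed
  have inner: "(CLINT u|lborel. complex_of_real (exp (- ((u - v) / s)\<^sup>2 / 2)) * (m u * cnj (m v)))
    = complex_of_real (s * sqrt (2 * pi)) * (CLINT z|stdn. m (v + s * z) * cnj (m v))" for v
  proof -
    have "(CLINT u|lborel. complex_of_real (exp (- ((u - v) / s)\<^sup>2 / 2)) * (m u * cnj (m v)))
      = s *\<^sub>R (CLINT z|lborel. complex_of_real (exp (- z\<^sup>2 / 2)) * (m (v + s * z) * cnj (m v)))"
      using s by (subst lborel_integral_real_affine[of s _ v]) auto
    also have "(CLINT z|lborel. complex_of_real (exp (- z\<^sup>2 / 2)) * (m (v + s * z) * cnj (m v)))
      = (CLINT z|lborel. sqrt (2 * pi) *\<^sub>R (std_normal_density z *\<^sub>R (m (v + s * z) * cnj (m v))))"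
      by (rule Bochner_Integration.integral_cong) (auto simp: std_normal_density_def scaleR_conv_of_real)
    also have "\<dots> = sqrt (2 * pi) *\<^sub>R (CLINT z|lborel. std_normal_density z *\<^sub>R (m (v + s * z) * cnj (m v)))"
      by (rule integral_scaleR_right)
    also have "\<dots> = sqrt (2 * pi) *\<^sub>R (CLINT z|stdn. m (v + s * z) * cnj (m v))"
      by (subst integral_density) auto
    finally show ?thesis by (simp add: scaleR_conv_of_real)
  qed
  have "complex_of_real (s * (LINT x|lborel. std_normal_density (s * x) * (cmod (ft m x))\<^sup>2))
    = complex_of_real (s * sqrt (2 * pi)) * (CLINT v|lborel. CLINT z|stdn. m (v + s * z) * cnj (m v))"
    unfolding L[symmetric] gauss_ft[OF m] inner by simp
  also have "(CLINT v|lborel. CLINT z|stdn. m (v + s * z) * cnj (m v)) = (CLINT z|stdn. acorr m (s * z))"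
    using pnl.Fubini_integral[OF Fi] unfolding acorr_def by simp
  finally have "complex_of_real (s * (LINT x|lborel. std_normal_density (s * x) * (cmod (ft m x))\<^sup>2))
    = complex_of_real (s * sqrt (2 * pi)) * (CLINT z|stdn. acorr m (s * z))" .
  from arg_cong[OF this, of Re] have "s * (LINT x|lborel. std_normal_density (s * x) * (cmod (ft m x))\<^sup>2)
    = s * (sqrt (2 * pi) * Re (CLINT z|stdn. acorr m (s * z)))"
    unfolding Re_of_real_mult Re_complex_of_real mult.assoc .
  then show ?thesis using s by simp
qed

lemma gauss_ft_le:
  fixes m :: "real \<Rightarrow> complex"
  assumes m: "integrable lborel m" and m2: "integrable lborel (\<lambda>x. (cmod (m x))\<^sup>2)" and s: "s > 0"
  shows "(LINT x|lborel. std_normal_density (s * x) * (cmod (ft m x))\<^sup>2)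
    \<le> sqrt (2 * pi) * (LINT x|lborel. (cmod (m x))\<^sup>2)"
proof -
  have [measurable]: "m \<in> borel_measurable borel"
    using m by (auto dest: borel_measurable_integrable)
  have i: "integrable stdn (\<lambda>z. acorr m (s * z))"
    using norm_acorr_le[OF _ m2]
    by (intro stdn.integrable_const_bound[where B="LINT x|lborel. (cmod (m x))\<^sup>2"]) auto
  have "Re (CLINT z|stdn. acorr m (s * z)) \<le> cmod (CLINT z|stdn. acorr m (s * z))"
    by (rule complex_Re_le_cmod)
  also have "\<dots> \<le> (LINT z|stdn. cmod (acorr m (s * z)))" by (rule integral_norm_bound)
  also have "\<dots> \<le> (LINT z|stdn. (LINT x|lborel. (cmod (m x))\<^sup>2))"
    using i norm_acorr_le[OF _ m2] by (intro integral_mono) auto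
  finally show ?thesis unfolding gauss_ft_acorr[OF assms] by (simp add: stdn.prob_space[simplified])
qed

text \<open>Fatou's lemma along the scales 1 / (n + 1). This half of Plancherel's theorem rests on
  the bound of the autocorrelation by its value at 0 and not on its continuity.\<close>

lemma
  fixes m :: "real \<Rightarrow> complex"
  assumes m: "integrable lborel m" and m2: "integrable lborel (\<lambda>x. (cmod (m x))\<^sup>2)"
  shows ft_L2_integrable: "integrable lborel (\<lambda>x. (cmod (ft m x))\<^sup>2)"
    and ft_L2_le: "(LINT x|lborel. (cmod (ft m x))\<^sup>2) \<le> 2 * pi * (LINT x|lborel. (cmod (m x))\<^sup>2)"
proof -
  have [measurable]: "m \<in> borel_measurable borel"
    using m by (auto dest: borel_measurable_integrable)
  let ?I = "LINT x|lborel. (cmod (m x))\<^sup>2"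
  define F where "F n x = std_normal_density (x / real (Suc n)) * (cmod (ft m x))\<^sup>2" for n x
  have F0: "0 \<le> F n x" for n x unfolding F_def by simp
  have B: "(\<integral>\<^sup>+x. F n x \<partial>lborel) \<le> ennreal (sqrt (2 * pi) * ?I)" for n
  proof -
    \<comment> \<open>Needed before \<open>gauss_ft_le\<close> is used: the Bochner integral of a
      function that is not integrable is 0, so a bound on it alone would say nothing. Integrability
      holds because |\<open>ft m\<close>| is at most the L1 norm of \<open>m\<close>.\<close>
    have "integrable lborel (\<lambda>x. std_normal_density ((1 / real (Suc n)) * x) * (LINT u|lborel. cmod (m u))\<^sup>2)"
      by (intro integrable_mult_left lborel_integrable_real_affine[where t=0, simplified]) auto
    then have "integrable lborel (F n)"
      unfolding F_def by (rule Bochner_Integration.integrable_bound)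
        (auto intro!: AE_I2 mult_left_mono power_mono norm_ft_le)
    then show ?thesis
      using gauss_ft_le[OF m m2, of "1 / real (Suc n)"] F0
      by (subst nn_integral_eq_integral) (auto simp: F_def[abs_def] intro!: ennreal_leI)
  qed
  have lim: "(\<lambda>n. F n x) \<longlonglongrightarrow> (1 / sqrt (2 * pi)) * (cmod (ft m x))\<^sup>2" for x
  proof -
    have "(\<lambda>n. 1 / sqrt (2 * pi) * exp (- (x / real (Suc n))\<^sup>2 / 2)) \<longlonglongrightarrow> 1 / sqrt (2 * pi) * exp (- 0\<^sup>2 / 2)"
      by (intro tendsto_intros LIMSEQ_Suc lim_const_over_n) auto
    then show ?thesis unfolding F_def std_normal_density_def by (intro tendsto_mult) auto
  qed
  have "(\<integral>\<^sup>+x. ennreal ((1 / sqrt (2 * pi)) * (cmod (ft m x))\<^sup>2) \<partial>lborel) = (\<integral>\<^sup>+x. liminf (\<lambda>n. ennreal (F n x)) \<partial>lborel)"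
    using lim by (intro nn_integral_cong lim_imp_Liminf[symmetric] tendsto_ennrealI) auto
  also have "\<dots> \<le> liminf (\<lambda>n. \<integral>\<^sup>+x. F n x \<partial>lborel)"
    unfolding F_def by (intro nn_integral_liminf) measurable
  also have "\<dots> \<le> ennreal (sqrt (2 * pi) * ?I)"
    using B by (intro Liminf_le) (auto intro!: always_eventually)
  finally have *: "(\<integral>\<^sup>+x. ennreal ((1 / sqrt (2 * pi)) * (cmod (ft m x))\<^sup>2) \<partial>lborel) \<le> ennreal (sqrt (2 * pi) * ?I)" .
  then have i: "integrable lborel (\<lambda>x. (1 / sqrt (2 * pi)) * (cmod (ft m x))\<^sup>2)"
    by (intro integrableI_bounded) (auto simp: top_unique less_top[symmetric])
  from integrable_mult_right[OF this, of "sqrt (2 * pi)"]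
  show 1: "integrable lborel (\<lambda>x. (cmod (ft m x))\<^sup>2)" by simp
  have "(1 / sqrt (2 * pi)) * (LINT x|lborel. (cmod (ft m x))\<^sup>2) \<le> sqrt (2 * pi) * ?I"
    using * i by (subst (asm) nn_integral_eq_integral) auto
  then have "(LINT x|lborel. (cmod (ft m x))\<^sup>2) \<le> sqrt (2 * pi) * (sqrt (2 * pi) * ?I)"
    by (simp add: field_simps)
  then show "(LINT x|lborel. (cmod (ft m x))\<^sup>2) \<le> 2 * pi * ?I"
    by (simp flip: mult.assoc)
qed

text \<open>Dominated convergence with the majorant \<open>B * cmod (p v)\<close>. Finitely many
  discontinuities form a null set, which leaves room for functions cut off sharply at the ends of an
  interval.\<close>

lemma tendsto_acorr:
  fixes p :: "real \<Rightarrow> complex"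
  assumes [measurable]: "p \<in> borel_measurable borel" and p: "integrable lborel p" and B: "\<And>x. cmod (p x) \<le> B"
    and S: "finite S" "\<And>x. x \<notin> S \<Longrightarrow> isCont p x" and t: "t \<longlonglongrightarrow> 0"
  shows "(\<lambda>n. acorr p (t n)) \<longlonglongrightarrow> acorr p 0"
  unfolding acorr_def
proof (rule integral_dominated_convergence[where w="\<lambda>v. B * cmod (p v)"])
  show "integrable lborel (\<lambda>v. B * cmod (p v))" using p by simp
  have "AE v in lborel. v \<notin> S"
    using S(1) by (intro AE_not_in) (auto intro!: finite_imp_null_set_lborel)
  then show "AE v in lborel. (\<lambda>n. p (v + t n) * cnj (p v)) \<longlonglongrightarrow> p (v + 0) * cnj (p v)"
  proof eventually_elim
    case (elim v)
    have "(\<lambda>n. v + t n) \<longlonglongrightarrow> v" using tendsto_add[OF tendsto_const t, of v] by simp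
    from isCont_tendsto_compose[OF S(2)[OF elim] this] show ?case
      by (intro tendsto_mult) auto
  qed
  show "AE v in lborel. cmod (p (v + t n) * cnj (p v)) \<le> B * cmod (p v)" for n
    by (intro AE_I2) (auto simp: norm_mult intro!: mult_right_mono B)
qed measurable

text \<open>Both sides of \<open>gauss_ft_acorr\<close> have limits as the scale tends to 0: the
  right one by continuity of the autocorrelation, the left one by dominated convergence, for which
  \<open>ft_L2_integrable\<close> supplies the majorant.\<close>

lemma plancherel_piecewise:
  fixes p :: "real \<Rightarrow> complex"
  assumes p: "integrable lborel p" and B: "\<And>x. cmod (p x) \<le> B"
    and S: "finite S" "\<And>x. x \<notin> S \<Longrightarrow> isCont p x"
  shows "(LINT x|lborel. (cmod (ft p x))\<^sup>2) = 2 * pi * (LINT x|lborel. (cmod (p x))\<^sup>2)"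
proof -
  have [measurable]: "p \<in> borel_measurable borel"
    using p by (auto dest: borel_measurable_integrable)
  have p2: "integrable lborel (\<lambda>x. (cmod (p x))\<^sup>2)"
  proof (rule Bochner_Integration.integrable_bound)
    show "integrable lborel (\<lambda>x. B * cmod (p x))" using p by simp
    show "AE x in lborel. norm ((cmod (p x))\<^sup>2) \<le> norm (B * cmod (p x))"
      using B by (intro AE_I2) (auto simp: power2_eq_square abs_mult intro!: mult_right_mono order_trans[OF B])
  qed measurable
  define s where "s n = 1 / real (Suc n)" for n
  have s: "s n > 0" for n by (simp add: s_def)
  have s0: "s \<longlonglongrightarrow> 0" unfolding s_def by (intro LIMSEQ_Suc lim_const_over_n)
  have "(\<lambda>n. CLINT z|stdn. acorr p (s n * z)) \<longlonglongrightarrow> (CLINT z|stdn. acorr p 0)"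
  proof (rule integral_dominated_convergence[where w="\<lambda>_. LINT x|lborel. (cmod (p x))\<^sup>2"])
    show "AE z in stdn. (\<lambda>n. acorr p (s n * z)) \<longlonglongrightarrow> acorr p 0"
      by (intro AE_I2 tendsto_acorr[OF _ p B S] tendsto_mult_left_zero s0) measurable
  qed (auto intro!: norm_acorr_le p2)
  moreover have "(CLINT z|stdn. acorr p 0) = acorr p 0"
    using stdn.prob_space by simp
  moreover have "acorr p 0 = complex_of_real (LINT x|lborel. (cmod (p x))\<^sup>2)"
    unfolding acorr_def integral_complex_of_real[symmetric]
    by (simp add: complex_norm_square del: of_real_power)
  ultimately have "(\<lambda>n. sqrt (2 * pi) * Re (CLINT z|stdn. acorr p (s n * z))) \<longlonglongrightarrow>
      sqrt (2 * pi) * (LINT x|lborel. (cmod (p x))\<^sup>2)"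
    using tendsto_Re by (intro tendsto_mult tendsto_const) fastforce
  then have R: "(\<lambda>n. LINT x|lborel. std_normal_density (s n * x) * (cmod (ft p x))\<^sup>2) \<longlonglongrightarrow>
      sqrt (2 * pi) * (LINT x|lborel. (cmod (p x))\<^sup>2)"
    by (simp add: gauss_ft_acorr[OF p p2 s])
  have L: "(\<lambda>n. LINT x|lborel. std_normal_density (s n * x) * (cmod (ft p x))\<^sup>2) \<longlonglongrightarrow>
      (LINT x|lborel. std_normal_density 0 * (cmod (ft p x))\<^sup>2)"
  proof (rule integral_dominated_convergence[where w="\<lambda>x. std_normal_density 0 * (cmod (ft p x))\<^sup>2"])
    show "integrable lborel (\<lambda>x. std_normal_density 0 * (cmod (ft p x))\<^sup>2)"
      using ft_L2_integrable[OF p p2] by simp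
    show "AE x in lborel. (\<lambda>n. std_normal_density (s n * x) * (cmod (ft p x))\<^sup>2) \<longlonglongrightarrow> std_normal_density 0 * (cmod (ft p x))\<^sup>2"
    proof (rule AE_I2)
      fix x
      have "(\<lambda>n. 1 / sqrt (2 * pi) * exp (- (s n * x)\<^sup>2 / 2)) \<longlonglongrightarrow> 1 / sqrt (2 * pi) * exp (- 0\<^sup>2 / 2)"
        by (intro tendsto_intros tendsto_mult_left_zero s0) auto
      then show "(\<lambda>n. std_normal_density (s n * x) * (cmod (ft p x))\<^sup>2) \<longlonglongrightarrow> std_normal_density 0 * (cmod (ft p x))\<^sup>2"
        unfolding std_normal_density_def by (rule tendsto_mult[OF _ tendsto_const])
    qed
    show "AE x in lborel. norm (std_normal_density (s n * x) * (cmod (ft p x))\<^sup>2) \<le> std_normal_density 0 * (cmod (ft p x))\<^sup>2" for n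
      by (intro AE_I2) (auto simp: std_normal_density_def abs_mult intro!: divide_right_mono mult_left_le_one_le)
  qed auto
  from LIMSEQ_unique[OF R L]
  have "sqrt (2 * pi) * (LINT x|lborel. (cmod (p x))\<^sup>2) = (LINT x|lborel. (cmod (ft p x))\<^sup>2) / sqrt (2 * pi)"
    by (simp add: std_normal_density_def)
  then have "(LINT x|lborel. (cmod (ft p x))\<^sup>2) = sqrt (2 * pi) * (sqrt (2 * pi) * (LINT x|lborel. (cmod (p x))\<^sup>2))"
    by (simp add: field_simps)
  then show ?thesis by (simp flip: mult.assoc)
qed

section \<open>Approximation in L2 by bounded, piecewise continuous functions\<close>

definition clamp0 :: "real \<Rightarrow> complex \<Rightarrow> complex" where
  "clamp0 R z = (R / max R (cmod z)) *\<^sub>R z"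

lemma continuous_clamp0: "R > 0 \<Longrightarrow> continuous_on UNIV (clamp0 R)"
  unfolding clamp0_def by (intro continuous_intros) (auto simp: max_def)

lemma norm_clamp0_le: "R > 0 \<Longrightarrow> cmod (clamp0 R z) \<le> R" "R > 0 \<Longrightarrow> cmod (clamp0 R z) \<le> cmod z"
  unfolding clamp0_def by (auto simp: max_def divide_simps mult_left_le_one_le)

lemma clamp0_eq: "R > 0 \<Longrightarrow> cmod z \<le> R \<Longrightarrow> clamp0 R z = z"
  unfolding clamp0_def by (auto simp: max_def)

lemma cmod_add_square_le: "(cmod (a + b))\<^sup>2 \<le> 2 * (cmod a)\<^sup>2 + 2 * (cmod b)\<^sup>2"
proof -
  have "(cmod (a + b))\<^sup>2 \<le> (cmod a + cmod b)\<^sup>2" by (intro power_mono norm_triangle_ineq) auto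
  also have "\<dots> \<le> 2 * (cmod a)\<^sup>2 + 2 * (cmod b)\<^sup>2"
    using sum_squares_bound[of "cmod a" "cmod b"] by (simp add: power2_sum)
  finally show ?thesis .
qed

lemma integrable_square_add:
  fixes a b :: "'a \<Rightarrow> complex"
  assumes [measurable]: "a \<in> borel_measurable M" "b \<in> borel_measurable M"
    and i: "integrable M (\<lambda>x. (cmod (a x))\<^sup>2)" "integrable M (\<lambda>x. (cmod (b x))\<^sup>2)"
  shows "integrable M (\<lambda>x. (cmod (a x + b x))\<^sup>2)"
proof (rule Bochner_Integration.integrable_bound)
  show "integrable M (\<lambda>x. 2 * (cmod (a x))\<^sup>2 + 2 * (cmod (b x))\<^sup>2)" using i by simp
  show "AE x in M. norm ((cmod (a x + b x))\<^sup>2) \<le> norm (2 * (cmod (a x))\<^sup>2 + 2 * (cmod (b x))\<^sup>2)"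
    using cmod_add_square_le by (intro AE_I2) auto
qed measurable

lemma integrable_square_diff:
  fixes a b :: "'a \<Rightarrow> complex"
  assumes "a \<in> borel_measurable M" "b \<in> borel_measurable M"
    "integrable M (\<lambda>x. (cmod (a x))\<^sup>2)" "integrable M (\<lambda>x. (cmod (b x))\<^sup>2)"
  shows "integrable M (\<lambda>x. (cmod (a x - b x))\<^sup>2)"
  using integrable_square_add[of a M "\<lambda>x. - b x"] assms by simp

text \<open>Two approximations by dominated convergence. Cutting \<open>m\<close> to height and
  half-width n + 1 gives \<open>q n\<close>, close to \<open>m\<close>. Then continuous functions
  converging to \<open>m\<close> almost everywhere are clamped radially and restricted to the same
  interval; clamping is continuous, so the ends of the interval are the only discontinuities, and
  the fixed height provides a majorant.\<close>

lemma piecewise_dense: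
  fixes m :: "real \<Rightarrow> complex"
  assumes m[measurable]: "m \<in> borel_measurable borel" and m2: "integrable lborel (\<lambda>x. (cmod (m x))\<^sup>2)" and e: "e > 0"
  obtains p B S where "integrable lborel p" "\<And>x. cmod (p x) \<le> B" "finite S" "\<And>x. x \<notin> S \<Longrightarrow> isCont p x"
    "integrable lborel (\<lambda>x. (cmod (p x))\<^sup>2)" "(LINT x|lborel. (cmod (m x - p x))\<^sup>2) < e"
proof -
  define q where "q n x = indicator {- real (Suc n)..real (Suc n)} x *\<^sub>R clamp0 (real (Suc n)) (m x)" for n x
  have [measurable]: "clamp0 (real (Suc n)) \<in> borel_measurable borel" for n
    by (intro borel_measurable_continuous_onI continuous_clamp0) simp
  have [measurable]: "q n \<in> borel_measurable borel" for n unfolding q_def by measurable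
  have q_le: "cmod (q n x) \<le> cmod (m x)" "cmod (q n x) \<le> real (Suc n)" for n x
    unfolding q_def using norm_clamp0_le[of "real (Suc n)" "m x"] by (auto simp: indicator_def)
  have "(\<lambda>n. LINT x|lborel. (cmod (m x - q n x))\<^sup>2) \<longlonglongrightarrow> (LINT x|(lborel :: real measure). (0 :: real))"
  proof (rule integral_dominated_convergence[where w="\<lambda>x. 4 * (cmod (m x))\<^sup>2"])
    show "AE x in lborel. (\<lambda>n. (cmod (m x - q n x))\<^sup>2) \<longlonglongrightarrow> 0"
    proof (intro AE_I2)
      fix x
      obtain N where N: "\<bar>x\<bar> \<le> real N" "cmod (m x) \<le> real N"
        using real_arch_simple[of "max \<bar>x\<bar> (cmod (m x))"] by auto
      have "\<forall>\<^sub>F n in sequentially. 0 = (cmod (m x - q n x))\<^sup>2"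
        using eventually_ge_at_top[of N]
      proof eventually_elim
        case (elim n)
        then have "\<bar>x\<bar> \<le> real (Suc n)" "cmod (m x) \<le> real (Suc n)" using N by auto
        then show ?case unfolding q_def by (auto simp: clamp0_eq indicator_def)
      qed
      then show "(\<lambda>n. (cmod (m x - q n x))\<^sup>2) \<longlonglongrightarrow> 0" by (rule Lim_transform_eventually[OF tendsto_const])
    qed
    show "AE x in lborel. norm ((cmod (m x - q n x))\<^sup>2) \<le> 4 * (cmod (m x))\<^sup>2" for n
    proof (intro AE_I2)
      fix x
      have "(cmod (m x - q n x))\<^sup>2 \<le> 2 * (cmod (m x))\<^sup>2 + 2 * (cmod (q n x))\<^sup>2"
        using cmod_add_square_le[of "m x" "- q n x"] by simp
      also have "\<dots> \<le> 4 * (cmod (m x))\<^sup>2" using power_mono[OF q_le(1)[of n x], of 2] by simp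
      finally show "norm ((cmod (m x - q n x))\<^sup>2) \<le> 4 * (cmod (m x))\<^sup>2" by simp
    qed
  qed (use m2 in auto)
  then have "\<forall>\<^sub>F n in sequentially. (LINT x|lborel. (cmod (m x - q n x))\<^sup>2) < e / 4"
    using e by (intro order_tendstoD) auto
  then obtain n where n: "(LINT x|lborel. (cmod (m x - q n x))\<^sup>2) < e / 4"
    by (auto simp: eventually_sequentially)
  let ?R = "real (Suc n)"
  \<comment> \<open>Measurability in the sense of \<open>measurable_on\<close> yields continuous
    functions that converge to \<open>m\<close> off a negligible set.\<close>
  have "m \<in> borel_measurable lebesgue" by (rule measurable_completion) simp
  then have "m measurable_on UNIV"
    using lebesgue_measurable_imp_measurable_on[of m] by simp
  then obtain N g where N: "negligible N" and g: "\<And>k. continuous_on UNIV (g k)"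
    and lim: "\<And>x. x \<notin> N \<Longrightarrow> (\<lambda>k. g k x) \<longlonglongrightarrow> m x"
    unfolding measurable_on_def by auto
  define p where "p k x = indicator {- ?R..?R} x *\<^sub>R clamp0 ?R (g k x)" for k x
  have cg: "continuous_on UNIV (\<lambda>x. clamp0 ?R (g k x))" for k
    by (rule continuous_on_compose2[OF continuous_clamp0 g]) auto
  then have [measurable]: "(\<lambda>x. clamp0 ?R (g k x)) \<in> borel_measurable borel" for k
    by (rule borel_measurable_continuous_onI)
  have [measurable]: "p k \<in> borel_measurable borel" for k unfolding p_def by measurable
  have p_le: "cmod (p k x) \<le> indicator {- ?R..?R} x * ?R" for k x
    unfolding p_def using norm_clamp0_le[of ?R "g k x"] by (auto simp: indicator_def)
  have p_cont: "isCont (p k) x" if "x \<notin> {- ?R, ?R}" for k x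
    unfolding p_def
  proof (intro continuous_intros)
    have "{- ?R<..<?R} \<noteq> {}" by (simp add: greaterThanLessThan_empty_iff)
    then show "isCont (indicator {- ?R..?R} :: real \<Rightarrow> real) x"
      using that by (subst isCont_indicator) (auto simp: frontier_def)
    show "isCont (\<lambda>x. clamp0 ?R (g k x)) x" using cg by (simp add: continuous_on_eq_continuous_at)
  qed
  have ip: "integrable lborel (p k)" for k
  proof (rule Bochner_Integration.integrable_bound)
    show "integrable lborel (\<lambda>x. indicator {- ?R..?R} x * ?R)" by simp
    show "AE x in lborel. norm (p k x) \<le> norm (indicator {- ?R..?R} x * ?R)"
      using p_le by (intro AE_I2) (auto intro: order_trans[OF _ abs_ge_self])
  qed measurable
  have i2: "integrable lborel (\<lambda>x. indicator {- ?R..?R} x * C :: real)" for C by simp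
  have ip2: "integrable lborel (\<lambda>x. (cmod (p k x))\<^sup>2)" for k
  proof (rule Bochner_Integration.integrable_bound[OF i2[of "?R\<^sup>2"]])
    show "AE x in lborel. norm ((cmod (p k x))\<^sup>2) \<le> norm (indicator {- ?R..?R} x * ?R\<^sup>2)"
    proof (intro AE_I2)
      fix x
      show "norm ((cmod (p k x))\<^sup>2) \<le> norm (indicator {- ?R..?R} x * ?R\<^sup>2)"
        using power_mono[OF p_le[of k x], of 2] by (cases "x \<in> {- ?R..?R}") auto
    qed
  qed measurable
  have iq2: "integrable lborel (\<lambda>x. (cmod (q n x))\<^sup>2)"
    by (rule Bochner_Integration.integrable_bound[OF m2]) (auto intro!: AE_I2 power_mono q_le)
  have "(\<lambda>k. LINT x|lborel. (cmod (q n x - p k x))\<^sup>2) \<longlonglongrightarrow> (LINT x|(lborel :: real measure). (0 :: real))"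
  proof (rule integral_dominated_convergence[where w="\<lambda>x. indicator {- ?R..?R} x * (4 * ?R\<^sup>2)"])
    have "AE x in lborel. x \<notin> N"
      using N AE_not_in[of N lebesgue] by (simp add: negligible_iff_null_sets AE_completion_iff)
    then show "AE x in lborel. (\<lambda>k. (cmod (q n x - p k x))\<^sup>2) \<longlonglongrightarrow> 0"
    proof eventually_elim
      case (elim x)
      have "(\<lambda>k. clamp0 ?R (g k x)) \<longlonglongrightarrow> clamp0 ?R (m x)"
        by (rule continuous_on_tendsto_compose[OF continuous_clamp0 lim[OF elim]]) auto
      then have "(\<lambda>k. (cmod (q n x - p k x))\<^sup>2) \<longlonglongrightarrow> (cmod (q n x - indicator {- ?R..?R} x *\<^sub>R clamp0 ?R (m x)))\<^sup>2"
        unfolding p_def by (intro tendsto_intros)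
      then show ?case by (simp add: q_def)
    qed
    show "AE x in lborel. norm ((cmod (q n x - p k x))\<^sup>2) \<le> indicator {- ?R..?R} x * (4 * ?R\<^sup>2)" for k
    proof (intro AE_I2)
      fix x
      have "(cmod (q n x - p k x))\<^sup>2 \<le> 2 * (cmod (q n x))\<^sup>2 + 2 * (cmod (p k x))\<^sup>2"
        using cmod_add_square_le[of "q n x" "- p k x"] by simp
      also have "\<dots> \<le> indicator {- ?R..?R} x * (4 * ?R\<^sup>2)"
      proof (cases "x \<in> {- ?R..?R}")
        case True
        then have "cmod (p k x) \<le> ?R" using p_le[of k x] by simp
        then have "(cmod (p k x))\<^sup>2 \<le> ?R\<^sup>2" "(cmod (q n x))\<^sup>2 \<le> ?R\<^sup>2"
          using q_le(2)[of n x] by (auto intro!: power_mono simp del: of_nat_Suc)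
        then have "2 * (cmod (q n x))\<^sup>2 + 2 * (cmod (p k x))\<^sup>2 \<le> 4 * ?R\<^sup>2" by linarith
        then show ?thesis using True by simp
      qed (simp add: p_def q_def)
      finally show "norm ((cmod (q n x - p k x))\<^sup>2) \<le> indicator {- ?R..?R} x * (4 * ?R\<^sup>2)" by simp
    qed
  qed auto
  then have "\<forall>\<^sub>F k in sequentially. (LINT x|lborel. (cmod (q n x - p k x))\<^sup>2) < e / 4"
    using e by (intro order_tendstoD) auto
  then obtain k where k: "(LINT x|lborel. (cmod (q n x - p k x))\<^sup>2) < e / 4"
    by (auto simp: eventually_sequentially)
  have mq: "integrable lborel (\<lambda>x. (cmod (m x - q n x))\<^sup>2)" and qp: "integrable lborel (\<lambda>x. (cmod (q n x - p k x))\<^sup>2)"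
    and mp: "integrable lborel (\<lambda>x. (cmod (m x - p k x))\<^sup>2)"
    by (intro integrable_square_diff m2 iq2 ip2; measurable)+
  have "(LINT x|lborel. (cmod (m x - p k x))\<^sup>2) \<le> (LINT x|lborel. 2 * (cmod (m x - q n x))\<^sup>2 + 2 * (cmod (q n x - p k x))\<^sup>2)"
    using mq qp mp cmod_add_square_le[of "m x - q n x" "q n x - p k x" for x] by (intro integral_mono) auto
  also have "\<dots> < e" using mq qp n k by simp
  finally have "(LINT x|lborel. (cmod (m x - p k x))\<^sup>2) < e" .
  moreover have "cmod (p k x) \<le> ?R" for x
    using p_le[of k x] by (cases "x \<in> {- ?R..?R}") auto
  ultimately show thesis
    using ip[of k] ip2[of k] p_cont[of _ k]
    by (intro that[of "p k" ?R "{- ?R, ?R}"]) auto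
qed

section \<open>Plancherel's identity and its polarised form\<close>

lemma integral_square_perturb:
  fixes a b :: "'a \<Rightarrow> complex"
  assumes [measurable]: "a \<in> borel_measurable M" "b \<in> borel_measurable M"
    and i: "integrable M (\<lambda>x. (cmod (a x))\<^sup>2)" "integrable M (\<lambda>x. (cmod (b x))\<^sup>2)" and \<eta>: "\<eta> > 0"
  shows "(LINT x|M. (cmod (a x))\<^sup>2) \<le> (1 + \<eta>) * (LINT x|M. (cmod (b x))\<^sup>2) + (1 + 1 / \<eta>) * (LINT x|M. (cmod (a x - b x))\<^sup>2)"
proof -
  have d: "integrable M (\<lambda>x. (cmod (a x - b x))\<^sup>2)" by (intro integrable_square_diff i) measurable
  have "(cmod u)\<^sup>2 \<le> (1 + \<eta>) * (cmod v)\<^sup>2 + (1 + 1 / \<eta>) * (cmod (u - v))\<^sup>2" for u v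
  proof -
    let ?v = "cmod v" and ?d = "cmod (u - v)"
    have "(cmod u)\<^sup>2 \<le> (?v + ?d)\<^sup>2"
      using norm_triangle_ineq[of v "u - v"] by (intro power_mono) auto
    moreover have "0 \<le> (\<eta> * ?v - ?d)\<^sup>2 / \<eta>" using \<eta> by simp
    then have "0 \<le> \<eta> * ?v\<^sup>2 - 2 * ?v * ?d + ?d\<^sup>2 / \<eta>"
      using \<eta> by (simp add: power2_diff field_simps power2_eq_square)
    ultimately show ?thesis by (simp add: power2_sum field_simps)
  qed
  then have "(LINT x|M. (cmod (a x))\<^sup>2) \<le> (LINT x|M. (1 + \<eta>) * (cmod (b x))\<^sup>2 + (1 + 1 / \<eta>) * (cmod (a x - b x))\<^sup>2)"
    using i d by (intro integral_mono) auto
  also have "\<dots> = (1 + \<eta>) * (LINT x|M. (cmod (b x))\<^sup>2) + (1 + 1 / \<eta>) * (LINT x|M. (cmod (a x - b x))\<^sup>2)"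
    using i d by (subst Bochner_Integration.integral_add) auto
  finally show ?thesis .
qed

text \<open>The upper bound is \<open>ft_L2_le\<close>. For the lower one, \<open>m\<close> is
  replaced by a nearby function for which equality is known, and the upper bound is used once more,
  for the transform of the difference.\<close>

lemma plancherel_norm:
  fixes m :: "real \<Rightarrow> complex"
  assumes m: "integrable lborel m" and m2: "integrable lborel (\<lambda>x. (cmod (m x))\<^sup>2)"
  shows "(LINT x|lborel. (cmod (ft m x))\<^sup>2) = 2 * pi * (LINT x|lborel. (cmod (m x))\<^sup>2)" (is "?J = 2 * pi * ?I")
proof (rule antisym)
  show "?J \<le> 2 * pi * ?I" by (rule ft_L2_le[OF m m2])
  have [measurable]: "m \<in> borel_measurable borel"
    using m by (auto dest: borel_measurable_integrable)
  have bound: "2 * pi * ?I \<le> (1 + \<eta>)\<^sup>2 * ?J + 2 * pi * (\<eta> * (1 + \<eta>) * (2 + \<eta>))" if \<eta>: "\<eta> > 0" for \<eta>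
  proof -
    \<comment> \<open>The tolerance \<eta>^2 outweighs the factor 1 + 1 / \<eta> of
      \<open>integral_square_perturb\<close>: the total error is of order \<eta>.\<close>
    obtain p B S where p: "integrable lborel p" "\<And>x. cmod (p x) \<le> B" "finite S" "\<And>x. x \<notin> S \<Longrightarrow> isCont p x"
      "integrable lborel (\<lambda>x. (cmod (p x))\<^sup>2)" "(LINT x|lborel. (cmod (m x - p x))\<^sup>2) < \<eta>\<^sup>2"
      using piecewise_dense[OF _ m2, of "\<eta>\<^sup>2"] \<eta> by auto
    have [measurable]: "p \<in> borel_measurable borel"
      using p by (auto dest: borel_measurable_integrable)
    let ?E = "LINT x|lborel. (cmod (m x - p x))\<^sup>2"
    let ?K = "LINT x|lborel. (cmod (p x))\<^sup>2" and ?F = "LINT x|lborel. (cmod (ft p x - ft m x))\<^sup>2"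
    have "?F = (LINT x|lborel. (cmod (ft (\<lambda>u. m u - p u) x))\<^sup>2)"
      using ft_diff[OF m p(1)] by (simp add: norm_minus_commute)
    also have "\<dots> \<le> 2 * pi * ?E"
      by (intro ft_L2_le integrable_square_diff Bochner_Integration.integrable_diff m m2 p) measurable
    finally have F: "?F \<le> 2 * pi * ?E" .
    have "2 * pi * ?I \<le> 2 * pi * ((1 + \<eta>) * ?K + (1 + 1 / \<eta>) * ?E)"
      using integral_square_perturb[OF _ _ m2 p(5) \<eta>] by simp
    also have "\<dots> = (1 + \<eta>) * (LINT x|lborel. (cmod (ft p x))\<^sup>2) + 2 * pi * ((1 + 1 / \<eta>) * ?E)"
      by (simp add: plancherel_piecewise[OF p(1-4)] algebra_simps)
    also have "\<dots> \<le> (1 + \<eta>) * ((1 + \<eta>) * ?J + (1 + 1 / \<eta>) * ?F) + 2 * pi * ((1 + 1 / \<eta>) * ?E)"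
      using \<eta> by (intro add_mono mult_left_mono integral_square_perturb ft_L2_integrable m m2 p) auto
    also have "\<dots> \<le> (1 + \<eta>) * ((1 + \<eta>) * ?J + (1 + 1 / \<eta>) * (2 * pi * ?E)) + 2 * pi * ((1 + 1 / \<eta>) * ?E)"
      using \<eta> F by (intro add_mono mult_left_mono) auto
    also have "\<dots> = (1 + \<eta>)\<^sup>2 * ?J + 2 * pi * ((1 + 1 / \<eta>) * (2 + \<eta>)) * ?E"
      using \<eta> by (simp add: field_simps power2_eq_square)
    also have "\<dots> \<le> (1 + \<eta>)\<^sup>2 * ?J + 2 * pi * ((1 + 1 / \<eta>) * (2 + \<eta>)) * \<eta>\<^sup>2"
      using \<eta> p(6) by (intro add_mono mult_left_mono) auto
    also have "\<dots> = (1 + \<eta>)\<^sup>2 * ?J + 2 * pi * (\<eta> * (1 + \<eta>) * (2 + \<eta>))"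
      using \<eta> by (simp add: field_simps power2_eq_square)
    finally show ?thesis .
  qed
  have "((\<lambda>\<eta>. (1 + \<eta>)\<^sup>2 * ?J + 2 * pi * (\<eta> * (1 + \<eta>) * (2 + \<eta>))) \<longlongrightarrow> (1 + 0)\<^sup>2 * ?J + 2 * pi * (0 * (1 + 0) * (2 + 0))) (at_right 0)"
    by (intro tendsto_intros)
  moreover have "\<forall>\<^sub>F \<eta> in at_right 0. 2 * pi * ?I \<le> (1 + \<eta>)\<^sup>2 * ?J + 2 * pi * (\<eta> * (1 + \<eta>) * (2 + \<eta>))"
    using bound by (auto simp: eventually_at_right_less intro: eventually_mono[OF eventually_at_right_less])
  ultimately show "2 * pi * ?I \<le> ?J"
    using tendsto_lowerbound by fastforce
qed

lemma polarization:
  "4 * (a * cnj b) = (complex_of_real ((cmod (a + b))\<^sup>2) - complex_of_real ((cmod (a - b))\<^sup>2))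
     + \<i> * (complex_of_real ((cmod (a + \<i> * b))\<^sup>2) - complex_of_real ((cmod (a - \<i> * b))\<^sup>2))"
  unfolding complex_norm_square complex_cnj_add complex_cnj_diff complex_cnj_mult complex_cnj_i
  by (simp add: algebra_simps)

text \<open>\<open>polarization\<close> expresses the scalar product through the squared norms of m
  + c * p for the four units c = 1, -1, \<i>, -\<i>, and \<open>plancherel_norm\<close> applies to
  each of them.\<close>

lemma plancherel:
  fixes m p :: "real \<Rightarrow> complex"
  assumes m: "integrable lborel m" "integrable lborel (\<lambda>x. (cmod (m x))\<^sup>2)"
    and p: "integrable lborel p" "integrable lborel (\<lambda>x. (cmod (p x))\<^sup>2)"
  shows "(CLINT x|lborel. ft m x * cnj (ft p x)) = 2 * pi * (CLINT x|lborel. m x * cnj (p x))"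
proof -
  have [measurable]: "m \<in> borel_measurable borel" "p \<in> borel_measurable borel"
    using m p by (auto dest: borel_measurable_integrable)
  have pol: "4 * (CLINT x|lborel. a x * cnj (b x)) =
     (complex_of_real (LINT x|lborel. (cmod (a x + b x))\<^sup>2) - complex_of_real (LINT x|lborel. (cmod (a x - b x))\<^sup>2))
     + \<i> * (complex_of_real (LINT x|lborel. (cmod (a x + \<i> * b x))\<^sup>2) - complex_of_real (LINT x|lborel. (cmod (a x - \<i> * b x))\<^sup>2))"
    if [measurable]: "a \<in> borel_measurable borel" "b \<in> borel_measurable borel"
      and i: "integrable lborel (\<lambda>x. (cmod (a x))\<^sup>2)" "integrable lborel (\<lambda>x. (cmod (b x))\<^sup>2)"
    for a b :: "real \<Rightarrow> complex"
  proof -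
    have j: "integrable lborel (\<lambda>x. (cmod (a x + b x))\<^sup>2)" "integrable lborel (\<lambda>x. (cmod (a x - b x))\<^sup>2)"
      "integrable lborel (\<lambda>x. (cmod (a x + \<i> * b x))\<^sup>2)" "integrable lborel (\<lambda>x. (cmod (a x - \<i> * b x))\<^sup>2)"
      using i by (auto intro!: integrable_square_add integrable_square_diff simp: norm_mult)
    have "4 * (CLINT x|lborel. a x * cnj (b x)) = (CLINT x|lborel. 4 * (a x * cnj (b x)))" by simp
    then show ?thesis
      unfolding polarization
      using j[THEN integrable_of_real[where 'a=complex]] by (simp del: of_real_power)
  qed
  have ip: "integrable lborel (\<lambda>x. \<i> * p x)" using p by simp
  have shift: "ft m x + \<i> * ft p x = ft (\<lambda>u. m u + \<i> * p u) x" "ft m x - \<i> * ft p x = ft (\<lambda>u. m u - \<i> * p u) x"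
    "ft m x + ft p x = ft (\<lambda>u. m u + p u) x" "ft m x - ft p x = ft (\<lambda>u. m u - p u) x" for x
    using m p by (simp_all add: ft_add ft_diff ft_cmult)
  have pl: "(LINT x|lborel. (cmod (ft (\<lambda>u. m u + c * p u) x))\<^sup>2) = 2 * pi * (LINT x|lborel. (cmod (m x + c * p x))\<^sup>2)" for c
    by (intro plancherel_norm integrable_square_add) (use m p in \<open>auto simp: norm_mult power_mult_distrib\<close>)
  have "4 * (CLINT x|lborel. ft m x * cnj (ft p x)) = 4 * (2 * pi * (CLINT x|lborel. m x * cnj (p x)))"
    using pl[of 1] pl[of "-1"] pl[of \<i>] pl[of "-\<i>"]
    unfolding pol[OF ft_measurable ft_measurable ft_L2_integrable ft_L2_integrable, OF \<open>m \<in> _\<close> \<open>p \<in> _\<close> m p]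
      mult.left_commute[of 4] pol[OF \<open>m \<in> _\<close> \<open>p \<in> _\<close> m(2) p(2)] shift
    by (simp add: algebra_simps)
  then show ?thesis by simp
qed

section \<open>Independent samples and degenerate U-statistics\<close>

abbreviation iid :: "'a measure \<Rightarrow> nat \<Rightarrow> (nat \<Rightarrow> 'a) measure" where
  "iid M n \<equiv> PiM {1..n} (\<lambda>_. M)"

context prob_space
begin

lemma product_sigma_finite_iid: "product_sigma_finite (\<lambda>_::nat. M)"
  by (simp add: product_sigma_finite_def sigma_finite_measure_axioms)

lemma prob_space_iid: "prob_space (iid M n)"
  by (rule prob_space_PiM) (rule prob_space_axioms)

lemma insert_Suc_interval: "{1..Suc n} = insert (Suc n) {1..n}"
  by auto

lemma integrable_iid_bounded:
  fixes F :: "(nat \<Rightarrow> 'a) \<Rightarrow> real"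
  assumes "F \<in> borel_measurable (iid M n)" "\<And>Y. \<bar>F Y\<bar> \<le> B"
  shows "integrable (iid M n) F"
  by (rule finite_measure.integrable_const_bound[where B=B])
    (use assms prob_space_iid prob_space.finite_measure in auto)

lemma integral_iid_Suc:
  fixes F :: "(nat \<Rightarrow> 'a) \<Rightarrow> real"
  assumes "F \<in> borel_measurable (iid M (Suc n))" "\<And>Y. \<bar>F Y\<bar> \<le> B"
  shows "(\<integral>Y. F Y \<partial>iid M (Suc n)) = (\<integral>Y. (\<integral>y. F (Y(Suc n := y)) \<partial>M) \<partial>iid M n)"
  using integrable_iid_bounded[OF assms] unfolding insert_Suc_interval
  by (intro product_sigma_finite.product_integral_insert product_sigma_finite_iid) auto

lemma nn_integral_iid_Suc:
  assumes "F \<in> borel_measurable (iid M (Suc n))"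
  shows "(\<integral>\<^sup>+Y. F Y \<partial>iid M (Suc n)) = (\<integral>\<^sup>+Y. (\<integral>\<^sup>+y. F (Y(Suc n := y)) \<partial>M) \<partial>iid M n)"
  using assms unfolding insert_Suc_interval
  by (intro product_sigma_finite.product_nn_integral_insert product_sigma_finite_iid) auto

text \<open>The opposite order of integration to \<open>integral_iid_Suc\<close>: with the last
  observation held fixed, the earlier ones form a sample to which moment formulas for independent
  sums apply.\<close>

lemma integral_iid_Suc_last:
  fixes F :: "(nat \<Rightarrow> 'a) \<Rightarrow> real"
  assumes "F \<in> borel_measurable (iid M (Suc n))" "\<And>Y. \<bar>F Y\<bar> \<le> B"
  shows "(\<integral>Y. F Y \<partial>iid M (Suc n)) = (\<integral>y. (\<integral>Y. F (Y(Suc n := y)) \<partial>iid M n) \<partial>M)"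
proof -
  interpret Y: prob_space "iid M n" by (rule prob_space_iid)
  interpret P: pair_prob_space "iid M n" M ..
  have [measurable]: "F \<in> borel_measurable (PiM (insert (Suc n) {1..n}) (\<lambda>_. M))"
    using assms(1) unfolding insert_Suc_interval .
  have "(\<lambda>(Y, y). F (Y(Suc n := y))) \<in> borel_measurable (iid M n \<Otimes>\<^sub>M M)"
    by measurable
  then have "integrable (iid M n \<Otimes>\<^sub>M M) (\<lambda>(Y, y). F (Y(Suc n := y)))"
    by (rule P.P.integrable_const_bound[where B=B, rotated]) (use assms(2) in auto)
  from P.Fubini_integral[OF this] show ?thesis
    unfolding integral_iid_Suc[OF assms] by simp
qed

lemma sum_measurable_iid:
  fixes q :: "'a \<Rightarrow> real"
  assumes [measurable]: "q \<in> borel_measurable M"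
  shows "(\<lambda>Y. \<Sum>k=1..n. q (Y k)) \<in> borel_measurable (iid M n)"
  by measurable

lemma sum_iid_bounded:
  fixes q :: "'a \<Rightarrow> real"
  assumes "\<And>x. \<bar>q x\<bar> \<le> A"
  shows "\<bar>\<Sum>k=1..n. q (Y k)\<bar> \<le> real n * A"
proof -
  have "\<bar>\<Sum>k=1..n. q (Y k)\<bar> \<le> (\<Sum>k=1..n. \<bar>q (Y k)\<bar>)" by (rule sum_abs)
  also have "\<dots> \<le> real (card {1..n}) * A" using assms by (intro sum_bounded_above)
  finally show ?thesis by simp
qed

lemma sum_upd_Suc:
  fixes q :: "'a \<Rightarrow> real"
  shows "(\<Sum>k=1..Suc n. q ((Y(Suc n := y)) k)) = (\<Sum>k=1..n. q (Y k)) + q y"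
proof -
  have "(\<Sum>k=1..n. q ((Y(Suc n := y)) k)) = (\<Sum>k=1..n. q (Y k))" by (rule sum.cong) auto
  then show ?thesis by simp
qed

lemma power_bounded: "\<bar>x\<bar> \<le> B \<Longrightarrow> \<bar>x ^ p\<bar> \<le> B ^ p" for x :: real
  by (simp add: power_abs power_mono)

text \<open>Induction on n, integrating out the last summand. Terms linear in it vanish by
  \<open>q0\<close>, and the term with its third moment vanishes because the partial sum is centred.
  With e2 and e4 the second and fourth moments of \<open>q\<close>, the fourth moment grows by 6 * n
  * e2^2 + e4, and 3 * n^2 + 6 * n is at most 3 * (n + 1)^2.\<close>

lemma
  fixes q :: "'a \<Rightarrow> real"
  assumes q[measurable]: "q \<in> borel_measurable M" and A: "\<And>x. \<bar>q x\<bar> \<le> A" and q0: "expectation q = 0"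
  shows iid_sum_square: "(\<integral>Y. (\<Sum>k=1..n. q (Y k))\<^sup>2 \<partial>iid M n) = real n * expectation (\<lambda>x. (q x)\<^sup>2)"
    and iid_sum_fourth: "(\<integral>Y. (\<Sum>k=1..n. q (Y k)) ^ 4 \<partial>iid M n)
      \<le> real n * expectation (\<lambda>x. q x ^ 4) + 3 * (real n)\<^sup>2 * (expectation (\<lambda>x. (q x)\<^sup>2))\<^sup>2"
proof -
  let ?S = "\<lambda>n Y. \<Sum>k=1..n. q (Y k)"
  let ?e2 = "expectation (\<lambda>x. (q x)\<^sup>2)" and ?e3 = "expectation (\<lambda>x. q x ^ 3)" and ?e4 = "expectation (\<lambda>x. q x ^ 4)"
  have i: "integrable M (\<lambda>x. q x ^ p)" for p
    by (rule integrable_const_bound[where B="A ^ p"]) (auto simp: power_abs intro!: power_mono A)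
  have i1: "integrable M q" using i[of 1] by simp
  have S: "integrable (iid M n) (\<lambda>Y. ?S n Y ^ p)" for n p
    by (intro integrable_iid_bounded[where B="(real n * A) ^ p"] power_bounded sum_iid_bounded A) measurable
  have S1: "integrable (iid M n) (?S n)" for n using S[of n 1] by simp
  have step: "(\<integral>Y. ?S (Suc n) Y ^ p \<partial>iid M (Suc n)) = (\<integral>Y. (\<integral>y. (?S n Y + q y) ^ p \<partial>M) \<partial>iid M n)" for n p
  proof -
    have "(\<integral>Y. ?S (Suc n) Y ^ p \<partial>iid M (Suc n)) = (\<integral>Y. (\<integral>y. ?S (Suc n) (Y(Suc n := y)) ^ p \<partial>M) \<partial>iid M n)"
      by (intro integral_iid_Suc[where B="(real (Suc n) * A) ^ p"] power_bounded sum_iid_bounded A) measurable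
    then show ?thesis unfolding sum_upd_Suc .
  qed
  interpret Y: prob_space "iid M n" for n by (rule prob_space_iid)
  have C: "integrable (iid M n) (\<lambda>Y. C)" for n and C :: real
    by (rule integrable_iid_bounded[where B="\<bar>C\<bar>"]) auto
  have m: "(\<integral>Y. ?S n Y \<partial>iid M n) = 0" for n
  proof (induction n)
    case (Suc n)
    show ?case using step[of n 1] Suc q0 i1 S1 Y.prob_space by (simp add: prob_space)
  qed simp
  show s: "(\<integral>Y. (?S n Y)\<^sup>2 \<partial>iid M n) = real n * ?e2" for n
  proof (induction n)
    case (Suc n)
    have "(\<integral>y. (?S n Y + q y)\<^sup>2 \<partial>M) = (?S n Y)\<^sup>2 + ?e2" for Y
      using i[of 2] i1 q0 by (simp add: power2_sum prob_space algebra_simps)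
    then have "(\<integral>Y. (?S (Suc n) Y)\<^sup>2 \<partial>iid M (Suc n)) = (\<integral>Y. (?S n Y)\<^sup>2 + ?e2 \<partial>iid M n)"
      unfolding step by simp
    also have "\<dots> = (\<integral>Y. (?S n Y)\<^sup>2 \<partial>iid M n) + ?e2"
      using S[of n 2] C Y.prob_space[of n] by (subst Bochner_Integration.integral_add) auto
    finally show ?case using Suc by (simp add: algebra_simps)
  qed simp
  show "(\<integral>Y. ?S n Y ^ 4 \<partial>iid M n) \<le> real n * ?e4 + 3 * (real n)\<^sup>2 * ?e2\<^sup>2"
  proof (induction n)
    case (Suc n)
    have e: "(a + b) ^ 4 = a ^ 4 + 4 * a ^ 3 * b + 6 * a\<^sup>2 * b\<^sup>2 + 4 * a * b ^ 3 + b ^ 4" for a b :: real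
      by (simp add: power4_eq_xxxx power3_eq_cube power2_eq_square algebra_simps)
    have "(\<integral>y. (?S n Y + q y) ^ 4 \<partial>M) = ?S n Y ^ 4 + 6 * ?e2 * (?S n Y)\<^sup>2 + 4 * ?e3 * ?S n Y + ?e4" for Y
      unfolding e using i[of 2] i[of 3] i[of 4] i1 q0 by (simp add: prob_space algebra_simps)
    then have "(\<integral>Y. ?S (Suc n) Y ^ 4 \<partial>iid M (Suc n)) = (\<integral>Y. ?S n Y ^ 4 \<partial>iid M n) + 6 * ?e2 * (real n * ?e2) + ?e4"
      using step[of n 4] S[of n 2] S[of n 4] S1[of n] m[of n] s[of n] Y.prob_space[of n] C by simp
    also have "\<dots> \<le> (real n * ?e4 + 3 * (real n)\<^sup>2 * ?e2\<^sup>2) + 6 * ?e2 * (real n * ?e2) + ?e4"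
      using Suc by simp
    also have "\<dots> \<le> real (Suc n) * ?e4 + 3 * (real (Suc n))\<^sup>2 * ?e2\<^sup>2"
      by (simp add: algebra_simps power2_eq_square)
    finally show ?case .
  qed simp
qed

end

text \<open>The function ln (1 + x + x^2/3) - x + x^2/6 has derivative (x^3/9) / (1 + x + x^2/3),
  hence its minimum 0 at 0. The pair 1/6, 1/3 is the one for which the numerator of the derivative
  has no terms in x and x^2.\<close>

lemma exp_le_one_plus:
  fixes x :: real
  shows "exp (x - x\<^sup>2 / 6) \<le> 1 + x + x\<^sup>2 / 3"
proof -
  have pos: "0 < 1 + x + x\<^sup>2 / 3" for x :: real
  proof -
    have "1 + x + x\<^sup>2 / 3 = (x + 3 / 2)\<^sup>2 / 3 + 1 / 4" by (simp add: power2_sum field_simps)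
    then show ?thesis by (simp add: add_nonneg_pos)
  qed
  define f where "f x = ln (1 + x + x\<^sup>2 / 3) - x + x\<^sup>2 / 6" for x :: real
  have der: "(f has_real_derivative (x ^ 3 / 9) / (1 + x + x\<^sup>2 / 3)) (at x)" for x
  proof -
    have "(f has_real_derivative (1 + 2 * x / 3) / (1 + x + x\<^sup>2 / 3) - 1 + 2 * x / 6) (at x)"
      unfolding f_def using pos[of x] by (auto intro!: derivative_eq_intros simp: field_simps)
    moreover have "(1 + 2 * x / 3) / (1 + x + x\<^sup>2 / 3) - 1 + 2 * x / 6 = (x ^ 3 / 9) / (1 + x + x\<^sup>2 / 3)"
      using pos[of x] by (simp add: divide_simps) (simp add: field_simps power2_eq_square power3_eq_cube)
    ultimately show ?thesis by simp
  qed
  have "0 \<le> f x"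
  proof (cases "0 \<le> x")
    case True
    have "f 0 \<le> f x"
      by (rule DERIV_nonneg_imp_nondecreasing[OF True]) (use der pos less_imp_le in \<open>force intro: divide_nonneg_pos\<close>)
    then show ?thesis by (simp add: f_def)
  next
    case False
    then have "f 0 \<le> f x"
    proof (intro DERIV_nonpos_imp_nonincreasing[of x 0 f])
      fix y assume "x \<le> y" "y \<le> 0"
      then show "\<exists>z. (f has_real_derivative z) (at y) \<and> z \<le> 0"
        using der[of y] pos[of y] by (intro exI[of _ "(y ^ 3 / 9) / (1 + y + y\<^sup>2 / 3)"]) (auto intro!: divide_nonpos_pos simp: power_le_zero_eq)
    qed simp
    then show ?thesis by (simp add: f_def)
  qed
  then have "x - x\<^sup>2 / 6 \<le> ln (1 + x + x\<^sup>2 / 3)" by (simp add: f_def)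
  then have "exp (x - x\<^sup>2 / 6) \<le> exp (ln (1 + x + x\<^sup>2 / 3))" by simp
  then show ?thesis using pos[of x] by simp
qed

section \<open>Markov bounds and martingale differences\<close>

context prob_space
begin

lemma integrable_iid_inner:
  fixes F :: "(nat \<Rightarrow> 'a) \<Rightarrow> real"
  assumes "F \<in> borel_measurable (iid M (Suc n))" "\<And>Y. \<bar>F Y\<bar> \<le> B"
  shows "integrable (iid M n) (\<lambda>Y. \<integral>y. F (Y(Suc n := y)) \<partial>M)"
proof -
  interpret Y: prob_space "iid M n" by (rule prob_space_iid)
  interpret P: pair_prob_space "iid M n" M ..
  have [measurable]: "F \<in> borel_measurable (PiM (insert (Suc n) {1..n}) (\<lambda>_. M))"
    using assms(1) unfolding insert_Suc_interval .
  have "(\<lambda>(Y, y). F (Y(Suc n := y))) \<in> borel_measurable (iid M n \<Otimes>\<^sub>M M)"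
    by measurable
  then have "integrable (iid M n \<Otimes>\<^sub>M M) (\<lambda>(Y, y). F (Y(Suc n := y)))"
    by (rule P.P.integrable_const_bound[where B=B, rotated]) (use assms(2) in auto)
  from P.integrable_fst[OF this] show ?thesis .
qed

lemma Markov_square:
  assumes [measurable]: "F \<in> borel_measurable M" and "integrable M (\<lambda>x. (F x)\<^sup>2)" and a: "(a::real) > 0"
  shows "prob {x \<in> space M. F x \<ge> a} \<le> expectation (\<lambda>x. (F x)\<^sup>2) / a\<^sup>2"
    and "prob {x \<in> space M. \<bar>F x\<bar> \<ge> a} \<le> expectation (\<lambda>x. (F x)\<^sup>2) / a\<^sup>2"
proof -
  have "prob {x \<in> space M. \<bar>F x\<bar> \<ge> a} \<le> prob {x \<in> space M. (F x)\<^sup>2 \<ge> a\<^sup>2}"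
    using a by (intro finite_measure_mono) (auto simp: abs_le_square_iff[symmetric])
  also have "\<dots> \<le> expectation (\<lambda>x. (F x)\<^sup>2) / a\<^sup>2"
    using assms by (intro integral_Markov_inequality_measure[where A="{}"]) auto
  finally show 1: "prob {x \<in> space M. \<bar>F x\<bar> \<ge> a} \<le> expectation (\<lambda>x. (F x)\<^sup>2) / a\<^sup>2" .
  have "prob {x \<in> space M. F x \<ge> a} \<le> prob {x \<in> space M. \<bar>F x\<bar> \<ge> a}"
    by (intro finite_measure_mono) auto
  then show "prob {x \<in> space M. F x \<ge> a} \<le> expectation (\<lambda>x. (F x)\<^sup>2) / a\<^sup>2" using 1 by simp
qed

text \<open>Orthogonality of martingale differences. \<open>X j Y y\<close> is the j-th increment
  with past \<open>Y\<close> and current observation \<open>y\<close>; \<open>pred\<close> says that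
  it depends only on the coordinates before j, so integrating over the last coordinate removes the
  cross term by \<open>mean\<close>.\<close>

lemma martingale_square:
  fixes X :: "nat \<Rightarrow> (nat \<Rightarrow> 'a) \<Rightarrow> 'a \<Rightarrow> real"
  assumes meas: "\<And>j n. 1 \<le> j \<Longrightarrow> j \<le> n \<Longrightarrow> (\<lambda>Y. X j Y (Y j)) \<in> borel_measurable (iid M n)"
    and sec: "\<And>j Y. X j Y \<in> borel_measurable M"
    and bnd: "\<And>j Y y. \<bar>X j Y y\<bar> \<le> B j"
    and pred: "\<And>j n Y y z. j \<le> Suc n \<Longrightarrow> X j (Y(Suc n := y)) z = X j Y z"
    and mean: "\<And>j Y. expectation (X j Y) = 0"
  shows "(\<integral>Y. (\<Sum>j=1..n. X j Y (Y j))\<^sup>2 \<partial>iid M n) = (\<Sum>j=1..n. \<integral>Y. (X j Y (Y j))\<^sup>2 \<partial>iid M j)"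
proof (induction n)
  case 0
  then show ?case by simp
next
  case (Suc n)
  let ?S = "\<lambda>n Y. \<Sum>j=1..n. X j Y (Y j)"
  have upd: "?S (Suc n) (Y(Suc n := y)) = ?S n Y + X (Suc n) Y y" for Y y
  proof -
    have "?S n (Y(Suc n := y)) = ?S n Y" by (rule sum.cong) (auto simp: pred)
    then show ?thesis by (simp add: pred)
  qed
  have Sm: "?S n \<in> borel_measurable (iid M n)" for n
    using meas by (intro borel_measurable_sum) auto
  have Sb: "\<bar>?S n Y\<bar> \<le> (\<Sum>j=1..n. B j)" for n Y
    by (rule order_trans[OF sum_abs sum_mono]) (rule bnd)
  have i: "integrable M (\<lambda>y. X j Y y ^ p)" for j Y p
    by (rule integrable_const_bound[where B="B j ^ p"]) (auto simp: power_abs intro!: power_mono bnd sec borel_measurable_power)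
  have i1: "integrable M (X j Y)" for j Y using i[of j Y 1] by simp
  have X: "(\<lambda>Y. (X (Suc n) Y (Y (Suc n)))\<^sup>2) \<in> borel_measurable (iid M (Suc n))"
    using meas[of "Suc n" "Suc n"] by (intro borel_measurable_power) auto
  have Xb: "\<bar>(X (Suc n) Y (Y (Suc n)))\<^sup>2\<bar> \<le> (B (Suc n))\<^sup>2" for Y by (intro power_bounded bnd)
  have inner: "(\<integral>y. (?S n Y + X (Suc n) Y y)\<^sup>2 \<partial>M) = (?S n Y)\<^sup>2 + (\<integral>y. (X (Suc n) Y y)\<^sup>2 \<partial>M)" for Y
    using i[of "Suc n" Y 2] i1[of "Suc n" Y] mean[of "Suc n" Y] by (simp add: power2_sum prob_space)
  have "(\<integral>Y. (?S (Suc n) Y)\<^sup>2 \<partial>iid M (Suc n)) = (\<integral>Y. (\<integral>y. (?S (Suc n) (Y(Suc n := y)))\<^sup>2 \<partial>M) \<partial>iid M n)"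
    by (intro integral_iid_Suc[where B="(\<Sum>j=1..Suc n. B j)\<^sup>2"] power_bounded Sb borel_measurable_power Sm)
  also have "\<dots> = (\<integral>Y. (?S n Y)\<^sup>2 + (\<integral>y. (X (Suc n) Y y)\<^sup>2 \<partial>M) \<partial>iid M n)"
    unfolding upd inner ..
  also have "\<dots> = (\<integral>Y. (?S n Y)\<^sup>2 \<partial>iid M n) + (\<integral>Y. (\<integral>y. (X (Suc n) Y y)\<^sup>2 \<partial>M) \<partial>iid M n)"
  proof (rule Bochner_Integration.integral_add)
    show "integrable (iid M n) (\<lambda>Y. (?S n Y)\<^sup>2)"
      by (intro integrable_iid_bounded[where B="(\<Sum>j=1..n. B j)\<^sup>2"] power_bounded Sb borel_measurable_power Sm)
    show "integrable (iid M n) (\<lambda>Y. \<integral>y. (X (Suc n) Y y)\<^sup>2 \<partial>M)"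
      using integrable_iid_inner[OF X Xb] by (simp add: pred)
  qed
  also have "(\<integral>Y. (\<integral>y. (X (Suc n) Y y)\<^sup>2 \<partial>M) \<partial>iid M n) = (\<integral>Y. (X (Suc n) Y (Y (Suc n)))\<^sup>2 \<partial>iid M (Suc n))"
    using integral_iid_Suc[OF X Xb] by (simp add: pred)
  finally show ?case using Suc.IH by simp
qed

end

text \<open>Completely degenerate kernel: the mean vanishes in each argument, which makes the
  increments \<open>D\<close> of the associated U-statistic martingale differences. The bound
  \<open>A\<close> supplies integrability and otherwise enters only a lower-order term of the tail
  bound.\<close>

locale degenerate_kernel = prob_space M for M :: "'a measure" +
  fixes H :: "'a \<Rightarrow> 'a \<Rightarrow> real" and A :: real
  assumes space_UNIV: "space M = UNIV"
    and H_measurable [measurable]: "case_prod H \<in> borel_measurable (M \<Otimes>\<^sub>M M)"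
    and H_bound: "\<And>x y. \<bar>H x y\<bar> \<le> A"
    and H_sym: "\<And>x y. H x y = H y x"
    and H_degenerate: "\<And>y. expectation (\<lambda>x. H x y) = 0"
begin

lemma A_nonneg: "0 \<le> A"
  using H_bound[of undefined undefined] by linarith

lemma H_section_measurable [measurable]: "(\<lambda>x. H x y) \<in> borel_measurable M" "H y \<in> borel_measurable M"
proof -
  have "(\<lambda>x. case_prod H (x, y)) \<in> borel_measurable M"
    using measurable_Pair2'[of y M M] by (intro measurable_compose[OF _ H_measurable]) (simp add: space_UNIV)
  then show "(\<lambda>x. H x y) \<in> borel_measurable M" by simp
  then show "H y \<in> borel_measurable M" using H_sym[of _ y] by simp
qed

definition D :: "nat \<Rightarrow> (nat \<Rightarrow> 'a) \<Rightarrow> 'a \<Rightarrow> real" where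
  "D j Y y = (\<Sum>k=1..<j. H (Y k) y)"

lemma D_pred: "j \<le> Suc n \<Longrightarrow> D j (Y(Suc n := y)) z = D j Y z"
  unfolding D_def by (rule sum.cong) auto

lemma D_bound: "\<bar>D j Y y\<bar> \<le> real j * A"
proof -
  have "\<bar>D j Y y\<bar> \<le> (\<Sum>k=1..<j. \<bar>H (Y k) y\<bar>)" unfolding D_def by (rule sum_abs)
  also have "\<dots> \<le> real (card {1..<j}) * A" using H_bound by (intro sum_bounded_above)
  also have "\<dots> \<le> real j * A" using A_nonneg by (intro mult_right_mono) auto
  finally show ?thesis .
qed

lemma D_measurable [measurable]: "D j Y \<in> borel_measurable M"
  unfolding D_def by measurable

lemma H_comp_measurable:
  "f \<in> measurable N M \<Longrightarrow> g \<in> measurable N M \<Longrightarrow> (\<lambda>x. H (f x) (g x)) \<in> borel_measurable N"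
  using measurable_compose[OF measurable_Pair H_measurable, of f N g] by simp

lemma D_measurable_iid: "1 \<le> j \<Longrightarrow> j \<le> n \<Longrightarrow> (\<lambda>Y. D j Y (Y j)) \<in> borel_measurable (iid M n)"
  unfolding D_def by (intro borel_measurable_sum H_comp_measurable measurable_component_singleton) auto

lemma D_measurable_pair: "j \<le> Suc n \<Longrightarrow> (\<lambda>(Y, y). D j Y y) \<in> borel_measurable (iid M n \<Otimes>\<^sub>M M)"
  unfolding D_def case_prod_beta
  by (intro borel_measurable_sum H_comp_measurable measurable_compose[OF measurable_fst measurable_component_singleton]) auto

lemma integrable_D_power: "integrable M (\<lambda>y. D j Y y ^ p)"
  by (rule integrable_const_bound[where B="(real j * A) ^ p"])
    (auto simp: power_abs intro!: power_mono D_bound)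

lemma integrable_H: "integrable M (\<lambda>x. H x y)"
  by (rule integrable_const_bound[where B=A]) (auto simp: H_bound)

lemma D_mean: "expectation (D j Y) = 0"
proof -
  have "expectation (D j Y) = (\<Sum>k=1..<j. expectation (\<lambda>y. H y (Y k)))"
    unfolding D_def H_sym[of "Y _"] by (intro Bochner_Integration.integral_sum integrable_H)
  then show ?thesis by (simp add: H_degenerate)
qed

definition U :: "nat \<Rightarrow> (nat \<Rightarrow> 'a) \<Rightarrow> real" where
  "U n Y = (\<Sum>j=1..n. D j Y (Y j))"

lemma U_measurable [measurable]: "U n \<in> borel_measurable (iid M n)"
  unfolding U_def by (intro borel_measurable_sum D_measurable_iid) auto

text \<open>For a fixed last argument y the increment is a sum of j - 1 independent centred
  variables \<open>H (Y k) y\<close>, so the moments of independent sums can be inserted.\<close>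

lemma expectation_D_power:
  assumes "1 \<le> j"
  shows "(\<integral>Y. D j Y (Y j) ^ p \<partial>iid M j) = (\<integral>y. (\<integral>Y. (\<Sum>k=1..j-1. H (Y k) y) ^ p \<partial>iid M (j - 1)) \<partial>M)"
proof -
  obtain n where j: "j = Suc n" using assms by (cases j) auto
  have "(\<integral>Y. D (Suc n) Y (Y (Suc n)) ^ p \<partial>iid M (Suc n)) =
    (\<integral>y. (\<integral>Y. D (Suc n) (Y(Suc n := y)) ((Y(Suc n := y)) (Suc n)) ^ p \<partial>iid M n) \<partial>M)"
    by (intro integral_iid_Suc_last[where B="(real (Suc n) * A) ^ p"] borel_measurable_power D_measurable_iid
        power_bounded D_bound) auto
  then show ?thesis unfolding j by (simp add: D_pred) (simp add: D_def atLeastLessThanSuc_atLeastAtMost)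
qed

lemma expectation_D_square:
  assumes "1 \<le> j"
  shows "(\<integral>Y. (D j Y (Y j))\<^sup>2 \<partial>iid M j) = real (j - 1) * (\<integral>y. (\<integral>x. (H x y)\<^sup>2 \<partial>M) \<partial>M)"
  unfolding expectation_D_power[OF assms]
  by (subst iid_sum_square[where A=A]) (auto simp: H_bound H_degenerate)

text \<open>Unit weights give the variance of \<open>U\<close>; weights 2 * (n - l), with
  \<open>G\<close> in the place of \<open>H\<close>, give that of the fluctuating part of the summed
  conditional variances.\<close>

lemma weighted_square:
  "(\<integral>Y. (\<Sum>j=1..n. w j * D j Y (Y j))\<^sup>2 \<partial>iid M n) = (\<Sum>j=1..n. (w j)\<^sup>2 * (real (j - 1) * (\<integral>y. (\<integral>x. (H x y)\<^sup>2 \<partial>M) \<partial>M)))"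
proof -
  have "(\<integral>Y. (\<Sum>j=1..n. w j * D j Y (Y j))\<^sup>2 \<partial>iid M n) = (\<Sum>j=1..n. \<integral>Y. (w j * D j Y (Y j))\<^sup>2 \<partial>iid M j)"
  proof (rule martingale_square[where B="\<lambda>j. \<bar>w j\<bar> * (real j * A)" and X="\<lambda>j Y y. w j * D j Y y"])
    show "\<bar>w j * D j Y y\<bar> \<le> \<bar>w j\<bar> * (real j * A)" for j Y y
      using D_bound by (simp add: abs_mult mult_left_mono)
    show "(\<lambda>Y. w j * D j Y (Y j)) \<in> borel_measurable (iid M n)" if "1 \<le> j" "j \<le> n" for j n
      using D_measurable_iid[OF that] by simp
  qed (auto simp: D_pred D_mean)
  also have "\<dots> = (\<Sum>j=1..n. (w j)\<^sup>2 * (real (j - 1) * (\<integral>y. (\<integral>x. (H x y)\<^sup>2 \<partial>M) \<partial>M)))"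
    by (rule sum.cong) (simp_all add: power_mult_distrib expectation_D_square del: One_nat_def of_nat_diff)
  finally show ?thesis .
qed

end

section \<open>Conditional variances, the exponential supermartingale and the tail bound\<close>

lemma sum_triangle:
  fixes c :: "nat \<Rightarrow> real"
  shows "(\<Sum>j=1..n. \<Sum>l=1..<j. c l) = (\<Sum>l=1..n. real (n - l) * c l)"
proof (induction n)
  case (Suc n)
  have "(\<Sum>l=1..Suc n. real (Suc n - l) * c l) = (\<Sum>l=1..n. real (n - l) * c l + c l)"
    by (simp add: algebra_simps Suc_diff_le)
  then show ?case using Suc by (simp add: sum.distrib atLeastLessThanSuc_atLeastAtMost)
qed simp

lemma sum_square_symmetric:
  fixes G :: "nat \<Rightarrow> nat \<Rightarrow> real"
  assumes "\<And>k l. G k l = G l k"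
  shows "(\<Sum>k=1..<j. \<Sum>l=1..<j. G k l) = (\<Sum>k=1..<j. G k k) + 2 * (\<Sum>l=1..<j. \<Sum>k=1..<l. G k l)"
proof (induction j)
  case (Suc j)
  have "(\<Sum>k=1..<j. G j k) = (\<Sum>k=1..<j. G k j)" using assms by simp
  then show ?case using Suc by (cases "j = 0") (auto simp: sum.distrib)
qed simp

context degenerate_kernel
begin

text \<open>Conditional variance of the j-th increment given the past.\<close>

definition m2 :: "nat \<Rightarrow> (nat \<Rightarrow> 'a) \<Rightarrow> real" where
  "m2 j Y = expectation (\<lambda>z. (D j Y z)\<^sup>2)"

text \<open>Kernel of the square of the integral operator with kernel \<open>H\<close>; its
  Hilbert-Schmidt norm measures how much the conditional variances fluctuate.\<close>

definition G :: "'a \<Rightarrow> 'a \<Rightarrow> real" where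
  "G x y = expectation (\<lambda>z. H x z * H y z)"

lemma integrable_D_sq: "integrable M (\<lambda>y. (D j Y y)\<^sup>2)"
  using integrable_D_power[of j Y 2] .

lemma m2_pred: "j \<le> Suc n \<Longrightarrow> m2 j (Y(Suc n := y)) = m2 j Y"
  unfolding m2_def by (simp add: D_pred)

lemma m2_measurable: "j \<le> Suc n \<Longrightarrow> m2 j \<in> borel_measurable (iid M n)"
  unfolding m2_def using D_measurable_pair[of j n]
  by (intro borel_measurable_lebesgue_integral) (auto simp: case_prod_beta)

lemma m2_nonneg: "0 \<le> m2 j Y"
  unfolding m2_def by (intro integral_nonneg_AE) auto

lemma m2_le: "m2 j Y \<le> (real j * A)\<^sup>2"
proof -
  have "m2 j Y \<le> expectation (\<lambda>z. (real j * A)\<^sup>2)"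
    unfolding m2_def by (intro integral_mono integrable_D_sq) (auto intro!: power2_le_iff_abs_le[THEN iffD2] D_bound simp: A_nonneg)
  then show ?thesis by (simp add: prob_space)
qed

text \<open>Conditionally on the past, the right side of \<open>exp_le_one_plus\<close> at x =
  \<theta> * D has mean 1 + \<theta>^2 * m2 / 3, because \<open>D\<close> is centred. This is at
  most the exponential of \<theta>^2 * m2 / 3, which the last term of the exponent cancels, so each
  new factor has conditional mean at most 1.\<close>

lemma exp_martingale:
  "(\<integral>\<^sup>+Y. ennreal (exp (\<Sum>j=1..n. \<theta> * D j Y (Y j) - \<theta>\<^sup>2 * (D j Y (Y j))\<^sup>2 / 6 - \<theta>\<^sup>2 * m2 j Y / 3)) \<partial>iid M n) \<le> 1"
proof (induction n)
  case 0
  interpret Y: prob_space "iid M 0" by (rule prob_space_iid)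
  show ?case using Y.emeasure_space_1 by simp
next
  case (Suc n)
  define E where "E j Y y = \<theta> * D j Y y - \<theta>\<^sup>2 * (D j Y y)\<^sup>2 / 6 - \<theta>\<^sup>2 * m2 j Y / 3" for j Y y
  have Em: "(\<lambda>Y. E j Y (Y j)) \<in> borel_measurable (iid M n)" if "1 \<le> j" "j \<le> n" for j n
    unfolding E_def using D_measurable_iid[OF that] m2_measurable[of j n] that
    by (intro borel_measurable_diff borel_measurable_times borel_measurable_divide borel_measurable_power borel_measurable_const) auto
  have S: "(\<lambda>Y. ennreal (exp (\<Sum>j=1..n. E j Y (Y j)))) \<in> borel_measurable (iid M n)" for n
    using Em by (intro measurable_compose[OF _ measurable_ennreal] measurable_compose[OF _ borel_measurable_exp] borel_measurable_sum) auto
  have upd: "(\<Sum>j=1..Suc n. E j (Y(Suc n := y)) ((Y(Suc n := y)) j)) = (\<Sum>j=1..n. E j Y (Y j)) + E (Suc n) Y y" for Y y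
  proof -
    have "(\<Sum>j=1..n. E j (Y(Suc n := y)) ((Y(Suc n := y)) j)) = (\<Sum>j=1..n. E j Y (Y j))"
      by (rule sum.cong) (auto simp: E_def D_pred m2_pred)
    then show ?thesis by (simp add: E_def D_pred m2_pred)
  qed
  have inner: "(\<integral>\<^sup>+y. ennreal (exp (E j Y y)) \<partial>M) \<le> 1" for j Y
  proof -
    let ?m = "\<theta>\<^sup>2 * m2 j Y / 3"
    have i: "integrable M (\<lambda>y. 1 + \<theta> * D j Y y + \<theta>\<^sup>2 * (D j Y y)\<^sup>2 / 3)"
      using integrable_D_power[of j Y 1] integrable_D_sq[of j Y] by auto
    have nn: "0 \<le> 1 + x + x\<^sup>2 / 3" for x :: real using order_trans[OF exp_ge_zero exp_le_one_plus] .
    have "(\<integral>\<^sup>+y. ennreal (exp (E j Y y)) \<partial>M) \<le> (\<integral>\<^sup>+y. ennreal (exp (- ?m)) * ennreal (1 + \<theta> * D j Y y + \<theta>\<^sup>2 * (D j Y y)\<^sup>2 / 3) \<partial>M)"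
    proof (rule nn_integral_mono)
      fix y
      have "exp (E j Y y) = exp (- ?m) * exp (\<theta> * D j Y y - (\<theta> * D j Y y)\<^sup>2 / 6)"
        unfolding E_def by (simp add: power_mult_distrib flip: exp_add)
      also have "\<dots> \<le> exp (- ?m) * (1 + \<theta> * D j Y y + (\<theta> * D j Y y)\<^sup>2 / 3)"
        by (intro mult_left_mono exp_le_one_plus) auto
      finally show "ennreal (exp (E j Y y)) \<le> ennreal (exp (- ?m)) * ennreal (1 + \<theta> * D j Y y + \<theta>\<^sup>2 * (D j Y y)\<^sup>2 / 3)"
        using nn[of "\<theta> * D j Y y"] by (subst ennreal_mult[symmetric]) (auto simp: power_mult_distrib intro!: ennreal_leI)
    qed
    also have "\<dots> = ennreal (exp (- ?m)) * (\<integral>\<^sup>+y. ennreal (1 + \<theta> * D j Y y + \<theta>\<^sup>2 * (D j Y y)\<^sup>2 / 3) \<partial>M)"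
      by (rule nn_integral_cmult) measurable
    also have "(\<integral>\<^sup>+y. ennreal (1 + \<theta> * D j Y y + \<theta>\<^sup>2 * (D j Y y)\<^sup>2 / 3) \<partial>M) = ennreal (\<integral>y. 1 + \<theta> * D j Y y + \<theta>\<^sup>2 * (D j Y y)\<^sup>2 / 3 \<partial>M)"
      using nn[of "\<theta> * D j Y _"] by (intro nn_integral_eq_integral i) (auto simp: power_mult_distrib)
    also have "(\<integral>y. 1 + \<theta> * D j Y y + \<theta>\<^sup>2 * (D j Y y)\<^sup>2 / 3 \<partial>M) = 1 + ?m"
      using integrable_D_power[of j Y 1] integrable_D_sq[of j Y] by (simp add: D_mean m2_def prob_space)
    also have "ennreal (exp (- ?m)) * ennreal (1 + ?m) \<le> ennreal (exp (- ?m)) * ennreal (exp ?m)"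
      by (intro mult_left_mono ennreal_leI exp_ge_add_one_self) auto
    also have "\<dots> = 1" by (simp add: ennreal_mult[symmetric] flip: exp_add)
    finally show ?thesis .
  qed
  have "(\<integral>\<^sup>+Y. ennreal (exp (\<Sum>j=1..Suc n. E j Y (Y j))) \<partial>iid M (Suc n))
    = (\<integral>\<^sup>+Y. (\<integral>\<^sup>+y. ennreal (exp (\<Sum>j=1..n. E j Y (Y j))) * ennreal (exp (E (Suc n) Y y)) \<partial>M) \<partial>iid M n)"
    unfolding nn_integral_iid_Suc[OF S] upd by (simp add: exp_add ennreal_mult)
  also have "\<dots> = (\<integral>\<^sup>+Y. ennreal (exp (\<Sum>j=1..n. E j Y (Y j))) * (\<integral>\<^sup>+y. ennreal (exp (E (Suc n) Y y)) \<partial>M) \<partial>iid M n)"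
    by (intro nn_integral_cong nn_integral_cmult) (unfold E_def, measurable)
  also have "\<dots> \<le> (\<integral>\<^sup>+Y. ennreal (exp (\<Sum>j=1..n. E j Y (Y j))) * 1 \<partial>iid M n)"
    by (intro nn_integral_mono mult_left_mono inner) auto
  also have "\<dots> \<le> 1" using Suc.IH unfolding E_def by simp
  finally show ?case unfolding E_def .
qed

lemma G_measurable: "case_prod G \<in> borel_measurable (M \<Otimes>\<^sub>M M)"
proof -
  have "(\<lambda>(w, z). H (fst w) z * H (snd w) z) \<in> borel_measurable ((M \<Otimes>\<^sub>M M) \<Otimes>\<^sub>M M)"
    unfolding case_prod_beta by (intro borel_measurable_times H_comp_measurable) measurable
  from borel_measurable_lebesgue_integral[OF this] show ?thesis
    by (simp add: G_def case_prod_beta')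
qed

lemma HH_bound: "\<bar>H x z * H y z\<bar> \<le> A\<^sup>2"
  by (simp add: abs_mult power2_eq_square mult_mono H_bound A_nonneg)

lemma integrable_HH: "integrable M (\<lambda>z. H x z * H y z)"
  by (rule integrable_const_bound[where B="A\<^sup>2"]) (use HH_bound in auto)

text \<open>Makes the results on \<open>H\<close> available for \<open>G\<close>. The mean vanishes
  because, by Fubini, \<open>H\<close> already integrates to 0 in its first argument.\<close>

lemma G_degenerate_kernel: "degenerate_kernel M G (A\<^sup>2)"
proof
  show "\<bar>G x y\<bar> \<le> A\<^sup>2" for x y
  proof -
    have "\<bar>G x y\<bar> \<le> expectation (\<lambda>z. \<bar>H x z * H y z\<bar>)" unfolding G_def by (rule integral_abs_bound)
    also have "\<dots> \<le> expectation (\<lambda>z. A\<^sup>2)"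
      using integrable_HH HH_bound by (intro integral_mono) auto
    finally show ?thesis by (simp add: prob_space)
  qed
  show "expectation (\<lambda>x. G x y) = 0" for y
  proof -
    interpret P: pair_prob_space M M ..
    have "(\<lambda>(x, z). H x z * H y z) \<in> borel_measurable (M \<Otimes>\<^sub>M M)"
      unfolding case_prod_beta by (intro borel_measurable_times H_comp_measurable) (auto simp: space_UNIV)
    then have "integrable (M \<Otimes>\<^sub>M M) (\<lambda>(x, z). H x z * H y z)"
      by (rule P.P.integrable_const_bound[where B="A\<^sup>2", rotated]) (use HH_bound in auto)
    from P.Fubini_integral[OF this] show ?thesis
      by (simp add: G_def H_degenerate)
  qed
qed (auto simp: space_UNIV G_measurable G_def mult.commute)

text \<open>The square of the sum splits into a diagonal, which is bounded termwise by the second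
  moments of the sections of \<open>H\<close>, and twice an off-diagonal part that is itself a
  degenerate U-statistic, with kernel \<open>G\<close>.\<close>

lemma m2_eq: "m2 j Y = (\<Sum>k=1..<j. G (Y k) (Y k)) + 2 * (\<Sum>l=1..<j. \<Sum>k=1..<l. G (Y k) (Y l))"
proof -
  have "m2 j Y = expectation (\<lambda>z. \<Sum>k=1..<j. \<Sum>l=1..<j. H (Y k) z * H (Y l) z)"
    unfolding m2_def D_def by (simp add: power2_eq_square sum_product)
  also have "\<dots> = (\<Sum>k=1..<j. \<Sum>l=1..<j. G (Y k) (Y l))"
    unfolding G_def using integrable_HH by (simp add: Bochner_Integration.integral_sum)
  also have "\<dots> = (\<Sum>k=1..<j. G (Y k) (Y k)) + 2 * (\<Sum>l=1..<j. \<Sum>k=1..<l. G (Y k) (Y l))"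
    by (rule sum_square_symmetric) (simp add: G_def mult.commute)
  finally show ?thesis .
qed

text \<open>Since H^4 \<le> A^2 * H^2, the part linear in j costs only A^2 * S; the part 3 * j^2 *
  S^2 is the one that a Gaussian variable would have.\<close>

lemma fourth_moment_D:
  assumes "1 \<le> j" and S: "\<And>y. expectation (\<lambda>x. (H x y)\<^sup>2) \<le> S"
  shows "(\<integral>Y. D j Y (Y j) ^ 4 \<partial>iid M j) \<le> real j * (A\<^sup>2 * S) + 3 * (real j)\<^sup>2 * S\<^sup>2"
proof -
  have S0: "0 \<le> S" by (rule order_trans[OF _ S[of undefined]]) auto
  have i2: "integrable M (\<lambda>x. (H x y)\<^sup>2)" for y
    using integrable_HH[of y y] H_sym by (simp add: power2_eq_square)
  have i4: "integrable M (\<lambda>x. H x y ^ 4)" for y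
    by (rule integrable_const_bound[where B="A ^ 4"]) (use power_bounded[OF H_bound, of _ y 4] in auto)
  have h4: "expectation (\<lambda>x. H x y ^ 4) \<le> A\<^sup>2 * S" for y
  proof -
    have "H x y ^ 4 \<le> A\<^sup>2 * (H x y)\<^sup>2" for x
    proof -
      have "(H x y)\<^sup>2 \<le> A\<^sup>2" using power_bounded[OF H_bound[of x y], of 2] by simp
      from mult_right_mono[OF this zero_le_power2[of "H x y"]] show ?thesis
        by (simp add: power4_eq_xxxx power2_eq_square mult.assoc)
    qed
    then have "expectation (\<lambda>x. H x y ^ 4) \<le> expectation (\<lambda>x. A\<^sup>2 * (H x y)\<^sup>2)"
      using i4 i2 by (intro integral_mono) auto
    also have "\<dots> \<le> A\<^sup>2 * S" using S by (simp add: mult_left_mono)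
    finally show ?thesis .
  qed
  have "(\<integral>Y. (\<Sum>k=1..j-1. H (Y k) y) ^ 4 \<partial>iid M (j - 1)) \<le> real j * (A\<^sup>2 * S) + 3 * (real j)\<^sup>2 * S\<^sup>2" for y
  proof -
    have "(\<integral>Y. (\<Sum>k=1..j-1. H (Y k) y) ^ 4 \<partial>iid M (j - 1)) \<le> real (j - 1) * expectation (\<lambda>x. H x y ^ 4) +
       3 * (real (j - 1))\<^sup>2 * (expectation (\<lambda>x. (H x y)\<^sup>2))\<^sup>2"
      by (rule iid_sum_fourth[where A=A]) (auto simp: H_bound H_degenerate)
    also have "\<dots> \<le> real j * (A\<^sup>2 * S) + 3 * (real j)\<^sup>2 * S\<^sup>2"
      using h4 S S0 by (intro add_mono mult_mono power_mono) auto
    finally show ?thesis .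
  qed
  then have "(\<integral>y. (\<integral>Y. (\<Sum>k=1..j-1. H (Y k) y) ^ 4 \<partial>iid M (j - 1)) \<partial>M) \<le> (\<integral>y. real j * (A\<^sup>2 * S) + 3 * (real j)\<^sup>2 * S\<^sup>2 \<partial>M)"
    using S0 by (intro Bochner_Integration.integral_mono') auto
  then show ?thesis unfolding expectation_D_power[OF assms(1)] by (simp add: prob_space)
qed

text \<open>Squared increments minus their conditional means are again martingale differences. Their
  second moments are at most the fourth moments of the increments, which
  \<open>fourth_moment_D\<close> bounds.\<close>

lemma Q_square:
  assumes S: "\<And>y. expectation (\<lambda>x. (H x y)\<^sup>2) \<le> S"
  shows "(\<integral>Y. (\<Sum>j=1..n. (D j Y (Y j))\<^sup>2 - m2 j Y)\<^sup>2 \<partial>iid M n) \<le> (real n)\<^sup>2 * (A\<^sup>2 * S) + 3 * real n ^ 3 * S\<^sup>2"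
proof -
  have S0: "0 \<le> S" by (rule order_trans[OF _ S[of undefined]]) auto
  have Xb: "\<bar>(D j Y y)\<^sup>2 - m2 j Y\<bar> \<le> 2 * (real j * A)\<^sup>2" for j Y y
    using m2_le[of j Y] m2_nonneg[of j Y] power_bounded[OF D_bound[of j Y y], of 2]
      zero_le_power2[of "D j Y y"] zero_le_power2[of "real j * A"] by (simp only: abs_le_iff) linarith
  have Xm: "(\<lambda>Y. (D j Y (Y j))\<^sup>2 - m2 j Y) \<in> borel_measurable (iid M n)" if "1 \<le> j" "j \<le> n" for j n
    using D_measurable_iid[OF that] m2_measurable[of j n] that by (intro borel_measurable_diff borel_measurable_power) auto
  have "(\<integral>Y. (\<Sum>j=1..n. (D j Y (Y j))\<^sup>2 - m2 j Y)\<^sup>2 \<partial>iid M n) = (\<Sum>j=1..n. \<integral>Y. ((D j Y (Y j))\<^sup>2 - m2 j Y)\<^sup>2 \<partial>iid M j)"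
  proof (rule martingale_square[where B="\<lambda>j. 2 * (real j * A)\<^sup>2" and X="\<lambda>j Y y. (D j Y y)\<^sup>2 - m2 j Y"])
    show "expectation (\<lambda>y. (D j Y y)\<^sup>2 - m2 j Y) = 0" for j Y
      using integrable_D_sq[of j Y] by (simp add: m2_def[symmetric] prob_space)
    show "(\<lambda>Y. (D j Y (Y j))\<^sup>2 - m2 j Y) \<in> borel_measurable (iid M n)" if "1 \<le> j" "j \<le> n" for j n
      using that by (rule Xm)
  qed (auto simp: D_pred m2_pred Xb)
  also have "\<dots> \<le> (\<Sum>j=1..n. real n * (A\<^sup>2 * S) + 3 * (real n)\<^sup>2 * S\<^sup>2)"
  proof (rule sum_mono)
    fix j assume j: "j \<in> {1..n}"
    then have "(\<integral>Y. ((D j Y (Y j))\<^sup>2 - m2 j Y)\<^sup>2 \<partial>iid M j) \<le> (\<integral>Y. D j Y (Y j) ^ 4 \<partial>iid M j)"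
    proof -
      obtain i where i: "j = Suc i" using j by (cases j) auto
      have i4: "(\<integral>y. ((D j Y y)\<^sup>2 - m2 j Y)\<^sup>2 \<partial>M) \<le> (\<integral>y. D j Y y ^ 4 \<partial>M)" for Y
      proof -
        have "(\<integral>y. ((D j Y y)\<^sup>2 - m2 j Y)\<^sup>2 \<partial>M) = (\<integral>y. D j Y y ^ 4 - 2 * m2 j Y * (D j Y y)\<^sup>2 + (m2 j Y)\<^sup>2 \<partial>M)"
          by (rule Bochner_Integration.integral_cong) (auto simp: power4_eq_xxxx power2_eq_square algebra_simps)
        also have "\<dots> = (\<integral>y. D j Y y ^ 4 \<partial>M) - (m2 j Y)\<^sup>2"
          using integrable_D_power[of j Y 4] integrable_D_sq[of j Y]
          by (simp add: m2_def[symmetric] prob_space) (simp add: power2_eq_square)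
        finally show ?thesis by simp
      qed
      have X1: "(\<lambda>Y. ((D j Y (Y j))\<^sup>2 - m2 j Y)\<^sup>2) \<in> borel_measurable (iid M (Suc i))"
        using Xm[of j "Suc i"] j i by (intro borel_measurable_power) auto
      have B1: "\<bar>((D j Y (Y j))\<^sup>2 - m2 j Y)\<^sup>2\<bar> \<le> (2 * (real j * A)\<^sup>2)\<^sup>2" for Y
        by (intro power_bounded Xb)
      have X2: "(\<lambda>Y. D j Y (Y j) ^ 4) \<in> borel_measurable (iid M (Suc i))"
        using j i by (intro borel_measurable_power D_measurable_iid) auto
      have B2: "\<bar>D j Y (Y j) ^ 4\<bar> \<le> (real j * A) ^ 4" for Y by (intro power_bounded D_bound)
      have "(\<integral>Y. ((D j Y (Y j))\<^sup>2 - m2 j Y)\<^sup>2 \<partial>iid M (Suc i)) = (\<integral>Y. (\<integral>y. ((D j Y y)\<^sup>2 - m2 j Y)\<^sup>2 \<partial>M) \<partial>iid M i)"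
        unfolding integral_iid_Suc[OF X1 B1] using i by (simp add: D_pred m2_pred)
      also have "\<dots> \<le> (\<integral>Y. (\<integral>y. D j Y y ^ 4 \<partial>M) \<partial>iid M i)"
        using integrable_iid_inner[OF X1 B1] integrable_iid_inner[OF X2 B2] i
        by (intro integral_mono i4) (auto simp: D_pred m2_pred)
      also have "\<dots> = (\<integral>Y. D j Y (Y j) ^ 4 \<partial>iid M (Suc i))"
        unfolding integral_iid_Suc[OF X2 B2] using i by (simp add: D_pred m2_pred)
      finally show ?thesis using i by simp
    qed
    also have "\<dots> \<le> real j * (A\<^sup>2 * S) + 3 * (real j)\<^sup>2 * S\<^sup>2"
      using j by (intro fourth_moment_D S) auto
    also have "\<dots> \<le> real n * (A\<^sup>2 * S) + 3 * (real n)\<^sup>2 * S\<^sup>2"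
      using j S0 by (intro add_mono mult_right_mono mult_left_mono power_mono) auto
    finally show "(\<integral>Y. ((D j Y (Y j))\<^sup>2 - m2 j Y)\<^sup>2 \<partial>iid M j) \<le> real n * (A\<^sup>2 * S) + 3 * (real n)\<^sup>2 * S\<^sup>2" .
  qed
  also have "\<dots> = (real n)\<^sup>2 * (A\<^sup>2 * S) + 3 * real n ^ 3 * S\<^sup>2"
    by (simp add: algebra_simps power2_eq_square power3_eq_cube)
  finally show ?thesis .
qed

text \<open>The diagonal terms of \<open>m2_eq\<close> contribute at most n^2 * S. In the
  off-diagonal part the index l is counted once for every j > l, which by
  \<open>sum_triangle\<close> produces the weights n - l.\<close>

lemma sum_m2_le:
  assumes S: "\<And>y. expectation (\<lambda>x. (H x y)\<^sup>2) \<le> S"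
  shows "(\<Sum>j=1..n. m2 j Y) \<le> (real n)\<^sup>2 * S + (\<Sum>l=1..n. 2 * real (n - l) * (\<Sum>k=1..<l. G (Y k) (Y l)))"
proof -
  have S0: "0 \<le> S" by (rule order_trans[OF _ S[of undefined]]) auto
  have G: "G x x \<le> S" for x
    using S[of x] H_sym by (simp add: G_def power2_eq_square)
  have "(\<Sum>j=1..n. m2 j Y) = (\<Sum>j=1..n. \<Sum>k=1..<j. G (Y k) (Y k)) + 2 * (\<Sum>j=1..n. \<Sum>l=1..<j. \<Sum>k=1..<l. G (Y k) (Y l))"
    by (simp add: m2_eq sum.distrib sum_distrib_left)
  also have "(\<Sum>j=1..n. \<Sum>k=1..<j. G (Y k) (Y k)) \<le> (\<Sum>j=1..n. real n * S)"
  proof (rule sum_mono)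
    fix j assume j: "j \<in> {1..n}"
    have "(\<Sum>k=1..<j. G (Y k) (Y k)) \<le> real (card {1..<j}) * S" using G by (intro sum_bounded_above)
    also have "\<dots> \<le> real n * S" using j S0 by (intro mult_right_mono) auto
    finally show "(\<Sum>k=1..<j. G (Y k) (Y k)) \<le> real n * S" .
  qed
  also have "(\<Sum>j=1..n. real n * S) = (real n)\<^sup>2 * S" by (simp add: power2_eq_square)
  finally show ?thesis
    unfolding sum_triangle by (simp only: sum_distrib_left mult.assoc)
qed

text \<open>Chernoff bound on the event where the accumulated variance \<open>V\<close> is at most
  \<open>v\<close>; \<open>exp_martingale\<close> bounds the exponential moment by 1.\<close>

lemma exp_tail:
  assumes [measurable]: "V \<in> borel_measurable (iid M n)"
    and V: "\<And>Y. V Y = (\<Sum>j=1..n. (D j Y (Y j))\<^sup>2 / 3 + 2 * m2 j Y / 3)"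
    and x: "x > 0" and v: "v > 0"
  shows "measure (iid M n) {Y \<in> space (iid M n). U n Y \<ge> x \<and> V Y \<le> v} \<le> exp (- x\<^sup>2 / (2 * v))"
proof -
  interpret Y: prob_space "iid M n" by (rule prob_space_iid)
  \<comment> \<open>Minimiser of - \<theta> * x + \<theta>^2 * v / 2.\<close>
  define \<theta> where "\<theta> = x / v"
  have th: "\<theta> > 0" using x v by (simp add: \<theta>_def)
  let ?c = "\<theta> * x - \<theta>\<^sup>2 * v / 2"
  have E: "(\<Sum>j=1..n. \<theta> * D j Y (Y j) - \<theta>\<^sup>2 * (D j Y (Y j))\<^sup>2 / 6 - \<theta>\<^sup>2 * m2 j Y / 3) = \<theta> * U n Y - \<theta>\<^sup>2 * V Y / 2" for Y
    by (simp add: U_def V sum_distrib_left sum_subtractf sum.distrib sum_divide_distrib algebra_simps)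
  let ?B = "{Y \<in> space (iid M n). U n Y \<ge> x \<and> V Y \<le> v}"
  have "emeasure (iid M n) ?B = (\<integral>\<^sup>+Y. indicator ?B Y \<partial>iid M n)"
    by (rule nn_integral_indicator[symmetric]) measurable
  also have "\<dots> \<le> (\<integral>\<^sup>+Y. ennreal (exp (- ?c)) * ennreal (exp (\<theta> * U n Y - \<theta>\<^sup>2 * V Y / 2)) \<partial>iid M n)"
  proof (rule nn_integral_mono)
    fix Y
    have "1 \<le> exp (- ?c) * exp (\<theta> * U n Y - \<theta>\<^sup>2 * V Y / 2)" if "Y \<in> ?B"
    proof -
      have "\<theta> * x \<le> \<theta> * U n Y" "\<theta>\<^sup>2 * V Y \<le> \<theta>\<^sup>2 * v" using that th by auto
      then show ?thesis by (simp flip: exp_add)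
    qed
    then show "indicator ?B Y \<le> ennreal (exp (- ?c)) * ennreal (exp (\<theta> * U n Y - \<theta>\<^sup>2 * V Y / 2))"
      by (auto simp: indicator_def ennreal_mult[symmetric] simp flip: ennreal_1 intro!: ennreal_leI)
  qed
  also have "\<dots> = ennreal (exp (- ?c)) * (\<integral>\<^sup>+Y. ennreal (exp (\<theta> * U n Y - \<theta>\<^sup>2 * V Y / 2)) \<partial>iid M n)"
    by (rule nn_integral_cmult) measurable
  also have "\<dots> \<le> ennreal (exp (- ?c)) * 1"
    using exp_martingale[of n \<theta>] unfolding E by (intro mult_left_mono) auto
  also have "?c = x\<^sup>2 / (2 * v)" using v by (simp add: \<theta>_def field_simps power2_eq_square)
  finally have "emeasure (iid M n) ?B \<le> ennreal (exp (- (x\<^sup>2 / (2 * v))))" by simp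
  then show ?thesis unfolding Y.emeasure_eq_measure by simp
qed

text \<open>\<open>V\<close> is at most Q / 3 + n^2 * S + R, where \<open>Q\<close> sums the squared
  increments minus their conditional means and \<open>R\<close> is a weighted U-statistic with
  kernel \<open>G\<close>. If Q < 3 * n^2 * S and R < n^2 * S then V \<le> 3 * n^2 * S, whence the 6
  in the exponent. Chebyshev's inequality handles the two exceptional events: \<open>R\<close>
  accounts for 4 * \<Gamma> / S^2, \<open>Q\<close> for the last two terms.\<close>

lemma U_upper_tail:
  assumes S: "\<And>y. expectation (\<lambda>x. (H x y)\<^sup>2) \<le> S" and Spos: "S > 0" and n: "n \<ge> 1"
    and Gam: "(\<integral>y. (\<integral>x. (G x y)\<^sup>2 \<partial>M) \<partial>M) \<le> \<Gamma>" and x: "x > 0"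
  shows "measure (iid M n) {Y \<in> space (iid M n). U n Y \<ge> x}
    \<le> exp (- x\<^sup>2 / (6 * (real n)\<^sup>2 * S)) + (4 * \<Gamma> / S\<^sup>2 + A\<^sup>2 / (9 * (real n)\<^sup>2 * S) + 1 / (3 * real n))"
proof -
  interpret Y: prob_space "iid M n" by (rule prob_space_iid)
  interpret G: degenerate_kernel M G "A\<^sup>2" by (rule G_degenerate_kernel)
  define V where "V Y = (\<Sum>j=1..n. (D j Y (Y j))\<^sup>2 / 3 + 2 * m2 j Y / 3)" for Y
  define Q where "Q Y = (\<Sum>j=1..n. (D j Y (Y j))\<^sup>2 - m2 j Y)" for Y
  define R where "R Y = (\<Sum>l=1..n. 2 * real (n - l) * G.D l Y (Y l))" for Y
  have n0: "real n > 0" using n by simp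
  let ?s = "(real n)\<^sup>2 * S"
  have s: "?s > 0" using n Spos by simp
  have Dm: "(\<lambda>Y. D j Y (Y j)) \<in> borel_measurable (iid M n)" "m2 j \<in> borel_measurable (iid M n)"
    "(\<lambda>Y. G.D j Y (Y j)) \<in> borel_measurable (iid M n)" if "j \<in> {1..n}" for j
    using that D_measurable_iid[of j n] m2_measurable[of j n] G.D_measurable_iid[of j n] by auto
  have Vm[measurable]: "V \<in> borel_measurable (iid M n)" and Qm[measurable]: "Q \<in> borel_measurable (iid M n)"
    and Rm[measurable]: "R \<in> borel_measurable (iid M n)"
    unfolding V_def Q_def R_def
    by (intro borel_measurable_sum borel_measurable_add borel_measurable_diff borel_measurable_times
        borel_measurable_divide borel_measurable_power borel_measurable_const Dm; assumption)+
  have V: "V Y \<le> Q Y / 3 + ?s + R Y" for Y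
  proof -
    have "V Y = Q Y / 3 + (\<Sum>j=1..n. m2 j Y)"
      unfolding V_def Q_def by (simp add: sum.distrib sum_subtractf sum_divide_distrib[symmetric] sum_distrib_left[symmetric] field_simps)
    then show ?thesis using sum_m2_le[OF S, where n=n and Y=Y] by (simp add: R_def G.D_def)
  qed
  have Qb: "\<bar>Q Y\<bar> \<le> (\<Sum>j=1..n. 2 * (real j * A)\<^sup>2)" for Y
    unfolding Q_def
  proof (rule order_trans[OF sum_abs sum_mono])
    show "\<bar>(D j Y (Y j))\<^sup>2 - m2 j Y\<bar> \<le> 2 * (real j * A)\<^sup>2" for j
      using m2_le[of j Y] m2_nonneg[of j Y] power_bounded[OF D_bound[of j Y "Y j"], of 2]
        zero_le_power2[of "D j Y (Y j)"] zero_le_power2[of "real j * A"] by (simp only: abs_le_iff) linarith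
  qed
  have Rb: "\<bar>R Y\<bar> \<le> (\<Sum>l=1..n. 2 * real (n - l) * (real l * A\<^sup>2))" for Y
    unfolding R_def
    by (rule order_trans[OF sum_abs sum_mono]) (auto simp: abs_mult intro!: mult_left_mono G.D_bound)
  have iQ: "integrable (iid M n) (\<lambda>Y. (Q Y)\<^sup>2)"
    by (rule integrable_iid_bounded[OF _ power_bounded[OF Qb]]) measurable
  have iR: "integrable (iid M n) (\<lambda>Y. (R Y)\<^sup>2)"
    by (rule integrable_iid_bounded[OF _ power_bounded[OF Rb]]) measurable
  have G0: "0 \<le> \<Gamma>" by (rule order_trans[OF _ Gam]) (auto intro!: integral_nonneg_AE)
  have PQ: "measure (iid M n) {Y \<in> space (iid M n). Q Y \<ge> 3 * ?s} \<le> A\<^sup>2 / (9 * (real n)\<^sup>2 * S) + 1 / (3 * real n)"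
  proof -
    have "measure (iid M n) {Y \<in> space (iid M n). Q Y \<ge> 3 * ?s} \<le> (\<integral>Y. (Q Y)\<^sup>2 \<partial>iid M n) / (3 * ?s)\<^sup>2"
      using s by (intro Y.Markov_square(1)[OF Qm iQ]) auto
    also have "\<dots> \<le> ((real n)\<^sup>2 * (A\<^sup>2 * S) + 3 * real n ^ 3 * S\<^sup>2) / (3 * ?s)\<^sup>2"
      unfolding Q_def by (intro divide_right_mono Q_square S) auto
    also have "\<dots> = A\<^sup>2 / (9 * (real n)\<^sup>2 * S) + 1 / (3 * real n)"
      using n0 Spos by (simp add: field_simps power2_eq_square power3_eq_cube)
    finally show ?thesis .
  qed
  have PR: "measure (iid M n) {Y \<in> space (iid M n). R Y \<ge> ?s} \<le> 4 * \<Gamma> / S\<^sup>2"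
  proof -
    have "(\<integral>Y. (R Y)\<^sup>2 \<partial>iid M n) = (\<Sum>j=1..n. (2 * real (n - j))\<^sup>2 * (real (j - 1) * (\<integral>y. (\<integral>x. (G x y)\<^sup>2 \<partial>M) \<partial>M)))"
      unfolding R_def by (rule G.weighted_square)
    also have "\<dots> \<le> (\<Sum>j=1..n. (2 * real n)\<^sup>2 * (real n * \<Gamma>))"
      using Gam G0 by (intro sum_mono mult_mono power_mono) (auto intro!: integral_nonneg_AE)
    also have "\<dots> = 4 * real n ^ 4 * \<Gamma>" by (simp add: power2_eq_square power4_eq_xxxx)
    finally have R2: "(\<integral>Y. (R Y)\<^sup>2 \<partial>iid M n) \<le> 4 * real n ^ 4 * \<Gamma>" .
    have "measure (iid M n) {Y \<in> space (iid M n). R Y \<ge> ?s} \<le> (\<integral>Y. (R Y)\<^sup>2 \<partial>iid M n) / ?s\<^sup>2"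
      using s by (intro Y.Markov_square(1)[OF Rm iR]) auto
    also have "\<dots> \<le> 4 * real n ^ 4 * \<Gamma> / ?s\<^sup>2" by (intro divide_right_mono R2) auto
    also have "\<dots> = 4 * \<Gamma> / S\<^sup>2"
      using n0 Spos by (simp add: power_mult_distrib power2_eq_square power4_eq_xxxx)
    finally show ?thesis .
  qed
  have "measure (iid M n) {Y \<in> space (iid M n). U n Y \<ge> x} \<le>
    measure (iid M n) ({Y \<in> space (iid M n). U n Y \<ge> x \<and> V Y \<le> 3 * ?s} \<union>
      ({Y \<in> space (iid M n). R Y \<ge> ?s} \<union> {Y \<in> space (iid M n). Q Y \<ge> 3 * ?s}))"
  proof (rule Y.finite_measure_mono)
    show "{Y \<in> space (iid M n). U n Y \<ge> x} \<subseteq> {Y \<in> space (iid M n). U n Y \<ge> x \<and> V Y \<le> 3 * ?s} \<union>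
      ({Y \<in> space (iid M n). R Y \<ge> ?s} \<union> {Y \<in> space (iid M n). Q Y \<ge> 3 * ?s})"
    proof (rule subsetI)
      fix Y assume Y: "Y \<in> {Y \<in> space (iid M n). U n Y \<ge> x}"
      show "Y \<in> {Y \<in> space (iid M n). U n Y \<ge> x \<and> V Y \<le> 3 * ?s} \<union>
        ({Y \<in> space (iid M n). R Y \<ge> ?s} \<union> {Y \<in> space (iid M n). Q Y \<ge> 3 * ?s})"
      proof (cases "R Y \<ge> ?s \<or> Q Y \<ge> 3 * ?s")
        case False
        then have "V Y \<le> 3 * ?s" using V[of Y] by linarith
        then show ?thesis using Y by (simp only: mem_Collect_eq Un_iff simp_thms)
      qed (use Y in \<open>simp only: mem_Collect_eq Un_iff; elim disjE; simp only: simp_thms\<close>)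
    qed
  qed measurable
  also have "\<dots> \<le> measure (iid M n) {Y \<in> space (iid M n). U n Y \<ge> x \<and> V Y \<le> 3 * ?s} +
      (measure (iid M n) {Y \<in> space (iid M n). R Y \<ge> ?s} + measure (iid M n) {Y \<in> space (iid M n). Q Y \<ge> 3 * ?s})"
    by (rule order_trans[OF measure_Un_le add_left_mono[OF measure_Un_le]]) measurable
  also have "\<dots> \<le> exp (- x\<^sup>2 / (2 * (3 * ?s))) + (4 * \<Gamma> / S\<^sup>2 + (A\<^sup>2 / (9 * (real n)\<^sup>2 * S) + 1 / (3 * real n)))"
    using s x by (intro add_mono PQ PR exp_tail[OF Vm V_def]) auto
  also have "2 * (3 * ?s) = 6 * (real n)\<^sup>2 * S" by simp
  finally show ?thesis by (simp only: add.assoc)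
qed

text \<open>The one-sided bound is applied to \<open>H\<close> and to its negative, which share the
  kernel \<open>G\<close>.\<close>

lemma U_tail:
  assumes S: "\<And>y. expectation (\<lambda>x. (H x y)\<^sup>2) \<le> S" and Spos: "S > 0" and n: "n \<ge> 1"
    and Gam: "(\<integral>y. (\<integral>x. (G x y)\<^sup>2 \<partial>M) \<partial>M) \<le> \<Gamma>" and x: "x > 0"
  shows "measure (iid M n) {Y \<in> space (iid M n). \<bar>U n Y\<bar> \<ge> x}
    \<le> 2 * (exp (- x\<^sup>2 / (6 * (real n)\<^sup>2 * S)) + (4 * \<Gamma> / S\<^sup>2 + A\<^sup>2 / (9 * (real n)\<^sup>2 * S) + 1 / (3 * real n)))"
proof -
  interpret Y: prob_space "iid M n" by (rule prob_space_iid)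
  interpret N: degenerate_kernel M "\<lambda>x y. - H x y" A
  proof
    show "(\<lambda>(x, y). - H x y) \<in> borel_measurable (M \<Otimes>\<^sub>M M)"
      using borel_measurable_uminus[OF H_measurable] by (simp add: case_prod_beta')
    show "- H x y = - H y x" for x y using H_sym[of x y] by simp
  qed (simp_all add: space_UNIV H_bound H_degenerate)
  have D: "N.D j Y y = - D j Y y" for j Y y by (simp add: N.D_def D_def sum_negf)
  have U: "N.U n Y = - U n Y" for Y by (simp add: N.U_def U_def D sum_negf)
  have m1: "{Y \<in> space (iid M n). U n Y \<ge> x} \<in> sets (iid M n)" by measurable
  have m2: "{Y \<in> space (iid M n). N.U n Y \<ge> x} \<in> sets (iid M n)" by measurable
  have G: "N.G = G" by (simp add: N.G_def G_def fun_eq_iff)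
  have "measure (iid M n) {Y \<in> space (iid M n). \<bar>U n Y\<bar> \<ge> x} \<le>
    measure (iid M n) ({Y \<in> space (iid M n). U n Y \<ge> x} \<union> {Y \<in> space (iid M n). N.U n Y \<ge> x})"
    by (rule Y.finite_measure_mono[OF _ sets.Un[OF m1 m2]]) (auto simp: U)
  also have "\<dots> \<le> measure (iid M n) {Y \<in> space (iid M n). U n Y \<ge> x} + measure (iid M n) {Y \<in> space (iid M n). N.U n Y \<ge> x}"
    by (rule measure_Un_le[OF m1 m2])
  finally show ?thesis
    using U_upper_tail[OF assms] N.U_upper_tail[of S n \<Gamma> x] assms by (simp add: G)
qed

lemma U_square:
  assumes S: "\<And>y. expectation (\<lambda>x. (H x y)\<^sup>2) \<le> S"
  shows "integrable (iid M n) (\<lambda>Y. (U n Y)\<^sup>2)" "(\<integral>Y. (U n Y)\<^sup>2 \<partial>iid M n) \<le> (real n)\<^sup>2 * S"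
proof -
  have S0: "0 \<le> S" by (rule order_trans[OF _ S[of undefined]]) auto
  have b: "\<bar>U n Y\<bar> \<le> (\<Sum>j=1..n. real j * A)" for Y
    unfolding U_def by (rule order_trans[OF sum_abs sum_mono]) (rule D_bound)
  show "integrable (iid M n) (\<lambda>Y. (U n Y)\<^sup>2)"
    by (rule integrable_iid_bounded[OF _ power_bounded[OF b]]) measurable
  have "(\<integral>y. (\<integral>x. (H x y)\<^sup>2 \<partial>M) \<partial>M) \<le> (\<integral>y. S \<partial>M)"
    using S S0 by (intro Bochner_Integration.integral_mono') auto
  then have I: "(\<integral>y. (\<integral>x. (H x y)\<^sup>2 \<partial>M) \<partial>M) \<le> S" by (simp add: prob_space)
  have "(\<integral>Y. (U n Y)\<^sup>2 \<partial>iid M n) = (\<Sum>j=1..n. 1\<^sup>2 * (real (j - 1) * (\<integral>y. (\<integral>x. (H x y)\<^sup>2 \<partial>M) \<partial>M)))"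
    using weighted_square[where w="\<lambda>_. 1" and n=n] by (simp add: U_def)
  also have "\<dots> \<le> (\<Sum>j=1..n. real n * S)"
    using I S0 by (intro sum_mono) (auto intro!: mult_mono integral_nonneg_AE)
  also have "\<dots> = (real n)\<^sup>2 * S" by (simp add: power2_eq_square)
  finally show "(\<integral>Y. (U n Y)\<^sup>2 \<partial>iid M n) \<le> (real n)\<^sup>2 * S" .
qed

end

section \<open>The deconvolution kernel\<close>

text \<open>Multipliers that are bounded and vanish outside the band [-T, T]. They are closed under
  products and conjugation and lie in L1 and L2, so that Fubini's and Plancherel's theorems apply to
  all of them.\<close>

definition bc :: "real \<Rightarrow> (real \<Rightarrow> complex) \<Rightarrow> bool" where
  "bc T m \<longleftrightarrow> m \<in> borel_measurable borel \<and> (\<exists>B. \<forall>u. cmod (m u) \<le> B * indicator {-T..T} u)"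

lemma bcI: "m \<in> borel_measurable borel \<Longrightarrow> (\<And>u. cmod (m u) \<le> B * indicator {-T..T} u) \<Longrightarrow> bc T m"
  unfolding bc_def by auto

lemma bc_measurable: "bc T m \<Longrightarrow> m \<in> borel_measurable borel"
  unfolding bc_def by auto

lemma integrable_indicator_mult: fixes T :: real shows "integrable lborel (\<lambda>u. B * indicator {-T..T} u :: real)"
  by (intro integrable_mult_right integrable_real_indicator) (auto simp: emeasure_lborel_Icc_eq)

lemma bc_integrable: assumes "bc T m" shows "integrable lborel m"
proof -
  obtain B where B: "\<And>u. cmod (m u) \<le> B * indicator {-T..T} u" using assms unfolding bc_def by auto
  show ?thesis
    by (rule Bochner_Integration.integrable_bound[OF integrable_indicator_mult[of B T]])
      (use bc_measurable[OF assms] B in \<open>auto intro!: AE_I2 intro: order_trans[OF _ abs_ge_self]\<close>)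
qed

lemma bc_mult: assumes "bc T m" "bc T p" shows "bc T (\<lambda>u. m u * p u)"
proof -
  obtain B C where B: "\<And>u. cmod (m u) \<le> B * indicator {-T..T} u" and C: "\<And>u. cmod (p u) \<le> C * indicator {-T..T} u"
    using assms unfolding bc_def by auto
  have "cmod (m u * p u) \<le> (B * C) * indicator {-T..T} u" for u
    using mult_mono[OF B[of u] C[of u]] order_trans[OF norm_ge_zero B[of u]]
    by (auto simp: norm_mult indicator_def split: if_splits)
  then show ?thesis using assms[THEN bc_measurable] by (intro bcI[of _ "B * C"]) auto
qed

lemma bc_cnj: "bc T m \<Longrightarrow> bc T (\<lambda>u. cnj (m u))"
  unfolding bc_def complex_mod_cnj by (intro conjI measurable_compose[OF _ cnj_borel_measurable]) (blast+)

lemma bc_square_integrable: "bc T m \<Longrightarrow> integrable lborel (\<lambda>u. (cmod (m u))\<^sup>2)"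
proof -
  assume m: "bc T m"
  have "integrable lborel (\<lambda>u. Re (m u * cnj (m u)))"
    using bc_integrable[OF bc_mult[OF m bc_cnj[OF m]]] by (rule integrable_Re)
  moreover have "Re (m u * cnj (m u)) = (cmod (m u))\<^sup>2" for u
    unfolding cmod_power2 by (simp add: power2_eq_square)
  ultimately show ?thesis by simp
qed

lemma cmod_square_integral: "complex_of_real (LINT u|lborel. (cmod (m u))\<^sup>2) = (CLINT u|lborel. m u * cnj (m u))"
  unfolding integral_complex_of_real[symmetric] by (simp add: complex_norm_square del: of_real_power)

text \<open>Hermitian symmetry, the frequency-side form of being real valued: reflection shows that
  the integral equals its own conjugate.\<close>

lemma integral_reflect_cnj:
  fixes F :: "real \<Rightarrow> complex"
  assumes "\<And>u. F (- u) = cnj (F u)"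
  shows "Im (integral\<^sup>L lborel F) = 0"
proof -
  have "integral\<^sup>L lborel F = (CLINT u|lborel. F (- u))"
    using lborel_integral_real_affine[of "-1" F 0] by simp
  also have "\<dots> = cnj (integral\<^sup>L lborel F)"
    unfolding assms by (rule Bochner_Integration.integral_cnj)
  finally have "Im (integral\<^sup>L lborel F) = Im (cnj (integral\<^sup>L lborel F))" by (rule arg_cong)
  then show ?thesis unfolding cnj.sel by linarith
qed

text \<open>\<open>M\<close> is the law of one observation, \<Phi> the transform of the unobserved
  density and \<kappa> the inverse of the noise transform on the band; \<open>char_kappa\<close>
  says that deconvolution is exact there. \<open>K\<close> measures the ill-posedness, and
  \<open>moment\<close> is the form in which integrability of the noise transform enters.\<close>

locale deconvolution = prob_space M for M :: "real measure" +
  fixes \<Phi> \<kappa> :: "real \<Rightarrow> complex" and T K b :: real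
  assumes sets_M [measurable_cong]: "sets M = sets borel"
    and T: "T > 0" and K: "K \<ge> 1" and b: "b > 0"
    and \<kappa>_measurable [measurable]: "\<kappa> \<in> borel_measurable borel"
    and \<Phi>_measurable [measurable]: "\<Phi> \<in> borel_measurable borel"
    and \<kappa>_bound: "\<And>u. \<bar>u\<bar> \<le> T \<Longrightarrow> cmod (\<kappa> u) \<le> K"
    and \<Phi>_bound: "\<And>u. cmod (\<Phi> u) \<le> 1"
    and \<kappa>_cnj: "\<And>u. \<kappa> (- u) = cnj (\<kappa> u)" and \<Phi>_cnj: "\<And>u. \<Phi> (- u) = cnj (\<Phi> u)"
    and char_kappa: "\<And>u. \<bar>u\<bar> \<le> T \<Longrightarrow> char M u * \<kappa> u = \<Phi> u"
    and moment: "\<And>m. bc T m \<Longrightarrow> expectation (\<lambda>y. (cmod (ft m y))\<^sup>2) \<le> b * (LINT u|lborel. (cmod (m u))\<^sup>2)"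
begin

lemma space_M: "space M = UNIV"
  using sets_eq_imp_space_eq[OF sets_M] by simp

interpretation PL: pair_sigma_finite M "lborel :: real measure" ..

lemma integrable_pair:
  fixes F :: "real \<Rightarrow> real \<Rightarrow> complex"
  assumes F: "case_prod F \<in> borel_measurable (borel \<Otimes>\<^sub>M borel)" and B: "\<And>y u. cmod (F y u) \<le> B * indicator {-T..T} u"
  shows "integrable (M \<Otimes>\<^sub>M lborel) (case_prod F)"
proof -
  have [measurable]: "case_prod F \<in> borel_measurable (M \<Otimes>\<^sub>M lborel)" using F by measurable
  have Fy: "bc T (F y)" for y
    using B measurable_compose[OF _ F, of "\<lambda>u. (y, u)" borel] by (intro bcI[of _ B]) auto
  show ?thesis
  proof (rule PL.Fubini_integrable)
    show "integrable M (\<lambda>y. LINT u|lborel. norm (case (y, u) of (y, u) \<Rightarrow> F y u))"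
    proof (rule integrable_const_bound[where B="LINT u|lborel. B * indicator {-T..T} u"])
      show "AE y in M. norm (LINT u|lborel. norm (case (y, u) of (y, u) \<Rightarrow> F y u)) \<le> (LINT u|lborel. B * indicator {-T..T} u)"
      proof (intro AE_I2)
        fix y
        have "(LINT u|lborel. cmod (F y u)) \<le> (LINT u|lborel. B * indicator {-T..T} u)"
          using bc_integrable[OF Fy[of y]] by (intro integral_mono integrable_indicator_mult B) auto
        then show "norm (LINT u|lborel. norm (case (y, u) of (y, u) \<Rightarrow> F y u)) \<le> (LINT u|lborel. B * indicator {-T..T} u)"
          by (simp only: case_prod_conv real_norm_def abs_of_nonneg[OF integral_nonneg_AE[OF AE_I2[OF norm_ge_zero]]])
      qed
    qed measurable
  qed (use bc_integrable[OF Fy] in auto)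
qed

lemma swap:
  fixes F :: "real \<Rightarrow> real \<Rightarrow> complex"
  assumes F: "case_prod F \<in> borel_measurable (borel \<Otimes>\<^sub>M borel)" and B: "\<And>y u. cmod (F y u) \<le> B * indicator {-T..T} u"
  shows "(CLINT y|M. CLINT u|lborel. F y u) = (CLINT u|lborel. CLINT y|M. F y u)"
  using PL.Fubini_integral[OF integrable_pair[OF assms]] by simp

text \<open>\<open>a y\<close> is the Fourier transform of the kernel translated to the observation \<open>y\<close>, centred and restricted to
  the band; \<open>la\<close> pairs it with a multiplier, and \<open>H\<close> is the kernel of the U-statistic.\<close>

definition a :: "real \<Rightarrow> real \<Rightarrow> complex" where
  "a y u = indicator {-T..T} u * (iexp (u * y) * \<kappa> u - \<Phi> u)"

lemma a_measurable2 [measurable]: "(\<lambda>w. a (fst w) (snd w)) \<in> borel_measurable (borel \<Otimes>\<^sub>M borel)"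
  unfolding a_def by measurable

lemma a_measurable [measurable]: "a y \<in> borel_measurable borel" "(\<lambda>y. a y u) \<in> borel_measurable borel"
  unfolding a_def by measurable

lemma a_bound: "cmod (a y u) \<le> (2 * K) * indicator {-T..T} u"
proof (cases "\<bar>u\<bar> \<le> T")
  case True
  have "cmod (iexp (u * y) * \<kappa> u - \<Phi> u) \<le> cmod (iexp (u * y) * \<kappa> u) + cmod (\<Phi> u)" by (rule norm_triangle_ineq4)
  also have "\<dots> \<le> 2 * K" using \<kappa>_bound[OF True] \<Phi>_bound[of u] K by (simp add: norm_mult)
  finally show ?thesis using True by (simp add: a_def indicator_def abs_le_iff)
qed (auto simp: a_def indicator_def)

lemma a_bc: "bc T (a y)"
  using a_bound by (intro bcI[of _ "2 * K"]) auto

lemma a_cnj: "a y (- u) = cnj (a y u)"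
  by (auto simp: a_def \<kappa>_cnj \<Phi>_cnj exp_cnj indicator_def)

definition la :: "(real \<Rightarrow> complex) \<Rightarrow> real \<Rightarrow> complex" where
  "la m y = (CLINT u|lborel. m u * a y u)"

lemma la_measurable [measurable]: "bc T m \<Longrightarrow> la m \<in> borel_measurable borel"
  unfolding la_def using bc_measurable[of T m] by measurable

lemma a_mean: "(CLINT y|M. a y u) = 0"
proof (cases "\<bar>u\<bar> \<le> T")
  case True
  have "(CLINT y|M. iexp (u * y) * \<kappa> u - \<Phi> u) = char M u * \<kappa> u - \<Phi> u"
    using integrable_iexp[of "\<lambda>y. u * y"] by (simp add: char_def prob_space)
  then show ?thesis using True char_kappa[OF True] by (simp add: a_def)
qed (auto simp: a_def indicator_def)

lemma bc_la_bound:
  assumes "bc T m" obtains B where "\<And>y u. cmod (m u * a y u) \<le> B * indicator {-T..T} u" "\<And>y. cmod (la m y) \<le> B * (2 * T)"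
proof -
  obtain B where B: "\<And>u. cmod (m u) \<le> B * indicator {-T..T} u" using assms unfolding bc_def by auto
  have 1: "cmod (m u * a y u) \<le> (B * (2 * K)) * indicator {-T..T} u" for y u
    using mult_mono[OF B[of u] a_bound[of y u]] order_trans[OF norm_ge_zero B[of u]]
    by (auto simp: norm_mult indicator_def split: if_splits)
  have "cmod (la m y) \<le> (LINT u|lborel. (B * (2 * K)) * indicator {-T..T} u)" for y
    unfolding la_def
    by (rule order_trans[OF integral_norm_bound integral_mono])
      (use bc_integrable[OF bc_mult[OF assms a_bc]] integrable_indicator_mult 1 in auto)
  then have "cmod (la m y) \<le> (B * (2 * K)) * (2 * T)" for y using T by simp
  with 1 show thesis using that by blast
qed

lemma la_mean: assumes "bc T m" shows "(CLINT y|M. la m y) = 0"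
proof -
  have [measurable]: "m \<in> borel_measurable borel" using assms by (rule bc_measurable)
  obtain B where B: "\<And>y u. cmod (m u * a y u) \<le> B * indicator {-T..T} u" "\<And>y. cmod (la m y) \<le> B * (2 * T)"
    by (rule bc_la_bound[OF assms]) (rule that; assumption)
  have "(CLINT y|M. la m y) = (CLINT u|lborel. CLINT y|M. m u * a y u)"
    unfolding la_def
  proof (rule swap[OF _ B(1)])
    show "(\<lambda>(y, u). m u * a y u) \<in> borel_measurable (borel \<Otimes>\<^sub>M borel)"
      unfolding a_def by measurable
  qed
  also have "\<dots> = 0" using a_mean by simp
  finally show ?thesis .
qed

lemma la_integrable:
  assumes "bc T m" shows "integrable M (la m)" "integrable M (\<lambda>y. (cmod (la m y))\<^sup>2)"
proof -
  note [measurable] = la_measurable[OF assms]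
  obtain B where "\<And>y u. cmod (m u * a y u) \<le> B * indicator {-T..T} u" and B: "\<And>y. cmod (la m y) \<le> B * (2 * T)"
    by (rule bc_la_bound[OF assms]) (rule that; assumption)
  show "integrable M (la m)"
    by (rule integrable_const_bound[where B="B * (2 * T)"]) (use B in auto)
  have "(cmod (la m y))\<^sup>2 \<le> (B * (2 * T))\<^sup>2" for y by (intro power_mono B) auto
  then show "integrable M (\<lambda>y. (cmod (la m y))\<^sup>2)"
    by (intro integrable_const_bound[where B="(B * (2 * T))\<^sup>2"]) auto
qed

text \<open>The centred variable \<open>la m\<close> has smaller second moment than the uncentred \<open>ft (m \<kappa>)\<close>.\<close>

lemma la_square:
  assumes m: "bc T m" shows "expectation (\<lambda>y. (cmod (la m y))\<^sup>2) \<le> b * K\<^sup>2 * (LINT u|lborel. (cmod (m u))\<^sup>2)"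
proof -
  note mm[measurable] = bc_measurable[OF m] la_measurable[OF m]
  obtain B where B: "\<And>u. cmod (m u) \<le> B * indicator {-T..T} u" using m unfolding bc_def by auto
  have mk: "cmod (m u * \<kappa> u) \<le> K * cmod (m u)" for u
  proof (cases "\<bar>u\<bar> \<le> T")
    case True
    then show ?thesis using mult_right_mono[OF \<kappa>_bound[OF True] norm_ge_zero[of "m u"]] by (simp add: norm_mult mult.commute)
  next
    case False
    then show ?thesis using B[of u] by (auto simp: indicator_def abs_le_iff split: if_splits)
  qed
  have k: "bc T (\<lambda>u. m u * \<kappa> u)"
  proof (rule bcI[of _ "K * B"])
    show "cmod (m u * \<kappa> u) \<le> K * B * indicator {-T..T} u" for u
      using order_trans[OF mk[of u] mult_left_mono[OF B[of u], of K]] K by (simp add: mult.assoc)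
  qed measurable
  define q where "q = ft (\<lambda>u. m u * \<kappa> u)"
  define c where "c = (CLINT u|lborel. m u * \<Phi> u * indicator {-T..T} u)"
  have mphi: "integrable lborel (\<lambda>u. m u * \<Phi> u * indicator {-T..T} u)"
    by (rule Bochner_Integration.integrable_bound[OF bc_integrable[OF m]])
      (auto intro!: AE_I2 simp: norm_mult indicator_def mult_left_le \<Phi>_bound)
  have [measurable]: "q \<in> borel_measurable borel" unfolding q_def by measurable
  have la: "la m y = q y - c" for y
  proof -
    have "la m y = (CLINT u|lborel. iexp (y * u) * (m u * \<kappa> u) - m u * \<Phi> u * indicator {-T..T} u)"
      unfolding la_def a_def
    proof (rule Bochner_Integration.integral_cong)
      show "m u * (indicator {-T..T} u * (iexp (u * y) * \<kappa> u - \<Phi> u)) = iexp (y * u) * (m u * \<kappa> u) - m u * \<Phi> u * indicator {-T..T} u" for u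
        using B[of u] by (cases "u \<in> {-T..T}") (auto simp: algebra_simps)
    qed simp
    also have "\<dots> = q y - c" unfolding q_def ft_def c_def
      by (rule Bochner_Integration.integral_diff[OF integrable_iexp_mult[OF bc_integrable[OF k]] mphi]) measurable
    finally show ?thesis .
  qed
  have qi: "integrable M q"
    using Bochner_Integration.integrable_add[OF la_integrable(1)[OF m] integrable_const[of c]] by (simp add: la)
  then have Eq: "(CLINT y|M. q y) = c" using la_mean[OF m] unfolding la by (simp add: prob_space)
  have q2: "(cmod (q y))\<^sup>2 = (cmod (la m y))\<^sup>2 + 2 * Re (la m y * cnj c) + (cmod c)\<^sup>2" for y
    unfolding la cmod_power2 by (simp add: power2_eq_square algebra_simps)
  define r where "r y = Re (la m y * cnj c)" for y
  have R: "integrable M r" "expectation r = 0"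
    unfolding r_def using la_integrable(1)[OF m] la_mean[OF m] by (auto intro!: integrable_Re integrable_mult_left)
  have "expectation (\<lambda>y. (cmod (la m y))\<^sup>2) \<le> expectation (\<lambda>y. (cmod (q y))\<^sup>2)"
    unfolding q2 r_def[symmetric] using la_integrable(2)[OF m] R by (simp add: prob_space)
  also have "\<dots> \<le> b * (LINT u|lborel. (cmod (m u * \<kappa> u))\<^sup>2)" unfolding q_def by (rule moment[OF k])
  also have "\<dots> \<le> b * (LINT u|lborel. K\<^sup>2 * (cmod (m u))\<^sup>2)"
    using b bc_square_integrable[OF m] bc_square_integrable[OF k] power_mono[OF mk norm_ge_zero, where n=2]
    by (intro mult_left_mono integral_mono) (auto simp: power_mult_distrib)
  finally show ?thesis by (simp add: mult.assoc)
qed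

definition H :: "real \<Rightarrow> real \<Rightarrow> real" where
  "H x y = Re (CLINT u|lborel. a x u * cnj (a y u)) / (2 * pi)"

lemma H_complex: "(CLINT u|lborel. a x u * cnj (a y u)) = complex_of_real (2 * pi * H x y)"
proof -
  have "Im (CLINT u|lborel. a x u * cnj (a y u)) = 0"
    by (rule integral_reflect_cnj) (simp add: a_cnj)
  moreover have "Re (CLINT u|lborel. a x u * cnj (a y u)) = 2 * pi * H x y"
    unfolding H_def by simp
  ultimately show ?thesis by (intro complex_eqI) (simp_all only: Re_complex_of_real Im_complex_of_real)
qed

lemma H_sym: "H x y = H y x"
proof -
  have "cnj (CLINT u|lborel. a y u * cnj (a x u)) = (CLINT u|lborel. cnj (a y u * cnj (a x u)))"
    by (rule Bochner_Integration.integral_cnj[symmetric])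
  also have "(\<lambda>u. cnj (a y u * cnj (a x u))) = (\<lambda>u. a x u * cnj (a y u))"
    by (rule ext) (simp only: complex_cnj_mult complex_cnj_cnj mult.commute)
  finally have "Re (cnj (CLINT u|lborel. a y u * cnj (a x u))) = Re (CLINT u|lborel. a x u * cnj (a y u))"
    by (rule arg_cong)
  then show ?thesis unfolding H_def by (simp only: cnj.sel)
qed

lemma H_la: "complex_of_real (2 * pi * H x y) = la (\<lambda>u. cnj (a x u)) y"
  unfolding la_def H_sym[of x y] H_complex[symmetric]
  by (rule arg_cong[where f="integral\<^sup>L lborel"], rule ext, rule mult.commute)

lemma a_norm: "(LINT u|lborel. (cmod (a y u))\<^sup>2) \<le> 8 * T * K\<^sup>2"
proof -
  have "(cmod (a y u))\<^sup>2 \<le> (4 * K\<^sup>2) * indicator {-T..T} u" for u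
    using power_mono[OF a_bound[of y u] norm_ge_zero, where n=2] by (cases "u \<in> {-T..T}") (auto simp: power_mult_distrib)
  then have "(LINT u|lborel. (cmod (a y u))\<^sup>2) \<le> (LINT u|lborel. (4 * K\<^sup>2) * indicator {-T..T} u)"
    by (intro integral_mono bc_square_integrable[OF a_bc] integrable_indicator_mult)
  then show ?thesis using T by (simp add: algebra_simps)
qed

lemma H_bound: "\<bar>H x y\<bar> \<le> 2 * T * K\<^sup>2"
proof -
  have "cmod (CLINT u|lborel. a x u * cnj (a y u)) \<le> (LINT u|lborel. ((cmod (a x u))\<^sup>2 + (cmod (a y u))\<^sup>2) / 2)"
    by (rule order_trans[OF integral_norm_bound integral_mono])
      (use bc_integrable[OF bc_mult[OF a_bc bc_cnj[OF a_bc]]] bc_square_integrable[OF a_bc] norm_mult_le_half[of "a x _" "cnj (a y _)"] in auto)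
  also have "\<dots> \<le> 8 * T * K\<^sup>2"
    using a_norm[of x] a_norm[of y] bc_square_integrable[OF a_bc] by simp
  finally have "2 * pi * \<bar>H x y\<bar> \<le> 8 * T * K\<^sup>2"
    unfolding H_complex norm_of_real by (simp add: abs_mult)
  \<comment> \<open>Since 4 \<le> 2 * pi, the constant 8 of the energy bound becomes 2.\<close>
  moreover have "2 * 2 * \<bar>H x y\<bar> \<le> 2 * pi * \<bar>H x y\<bar>" using pi_gt3 by (intro mult_right_mono) auto
  ultimately show ?thesis by linarith
qed

lemma H_measurable: "case_prod H \<in> borel_measurable (M \<Otimes>\<^sub>M M)"
proof -
  have "(\<lambda>w. CLINT u|lborel. a (fst w) u * cnj (a (snd w) u)) \<in> borel_measurable (M \<Otimes>\<^sub>M M)"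
    unfolding a_def by measurable
  then show ?thesis unfolding H_def case_prod_beta by measurable
qed

sublocale H: degenerate_kernel M H "2 * T * K\<^sup>2"
proof
  show "expectation (\<lambda>x. H x y) = 0" for y
  proof -
    have "complex_of_real (expectation (\<lambda>x. 2 * pi * H y x)) = (CLINT x|M. la (\<lambda>u. cnj (a y u)) x)"
      unfolding integral_complex_of_real[symmetric] H_la ..
    also have "\<dots> = 0" by (rule la_mean[OF bc_cnj[OF a_bc]])
    finally show ?thesis unfolding H_sym[of y] by simp
  qed
qed (fact space_M H_measurable H_bound H_sym)+

text \<open>Up to the factor 2 * pi, \<open>H y\<close> is \<open>la\<close> of the conjugate of
  \<open>a y\<close>, so \<open>la_square\<close> and \<open>a_norm\<close> give b * K^2 * (8 * T *
  K^2), and the 8 is absorbed by (2 * pi)^2. With K of order T powr \<sigma> the bound is of order T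
  powr (4 * \<sigma> + 1).\<close>

lemma H_square: "expectation (\<lambda>x. (H x y)\<^sup>2) \<le> b * T * K ^ 4"
proof -
  have e: "(cmod (la (\<lambda>u. cnj (a y u)) x))\<^sup>2 = (2 * pi)\<^sup>2 * (H x y)\<^sup>2" for x
    unfolding H_la[symmetric] norm_of_real H_sym[of y x] by (simp add: power_mult_distrib)
  have "(2 * pi)\<^sup>2 * expectation (\<lambda>x. (H x y)\<^sup>2) \<le> b * K\<^sup>2 * (LINT u|lborel. (cmod (a y u))\<^sup>2)"
    using la_square[OF bc_cnj[OF a_bc], of y] unfolding e by simp
  also have "\<dots> \<le> b * K\<^sup>2 * (8 * T * K\<^sup>2)"
    using b by (intro mult_left_mono a_norm) auto
  finally have "(2 * pi)\<^sup>2 * expectation (\<lambda>x. (H x y)\<^sup>2) \<le> 8 * (b * T * K ^ 4)" by (simp add: power4_eq_xxxx power2_eq_square algebra_simps)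
  moreover have "8 * expectation (\<lambda>x. (H x y)\<^sup>2) \<le> (2 * pi)\<^sup>2 * expectation (\<lambda>x. (H x y)\<^sup>2)"
  proof (rule mult_right_mono)
    have "(2 * 3)\<^sup>2 \<le> (2 * pi)\<^sup>2" using pi_gt3 by (intro power_mono) auto
    then show "8 \<le> (2 * pi)\<^sup>2" by simp
  qed auto
  ultimately show ?thesis by linarith
qed

end

section \<open>Operator norm of the kernel, tail of the U-statistic and the linear term\<close>

context deconvolution
begin

lemma H_section [measurable]: "H y \<in> borel_measurable borel"
  using H.H_section_measurable(2)[of y] by (simp add: measurable_cong_sets[OF sets_M refl])

text \<open>\<open>nn y\<close> is the covariance operator of \<open>a\<close> applied to \<open>a y\<close>, up to the factor \<open>2 * pi\<close>.\<close>

definition nn :: "real \<Rightarrow> real \<Rightarrow> complex" where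
  "nn y u = (CLINT z|M. complex_of_real (H y z) * a z u)"

lemma Ha_bound: "cmod (complex_of_real (H y z) * a z u) \<le> (2 * T * K\<^sup>2 * (2 * K)) * indicator {-T..T} u"
proof -
  have "\<bar>H y z\<bar> * cmod (a z u) \<le> (2 * T * K\<^sup>2) * ((2 * K) * indicator {-T..T} u)"
    by (intro mult_mono H_bound a_bound) (use T in auto)
  then show ?thesis by (simp only: norm_mult norm_of_real mult.assoc)
qed

lemma Ha_integrable: "integrable M (\<lambda>z. complex_of_real (H y z) * a z u)"
  by (rule integrable_const_bound[where B="(2 * T * K\<^sup>2 * (2 * K)) * indicator {-T..T} u"])
    (use Ha_bound in auto)

lemma nn_bc: "bc T (nn y)"
proof (rule bcI[of _ "2 * T * K\<^sup>2 * (2 * K)"])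
  have "(\<lambda>(u, z). complex_of_real (H y z) * a z u) \<in> borel_measurable (borel \<Otimes>\<^sub>M M)"
    unfolding a_def by measurable
  from borel_measurable_lebesgue_integral[OF this] show "nn y \<in> borel_measurable borel"
    unfolding nn_def by simp
  show "cmod (nn y u) \<le> (2 * T * K\<^sup>2 * (2 * K)) * indicator {-T..T} u" for u
  proof -
    have "cmod (nn y u) \<le> (LINT z|M. cmod (complex_of_real (H y z) * a z u))"
      unfolding nn_def by (rule integral_norm_bound)
    also have "\<dots> \<le> (LINT z|M. (2 * T * K\<^sup>2 * (2 * K)) * indicator {-T..T} u)"
      using Ha_integrable by (intro integral_mono Ha_bound) auto
    finally show ?thesis by (simp add: prob_space)
  qed
qed

text \<open>By Fubini, pairing with \<open>nn y\<close> is the mean of \<open>H y z\<close> times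
  the pairing with \<open>a z\<close>. Applied to \<open>a x\<close> this produces \<open>G\<close>;
  applied to \<open>nn y\<close> itself, its energy.\<close>

lemma nn_pairing:
  assumes m: "bc T m"
  shows "(CLINT u|lborel. cnj (nn y u) * m u) = (CLINT z|M. complex_of_real (H y z) * (CLINT u|lborel. m u * cnj (a z u)))"
proof -
  obtain B where B: "\<And>u. cmod (m u) \<le> B * indicator {-T..T} u" using m unfolding bc_def by auto
  note [measurable] = bc_measurable[OF m]
  define F where "F z u = complex_of_real (H y z) * (m u * cnj (a z u))" for z u
  have "(CLINT u|lborel. cnj (nn y u) * m u) = (CLINT u|lborel. CLINT z|M. F z u)"
  proof (rule Bochner_Integration.integral_cong[OF refl])
    fix u
    have "cnj (nn y u) * m u = (CLINT z|M. cnj (complex_of_real (H y z) * a z u) * m u)"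
      unfolding nn_def Bochner_Integration.integral_cnj[symmetric] by (rule integral_mult_left_zero[symmetric])
    also have "\<dots> = (CLINT z|M. F z u)"
      unfolding F_def by (rule Bochner_Integration.integral_cong[OF refl]) (simp only: complex_cnj_mult complex_cnj_complex_of_real ac_simps)
    finally show "cnj (nn y u) * m u = (CLINT z|M. F z u)" .
  qed
  also have "\<dots> = (CLINT z|M. CLINT u|lborel. F z u)"
  proof (rule swap[symmetric])
    show "case_prod F \<in> borel_measurable (borel \<Otimes>\<^sub>M borel)" unfolding F_def a_def by measurable
    show "cmod (F z u) \<le> (2 * T * K\<^sup>2 * (B * (2 * K))) * indicator {-T..T} u" for z u
    proof -
      have "\<bar>H y z\<bar> * (cmod (m u) * cmod (a z u)) \<le> (2 * T * K\<^sup>2) * ((B * indicator {-T..T} u) * ((2 * K) * indicator {-T..T} u))"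
        using T by (intro mult_mono H_bound a_bound B) (auto intro: order_trans[OF norm_ge_zero B])
      then show ?thesis unfolding F_def norm_mult norm_of_real complex_mod_cnj
        by (cases "u \<in> {-T..T}") (simp_all add: mult.assoc)
    qed
  qed
  finally show ?thesis unfolding F_def by simp
qed

lemma la_nn: "la (\<lambda>u. cnj (nn y u)) x = complex_of_real (2 * pi * H.G x y)"
proof -
  have "la (\<lambda>u. cnj (nn y u)) x = (CLINT z|M. complex_of_real (H y z) * (CLINT u|lborel. a x u * cnj (a z u)))"
    unfolding la_def by (rule nn_pairing[OF a_bc])
  also have "\<dots> = (CLINT z|M. complex_of_real (2 * pi * (H x z * H y z)))"
    unfolding H_complex by (rule Bochner_Integration.integral_cong[OF refl]) (simp add: algebra_simps)
  also have "\<dots> = complex_of_real (2 * pi * H.G x y)"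
    unfolding integral_complex_of_real H.G_def by simp
  finally show ?thesis .
qed

lemma nn_norm: "(LINT u|lborel. (cmod (nn y u))\<^sup>2) = 2 * pi * expectation (\<lambda>z. H y z * H.G z y)"
proof -
  have "complex_of_real (LINT u|lborel. (cmod (nn y u))\<^sup>2) = (CLINT u|lborel. cnj (nn y u) * nn y u)"
    unfolding cmod_square_integral by (rule arg_cong[where f="integral\<^sup>L lborel"], rule ext, rule mult.commute)
  also have "\<dots> = (CLINT z|M. complex_of_real (H y z) * (CLINT u|lborel. nn y u * cnj (a z u)))"
    by (rule nn_pairing[OF nn_bc])
  also have "\<dots> = (CLINT z|M. complex_of_real (2 * pi * (H y z * H.G z y)))"
  proof (rule Bochner_Integration.integral_cong[OF refl])
    fix z
    have "(CLINT u|lborel. nn y u * cnj (a z u)) = (CLINT u|lborel. cnj (cnj (nn y u) * a z u))"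
      by simp
    also have "\<dots> = cnj (la (\<lambda>u. cnj (nn y u)) z)"
      unfolding la_def by (rule Bochner_Integration.integral_cnj)
    finally show "complex_of_real (H y z) * (CLINT u|lborel. nn y u * cnj (a z u)) = complex_of_real (2 * pi * (H y z * H.G z y))"
      unfolding la_nn by simp
  qed
  also have "\<dots> = complex_of_real (2 * pi * expectation (\<lambda>z. H y z * H.G z y))"
    unfolding integral_complex_of_real by simp
  finally show ?thesis by (simp only: of_real_eq_iff)
qed

text \<open>An operator norm bound: with \<lambda> = b * K^2, applying the operator once more costs
  a factor \<lambda> in norm. Let N be the energy of \<open>nn y\<close>. Then
  \<open>la_square\<close> gives (2 * pi)^2 * E G^2 \<le> \<lambda> * N, while
  \<open>nn_norm\<close> writes N as 2 * pi * E (H * G). Young's inequality and the first bound turn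
  the latter into N \<le> \<lambda> / 2 * E H^2 + N / 2, so that N \<le> \<lambda> * E H^2, and the
  first bound yields the claim.\<close>

lemma G_square: "expectation (\<lambda>x. (H.G x y)\<^sup>2) \<le> (b * K\<^sup>2)\<^sup>2 * expectation (\<lambda>x. (H x y)\<^sup>2)"
proof -
  interpret G: degenerate_kernel M H.G "(2 * T * K\<^sup>2)\<^sup>2" by (rule H.G_degenerate_kernel)
  let ?l = "b * K\<^sup>2" and ?N = "LINT u|lborel. (cmod (nn y u))\<^sup>2"
  let ?EG = "expectation (\<lambda>x. (H.G x y)\<^sup>2)" and ?EH = "expectation (\<lambda>x. (H x y)\<^sup>2)"
  have l: "?l > 0" using b K by simp
  have iH: "integrable M (\<lambda>x. (H x y)\<^sup>2)" and iG: "integrable M (\<lambda>x. (H.G x y)\<^sup>2)"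
    using H.integrable_HH[of y y] G.integrable_HH[of y y] by (simp_all add: power2_eq_square H_sym[of y] G.H_sym[of y])
  have iHG: "integrable M (\<lambda>z. H y z * H.G z y)"
    by (rule integrable_const_bound[where B="(2 * T * K\<^sup>2) * (2 * T * K\<^sup>2)\<^sup>2"])
      (auto simp: abs_mult intro!: mult_mono H_bound G.H_bound borel_measurable_times H.H_section_measurable G.H_section_measurable simp: T less_imp_le)
  have e: "(cmod (la (\<lambda>u. cnj (nn y u)) x))\<^sup>2 = (2 * pi)\<^sup>2 * (H.G x y)\<^sup>2" for x
    unfolding la_nn norm_of_real by (simp add: power_mult_distrib)
  have 1: "(2 * pi)\<^sup>2 * ?EG \<le> ?l * ?N"
    using la_square[OF bc_cnj[OF nn_bc], of y] unfolding e by simp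
  \<comment> \<open>The weights in Young's inequality are chosen so that, by the preceding bound,
    the mean of the \<open>G\<close> term is at most half of the energy of
    \<open>nn y\<close>.\<close>
  have pw: "2 * pi * (H y z * H.G z y) \<le> ?l / 2 * (H z y)\<^sup>2 + 2 * pi\<^sup>2 / ?l * (H.G z y)\<^sup>2" for z
  proof -
    have "0 \<le> (?l * H z y - 2 * pi * H.G z y)\<^sup>2 / (2 * ?l)" using l by simp
    also have "\<dots> = ?l / 2 * (H z y)\<^sup>2 - 2 * pi * (H z y * H.G z y) + 2 * pi\<^sup>2 / ?l * (H.G z y)\<^sup>2"
      using b K by (simp add: power2_diff field_simps power2_eq_square)
    finally show ?thesis by (simp add: H_sym[of y z])
  qed
  have "?N \<le> expectation (\<lambda>z. ?l / 2 * (H z y)\<^sup>2 + 2 * pi\<^sup>2 / ?l * (H.G z y)\<^sup>2)"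
  proof -
    have "?N = expectation (\<lambda>z. 2 * pi * (H y z * H.G z y))" unfolding nn_norm by simp
    also have "\<dots> \<le> expectation (\<lambda>z. ?l / 2 * (H z y)\<^sup>2 + 2 * pi\<^sup>2 / ?l * (H.G z y)\<^sup>2)"
      by (intro integral_mono pw integrable_mult_right iHG Bochner_Integration.integrable_add iH iG)
    finally show ?thesis .
  qed
  also have "\<dots> = ?l / 2 * ?EH + 2 * pi\<^sup>2 / ?l * ?EG"
    using iH iG by (subst Bochner_Integration.integral_add) auto
  also have "2 * pi\<^sup>2 / ?l * ?EG = ((2 * pi)\<^sup>2 * ?EG) / (2 * ?l)" by (simp add: field_simps power2_eq_square)
  also have "\<dots> \<le> (?l * ?N) / (2 * ?l)" using 1 l by (intro divide_right_mono) auto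
  also have "\<dots> = ?N / 2" using b K by simp
  finally have N: "?N \<le> ?l * ?EH" by simp
  have "?EG \<le> (2 * pi)\<^sup>2 * ?EG"
  proof -
    have "1\<^sup>2 \<le> (2 * pi)\<^sup>2" using pi_gt3 by (intro power_mono) auto
    then show ?thesis using mult_right_mono[of 1 "(2 * pi)\<^sup>2" ?EG] by simp
  qed
  also have "\<dots> \<le> ?l * (?l * ?EH)" using 1 mult_left_mono[OF N, of ?l] l by linarith
  finally show ?thesis by (simp add: power2_eq_square mult.assoc)
qed

text \<open>With \<Gamma> = (b * K^2)^2 * S and S = b * T * K^4 the ratio \<Gamma> / S^2 equals b /
  T: the ill-posedness \<open>K\<close> cancels, and the fluctuation of the conditional variances is
  governed by the bandwidth 1 / T.\<close>

lemma H_tail: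
  assumes n: "n \<ge> 1" and x: "x > 0"
  shows "measure (iid M n) {Y \<in> space (iid M n). \<bar>H.U n Y\<bar> \<ge> x}
    \<le> 2 * (exp (- x\<^sup>2 / (6 * (real n)\<^sup>2 * (b * T * K ^ 4))) + (4 * b / T + 4 * T / (9 * (real n)\<^sup>2 * b) + 1 / (3 * real n)))"
proof -
  let ?S = "b * T * K ^ 4"
  have S: "?S > 0" using b T K by simp
  have "(\<integral>y. (\<integral>x. (H.G x y)\<^sup>2 \<partial>M) \<partial>M) \<le> (\<integral>y. (b * K\<^sup>2)\<^sup>2 * ?S \<partial>M)"
    using S order_trans[OF G_square mult_left_mono[OF H_square zero_le_power2]]
    by (intro Bochner_Integration.integral_mono') auto
  then have G: "(\<integral>y. (\<integral>x. (H.G x y)\<^sup>2 \<partial>M) \<partial>M) \<le> (b * K\<^sup>2)\<^sup>2 * ?S" by (simp add: prob_space)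
  have 1: "4 * ((b * K\<^sup>2)\<^sup>2 * ?S) / ?S\<^sup>2 = 4 * b / T"
    using b T K by (simp add: field_simps power2_eq_square power4_eq_xxxx)
  have 2: "(2 * T * K\<^sup>2)\<^sup>2 / (9 * (real n)\<^sup>2 * ?S) = 4 * T / (9 * (real n)\<^sup>2 * b)"
    using b T K n by (simp add: field_simps power2_eq_square power4_eq_xxxx)
  show ?thesis using H.U_tail[OF H_square S n G x] unfolding 1 2 .
qed

definition ell :: "(real \<Rightarrow> complex) \<Rightarrow> real \<Rightarrow> real" where
  "ell \<delta> y = Re (CLINT u|lborel. a y u * cnj (\<delta> u)) / (2 * pi)"

lemma ell_la: "ell \<delta> y = Re (la (\<lambda>u. cnj (\<delta> u)) y) / (2 * pi)"
proof -
  have "(CLINT u|lborel. a y u * cnj (\<delta> u)) = la (\<lambda>u. cnj (\<delta> u)) y"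
    unfolding la_def by (rule arg_cong[where f="integral\<^sup>L lborel"], rule ext, rule mult.commute)
  then show ?thesis unfolding ell_def by simp
qed

lemma ell_props:
  assumes d: "bc T \<delta>"
  shows "ell \<delta> \<in> borel_measurable borel" "\<exists>B. \<forall>y. \<bar>ell \<delta> y\<bar> \<le> B" "expectation (ell \<delta>) = 0"
    "expectation (\<lambda>y. (ell \<delta> y)\<^sup>2) \<le> b * K\<^sup>2 * (LINT u|lborel. (cmod (\<delta> u))\<^sup>2) / (2 * pi)\<^sup>2"
proof -
  let ?d = "\<lambda>u. cnj (\<delta> u)"
  have d': "bc T ?d" by (rule bc_cnj[OF d])
  note [measurable] = la_measurable[OF d']
  have e: "ell \<delta> = (\<lambda>y. Re (la ?d y) / (2 * pi))" by (rule ext) (rule ell_la)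
  show m[measurable]: "ell \<delta> \<in> borel_measurable borel" unfolding e by measurable
  obtain B where "\<And>y u. cmod (?d u * a y u) \<le> B * indicator {-T..T} u" and B: "\<And>y. cmod (la ?d y) \<le> B * (2 * T)"
    by (rule bc_la_bound[OF d']) (rule that; assumption)
  have "\<bar>ell \<delta> y\<bar> \<le> B * (2 * T) / (2 * pi)" for y
  proof -
    have "\<bar>Re (la ?d y)\<bar> / (2 * pi) \<le> B * (2 * T) / (2 * pi)"
      by (rule divide_right_mono[OF order_trans[OF abs_Re_le_cmod B[of y]]]) simp
    moreover have "\<bar>2 * pi\<bar> = 2 * pi" by simp
    ultimately show ?thesis unfolding ell_la abs_divide by (simp only:)
  qed
  then show "\<exists>B. \<forall>y. \<bar>ell \<delta> y\<bar> \<le> B" by blast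
  show "expectation (ell \<delta>) = 0" unfolding e using la_integrable(1)[OF d'] la_mean[OF d'] by simp
  have "expectation (\<lambda>y. (ell \<delta> y)\<^sup>2) \<le> expectation (\<lambda>y. (cmod (la ?d y))\<^sup>2 / (2 * pi)\<^sup>2)"
  proof (rule integral_mono')
    show "integrable M (\<lambda>y. (cmod (la ?d y))\<^sup>2 / (2 * pi)\<^sup>2)" using la_integrable(2)[OF d'] by simp
    show "(ell \<delta> y)\<^sup>2 \<le> (cmod (la ?d y))\<^sup>2 / (2 * pi)\<^sup>2" for y
      unfolding ell_la power_divide by (intro divide_right_mono) (auto simp: cmod_power2)
  qed auto
  also have "\<dots> \<le> b * K\<^sup>2 * (LINT u|lborel. (cmod (\<delta> u))\<^sup>2) / (2 * pi)\<^sup>2"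
    using la_square[OF d'] by (simp add: divide_right_mono)
  finally show "expectation (\<lambda>y. (ell \<delta> y)\<^sup>2) \<le> b * K\<^sup>2 * (LINT u|lborel. (cmod (\<delta> u))\<^sup>2) / (2 * pi)\<^sup>2" .
qed

text \<open>The variance of the linear term is bounded by a multiple of \<mu> itself, so after
  division by \<mu>^2 it contributes a multiple of 1 / (n * \<mu>); the U-statistic contributes the
  ratio of its variance to \<mu>^2.\<close>

lemma deviation:
  assumes d: "bc T \<delta>" and n: "n \<ge> 2" and mu: "\<mu> = (LINT u|lborel. (cmod (\<delta> u))\<^sup>2) / (2 * pi)" "\<mu> > 0"
  shows "measure (iid M n) {Y \<in> space (iid M n). \<bar>2 / real n * (\<Sum>j=1..n. ell \<delta> (Y j)) + 2 / (real n * (real n - 1)) * H.U n Y\<bar> \<ge> \<mu> / 2}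
    \<le> 64 * (b * K\<^sup>2) / (real n * \<mu>) + 256 * (b * T * K ^ 4) / ((real n)\<^sup>2 * \<mu>\<^sup>2)"
proof -
  interpret Y: prob_space "iid M n" by (rule prob_space_iid)
  note p = ell_props[OF d]
  obtain B where B: "\<And>y. \<bar>ell \<delta> y\<bar> \<le> B" using p(2) by blast
  have pm: "ell \<delta> \<in> borel_measurable M" using p(1) by (simp add: measurable_cong_sets[OF sets_M refl])
  let ?L = "\<lambda>Y. \<Sum>j=1..n. ell \<delta> (Y j)"
  have Lm[measurable]: "?L \<in> borel_measurable (iid M n)" by (rule sum_measurable_iid[OF pm])
  have Li: "integrable (iid M n) (\<lambda>Y. (?L Y)\<^sup>2)"
    by (rule integrable_iid_bounded[OF borel_measurable_power[OF Lm] power_bounded[OF sum_iid_bounded[OF B]]])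
  let ?S = "b * T * K ^ 4"
  have n0: "real n > 0" "real n - 1 \<ge> real n / 2" "real n - 1 > 0" using n by auto
  \<comment> \<open>The deviation \<mu> / 2 is shared equally: 2 / n * x and 2 / (n * (n - 1)) * z
    both equal \<mu> / 4.\<close>
  define x where "x = real n * \<mu> / 8"
  define z where "z = real n * (real n - 1) * \<mu> / 8"
  have xz: "x > 0" "z > 0" using mu(2) n0 by (auto simp: x_def z_def)
  have m1: "{Y \<in> space (iid M n). \<bar>?L Y\<bar> \<ge> x} \<in> sets (iid M n)" by measurable
  have m2: "{Y \<in> space (iid M n). \<bar>H.U n Y\<bar> \<ge> z} \<in> sets (iid M n)" by measurable
  have PL: "measure (iid M n) {Y \<in> space (iid M n). \<bar>?L Y\<bar> \<ge> x} \<le> 64 * (b * K\<^sup>2) / (real n * \<mu>)"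
  proof -
    have "measure (iid M n) {Y \<in> space (iid M n). \<bar>?L Y\<bar> \<ge> x} \<le> (\<integral>Y. (?L Y)\<^sup>2 \<partial>iid M n) / x\<^sup>2"
      by (rule Y.Markov_square(2)[OF Lm Li xz(1)])
    also have "(\<integral>Y. (?L Y)\<^sup>2 \<partial>iid M n) = real n * expectation (\<lambda>y. (ell \<delta> y)\<^sup>2)"
      by (rule iid_sum_square[OF pm B p(3)])
    also have "\<dots> \<le> real n * (b * K\<^sup>2 * \<mu>)"
    proof (rule mult_left_mono[OF order_trans[OF p(4)]])
      have "(LINT u|lborel. (cmod (\<delta> u))\<^sup>2) = 2 * pi * \<mu>" using mu(1) by simp
      then have "b * K\<^sup>2 * (LINT u|lborel. (cmod (\<delta> u))\<^sup>2) / (2 * pi)\<^sup>2 = (b * K\<^sup>2 * \<mu>) / (2 * pi)"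
        by (simp add: power2_eq_square)
      also have "\<dots> \<le> (b * K\<^sup>2 * \<mu>) / 1"
        using pi_gt3 b mu(2) by (intro divide_left_mono) auto
      finally show "b * K\<^sup>2 * (LINT u|lborel. (cmod (\<delta> u))\<^sup>2) / (2 * pi)\<^sup>2 \<le> b * K\<^sup>2 * \<mu>" by simp
    qed simp
    finally have "measure (iid M n) {Y \<in> space (iid M n). \<bar>?L Y\<bar> \<ge> x} \<le> real n * (b * K\<^sup>2 * \<mu>) / x\<^sup>2"
      by (simp add: divide_right_mono)
    also have "\<dots> = 64 * (b * K\<^sup>2) / (real n * \<mu>)"
      using n0 mu(2) by (simp add: x_def field_simps power2_eq_square)
    finally show ?thesis .
  qed
  have PU: "measure (iid M n) {Y \<in> space (iid M n). \<bar>H.U n Y\<bar> \<ge> z} \<le> 256 * ?S / ((real n)\<^sup>2 * \<mu>\<^sup>2)"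
  proof -
    have "measure (iid M n) {Y \<in> space (iid M n). \<bar>H.U n Y\<bar> \<ge> z} \<le> (\<integral>Y. (H.U n Y)\<^sup>2 \<partial>iid M n) / z\<^sup>2"
      by (rule Y.Markov_square(2)[OF H.U_measurable H.U_square(1)[OF H_square] xz(2)])
    also have "\<dots> \<le> ((real n)\<^sup>2 * ?S) / z\<^sup>2"
      by (intro divide_right_mono H.U_square(2)[OF H_square]) auto
    also have "\<dots> \<le> ((real n)\<^sup>2 * ?S) / (real n * (real n / 2) * \<mu> / 8)\<^sup>2"
    proof (intro divide_left_mono power_mono)
      show "real n * (real n / 2) * \<mu> / 8 \<le> z"
        unfolding z_def using n0 mu(2) by (intro divide_right_mono mult_right_mono mult_left_mono) auto
    qed (use xz b T K n0 mu(2) in auto)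
    also have "\<dots> = 256 * ?S / ((real n)\<^sup>2 * \<mu>\<^sup>2)"
      using n0(1) mu(2) by (simp add: field_simps power2_eq_square)
    finally show ?thesis .
  qed
  have "measure (iid M n) {Y \<in> space (iid M n). \<bar>2 / real n * ?L Y + 2 / (real n * (real n - 1)) * H.U n Y\<bar> \<ge> \<mu> / 2}
    \<le> measure (iid M n) ({Y \<in> space (iid M n). \<bar>?L Y\<bar> \<ge> x} \<union> {Y \<in> space (iid M n). \<bar>H.U n Y\<bar> \<ge> z})"
  proof (rule Y.finite_measure_mono[OF subsetI sets.Un[OF m1 m2]])
    fix Y assume Y: "Y \<in> {Y \<in> space (iid M n). \<bar>2 / real n * ?L Y + 2 / (real n * (real n - 1)) * H.U n Y\<bar> \<ge> \<mu> / 2}"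
    have "\<bar>?L Y\<bar> \<ge> x \<or> \<bar>H.U n Y\<bar> \<ge> z"
    proof (rule ccontr)
      assume "\<not> ?thesis"
      then have l: "\<bar>?L Y\<bar> < x" "\<bar>H.U n Y\<bar> < z" by auto
      have "\<bar>2 / real n * ?L Y + 2 / (real n * (real n - 1)) * H.U n Y\<bar> \<le> 2 / real n * \<bar>?L Y\<bar> + 2 / (real n * (real n - 1)) * \<bar>H.U n Y\<bar>"
        using n0 by (intro order_trans[OF abs_triangle_ineq]) (simp add: abs_mult)
      also have "\<dots> < 2 / real n * x + 2 / (real n * (real n - 1)) * z"
        using n0 l by (intro add_strict_mono mult_strict_left_mono) auto
      also have "\<dots> = \<mu> / 2" using n0 by (simp add: x_def z_def)
      finally show False using Y by simp
    qed
    then show "Y \<in> {Y \<in> space (iid M n). \<bar>?L Y\<bar> \<ge> x} \<union> {Y \<in> space (iid M n). \<bar>H.U n Y\<bar> \<ge> z}"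
      using Y by (simp only: mem_Collect_eq Un_iff) blast
  qed
  also have "\<dots> \<le> measure (iid M n) {Y \<in> space (iid M n). \<bar>?L Y\<bar> \<ge> x} + measure (iid M n) {Y \<in> space (iid M n). \<bar>H.U n Y\<bar> \<ge> z}"
    by (rule measure_Un_le[OF m1 m2])
  finally show ?thesis using PL PU by linarith
qed

end

section \<open>The convolution model\<close>

lemma prob_densityD:
  assumes "is_prob_density f"
  shows "integrable lborel f" "f \<in> borel_measurable borel" "integral\<^sup>L lborel f = 1" "0 \<le> f x"
    "integrable lborel (\<lambda>x. complex_of_real (f x))"
  using assms unfolding is_prob_density_def has_bochner_integral_iff
  by (auto dest: borel_measurable_integrable)

lemma real_distribution_density:
  assumes "is_prob_density f"
  shows "real_distribution (density lborel (\<lambda>x. ennreal (f x)))"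
proof -
  note f = prob_densityD[OF assms]
  have [measurable]: "f \<in> borel_measurable borel" by (rule f)
  have "(\<integral>\<^sup>+x. ennreal (f x) \<partial>lborel) = ennreal 1"
    using nn_integral_eq_integral[OF f(1)] f(3,4) by simp
  then have "prob_space (density lborel (\<lambda>x. ennreal (f x)))"
    by (intro prob_spaceI) (simp add: emeasure_density)
  then show ?thesis by (simp add: real_distribution_def real_distribution_axioms_def)
qed

lemma char_density:
  assumes "is_prob_density f"
  shows "char (density lborel (\<lambda>x. ennreal (f x))) u = fourier f u"
proof -
  note f = prob_densityD[OF assms]
  have [measurable]: "f \<in> borel_measurable borel" by (rule f)
  have "char (density lborel (\<lambda>x. ennreal (f x))) u = (CLINT x|lborel. f x *\<^sub>R iexp (u * x))"
    unfolding char_def by (subst integral_density) (use f in auto)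
  then show ?thesis unfolding fourier_def by (simp add: scaleR_conv_of_real mult.commute)
qed

lemma fourier_ft: "fourier f = ft (\<lambda>x. complex_of_real (f x))"
  unfolding fourier_def ft_def by (rule ext) simp

lemma fourier_cnj: "fourier f (- u) = cnj (fourier f u)"
proof -
  have "cnj (fourier f u) = (CLINT x|lborel. cnj (iexp (u * x) * complex_of_real (f x)))"
    unfolding fourier_def by (rule Bochner_Integration.integral_cnj[symmetric])
  also have "\<dots> = fourier f (- u)" unfolding fourier_def
    by (rule Bochner_Integration.integral_cong[OF refl]) (simp add: exp_cnj)
  finally show ?thesis by simp
qed

lemma
  assumes "is_prob_density f"
  shows fourier_le_1: "cmod (fourier f u) \<le> 1"
    and fourier_measurable: "fourier f \<in> borel_measurable borel"
    and isCont_fourier: "isCont (fourier f) u"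
proof -
  interpret real_distribution "density lborel (\<lambda>x. ennreal (f x))" by (rule real_distribution_density[OF assms])
  have e: "char (density lborel (\<lambda>x. ennreal (f x))) = fourier f"
    by (rule ext) (rule char_density[OF assms])
  show "cmod (fourier f u) \<le> 1" "fourier f \<in> borel_measurable borel" "isCont (fourier f) u"
    using cmod_char_le_1[of u] char_measurable isCont_char[of u] unfolding e by auto
qed

abbreviation law :: "(real \<Rightarrow> real) \<Rightarrow> (real \<Rightarrow> real) \<Rightarrow> real measure" where
  "law g f \<equiv> density lborel (\<lambda>x. ennreal (f x)) \<star> density lborel (\<lambda>x. ennreal (g x))"

lemma real_distribution_law:
  assumes "is_prob_density f" "is_prob_density g"
  shows "real_distribution (law g f)" and "char (law g f) u = fourier f u * fourier g u"
proof -
  let ?F = "density lborel (\<lambda>x. ennreal (f x))" and ?G = "density lborel (\<lambda>x. ennreal (g x))"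
  interpret F: real_distribution ?F by (rule real_distribution_density[OF assms(1)])
  interpret G: real_distribution ?G by (rule real_distribution_density[OF assms(2)])
  interpret P: pair_prob_space ?F ?G ..
  have m[measurable]: "(\<lambda>(x, y). x + y) \<in> measurable (?F \<Otimes>\<^sub>M ?G) borel"
    by measurable
  have "prob_space (law g f)" unfolding convolution_def by (rule P.prob_space_distr[OF m])
  then show "real_distribution (law g f)" by (simp add: real_distribution_def real_distribution_axioms_def)
  have "char (law g f) u = (CLINT w|?F \<Otimes>\<^sub>M ?G. (case w of (x, y) \<Rightarrow> iexp (u * x) * iexp (u * y)))"
    unfolding char_def convolution_def
    by (subst integral_distr[OF m]) (auto intro!: Bochner_Integration.integral_cong simp: distrib_left exp_add)
  also have "\<dots> = (CLINT x|?F. CLINT y|?G. iexp (u * x) * iexp (u * y))"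
  proof (rule P.integral_fst[symmetric], rule P.P.integrable_const_bound[where B=1])
    show "AE w in ?F \<Otimes>\<^sub>M ?G. cmod (case w of (x, y) \<Rightarrow> iexp (u * x) * iexp (u * y)) \<le> 1"
      by (intro AE_I2) (simp add: norm_mult split: prod.splits)
  qed measurable
  also have "\<dots> = char ?F u * char ?G u" unfolding char_def by simp
  finally show "char (law g f) u = fourier f u * fourier g u" by (simp add: char_density assms)
qed

text \<open>Schur test. In the double integral of \<open>integral_ft_square_char\<close> the product
  |m u| * |m v| is at most half the sum of the squares, and each square is integrated against w (u -
  v), which has the same total mass in u as in v.\<close>

lemma moment_bound:
  fixes m :: "real \<Rightarrow> complex"
  assumes "real_distribution M" and [measurable]: "w \<in> borel_measurable borel"
    and w: "\<And>u. cmod (char M u) \<le> w u" and wi: "integrable lborel w"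
    and m: "integrable lborel m" "integrable lborel (\<lambda>u. (cmod (m u))\<^sup>2)"
  shows "(\<integral>y. (cmod (ft m y))\<^sup>2 \<partial>M) \<le> (LINT u|lborel. w u) * (LINT u|lborel. (cmod (m u))\<^sup>2)"
proof -
  interpret M: real_distribution M by fact
  have [measurable]: "m \<in> borel_measurable borel"
    using m by (auto dest: borel_measurable_integrable)
  have w0: "0 \<le> w u" for u using order_trans[OF norm_ge_zero w] .
  let ?q = "\<lambda>u. ennreal ((cmod (m u))\<^sup>2)"
  \<comment> \<open>Holds without integrability too, since the Bochner integral is then 0; this
    permits the direct passage to nonnegative integrals.\<close>
  have nb: "ennreal (cmod (integral\<^sup>L N f)) \<le> (\<integral>\<^sup>+x. ennreal (cmod (f x)) \<partial>N)" for N :: "real measure" and f :: "real \<Rightarrow> complex"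
    by (cases "integrable N f") (auto simp: integral_norm_bound_ennreal not_integrable_integral_eq)
  have Iw: "(\<integral>\<^sup>+u. ennreal (w u) \<partial>lborel) = ennreal (integral\<^sup>L lborel w)"
    using wi w0 by (intro nn_integral_eq_integral) auto
  have Im: "(\<integral>\<^sup>+u. ?q u \<partial>lborel) = ennreal (LINT u|lborel. (cmod (m u))\<^sup>2)"
    using m by (intro nn_integral_eq_integral) auto
  have s1: "(\<integral>\<^sup>+u. ennreal (w (u - v)) \<partial>lborel) = ennreal (integral\<^sup>L lborel w)" for v
    using nn_integral_real_affine[of "\<lambda>u. ennreal (w u)" 1 "- v"] by (simp add: Iw add.commute)
  have s2: "(\<integral>\<^sup>+v. ennreal (w (u - v)) \<partial>lborel) = ennreal (integral\<^sup>L lborel w)" for u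
    using nn_integral_real_affine[of "\<lambda>u. ennreal (w u)" "-1" u] by (simp add: Iw)
  have J1: "(\<integral>\<^sup>+v. \<integral>\<^sup>+u. ennreal (w (u - v)) * ?q v \<partial>lborel \<partial>lborel) = ennreal (integral\<^sup>L lborel w) * (\<integral>\<^sup>+u. ?q u \<partial>lborel)"
    by (simp add: nn_integral_multc nn_integral_cmult s1)
  have "(\<integral>\<^sup>+v. \<integral>\<^sup>+u. ennreal (w (u - v)) * ?q u \<partial>lborel \<partial>lborel) = (\<integral>\<^sup>+u. \<integral>\<^sup>+v. ennreal (w (u - v)) * ?q u \<partial>lborel \<partial>lborel)"
    by (rule lborel_pair.Fubini') measurable
  then have J2: "(\<integral>\<^sup>+v. \<integral>\<^sup>+u. ennreal (w (u - v)) * ?q u \<partial>lborel \<partial>lborel) = ennreal (integral\<^sup>L lborel w) * (\<integral>\<^sup>+u. ?q u \<partial>lborel)"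
    by (simp add: nn_integral_multc nn_integral_cmult s2)
  have "ennreal (2 * (\<integral>y. (cmod (ft m y))\<^sup>2 \<partial>M)) = 2 * ennreal (cmod (CLINT y|M. ft m y * cnj (ft m y)))"
    unfolding cmod_square_integral[symmetric] norm_of_real[symmetric]
  proof -
    have "(CLINT y|M. ft m y * cnj (ft m y)) = complex_of_real (\<integral>y. (cmod (ft m y))\<^sup>2 \<partial>M)"
      unfolding integral_complex_of_real[symmetric] by (simp add: complex_norm_square del: of_real_power)
    moreover have "0 \<le> (\<integral>y. (cmod (ft m y))\<^sup>2 \<partial>M)" by (intro integral_nonneg_AE) auto
    ultimately show "ennreal (2 * (\<integral>y. (cmod (ft m y))\<^sup>2 \<partial>M)) = 2 * ennreal (cmod (CLINT y|M. ft m y * cnj (ft m y)))"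
      by (simp add: ennreal_mult)
  qed
  also have "\<dots> \<le> 2 * (\<integral>\<^sup>+v. \<integral>\<^sup>+u. ennreal (cmod (char M (u - v) * (m u * cnj (m v)))) \<partial>lborel \<partial>lborel)"
    unfolding integral_ft_square_char[OF assms(1) m(1)]
    by (intro mult_left_mono order_trans[OF nb nn_integral_mono] nb) auto
  also have "\<dots> = (\<integral>\<^sup>+v. \<integral>\<^sup>+u. 2 * ennreal (cmod (char M (u - v) * (m u * cnj (m v)))) \<partial>lborel \<partial>lborel)"
    by (simp add: nn_integral_cmult)
  also have "\<dots> \<le> (\<integral>\<^sup>+v. \<integral>\<^sup>+u. ennreal (w (u - v)) * ?q u + ennreal (w (u - v)) * ?q v \<partial>lborel \<partial>lborel)"
  proof (intro nn_integral_mono)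
    fix u v
    have "cmod (char M (u - v) * (m u * cnj (m v))) \<le> w (u - v) * (((cmod (m u))\<^sup>2 + (cmod (m v))\<^sup>2) / 2)"
      unfolding norm_mult[of "char M (u - v)"]
      using norm_mult_le_half[of "m u" "cnj (m v)"] by (intro mult_mono w w0) auto
    then have "2 * cmod (char M (u - v) * (m u * cnj (m v))) \<le> w (u - v) * (cmod (m u))\<^sup>2 + w (u - v) * (cmod (m v))\<^sup>2"
      by (simp add: field_simps)
    then have "ennreal (2 * cmod (char M (u - v) * (m u * cnj (m v)))) \<le> ennreal (w (u - v) * (cmod (m u))\<^sup>2 + w (u - v) * (cmod (m v))\<^sup>2)"
      by (rule ennreal_leI)
    then show "2 * ennreal (cmod (char M (u - v) * (m u * cnj (m v)))) \<le> ennreal (w (u - v)) * ?q u + ennreal (w (u - v)) * ?q v"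
      using w0 by (simp add: ennreal_mult)
  qed
  also have "\<dots> = 2 * (ennreal (integral\<^sup>L lborel w) * (\<integral>\<^sup>+u. ?q u \<partial>lborel))"
    by (simp add: nn_integral_add J1 J2 mult_2)
  also have "\<dots> = ennreal (2 * (integral\<^sup>L lborel w * (LINT u|lborel. (cmod (m u))\<^sup>2)))"
    unfolding Im using w0 by (simp add: ennreal_mult integral_nonneg_AE)
  finally show ?thesis
    using w0 by (subst (asm) ennreal_le_iff) (auto intro!: mult_nonneg_nonneg integral_nonneg_AE)
qed

lemma kernel_ft_measurable: "is_prob_density g \<Longrightarrow> kernel_ft g h \<in> borel_measurable borel"
  using fourier_measurable[of g] unfolding kernel_ft_def by measurable

text \<open>The constant \<open>b\<close> comes out free of \<open>f\<close> because
  |\<open>fourier f\<close>| \<le> 1, so that the characteristic function of an observation is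
  dominated by |\<open>fourier g\<close>|.\<close>

lemma deconvolution_law:
  assumes f: "is_prob_density f" and g: "is_prob_density g" and g0: "\<And>u. fourier g u \<noteq> 0"
    and gi: "integrable lborel (\<lambda>u. cmod (fourier g u))" and h: "h > 0" and K: "K \<ge> 1"
    and gK: "\<And>u. \<bar>u\<bar> \<le> 1 / h \<Longrightarrow> 1 / cmod (fourier g u) \<le> K"
    and b: "b = (LINT u|lborel. cmod (fourier g u))" "b > 0"
  shows "deconvolution (law g f) (fourier f) (kernel_ft g h) (1 / h) K b"
proof -
  interpret real_distribution "law g f" by (rule real_distribution_law[OF f g])
  note [measurable] = fourier_measurable[OF f] fourier_measurable[OF g] kernel_ft_measurable[OF g]
  show ?thesis
  proof
    show "cmod (kernel_ft g h u) \<le> K" if "\<bar>u\<bar> \<le> 1 / h" for u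
      using gK[OF that] that by (simp add: kernel_ft_def norm_inverse norm_divide inverse_eq_divide)
    show "kernel_ft g h (- u) = cnj (kernel_ft g h u)" for u
      by (auto simp: kernel_ft_def fourier_cnj indicator_def)
    show "char (law g f) u * kernel_ft g h u = fourier f u" if "\<bar>u\<bar> \<le> 1 / h" for u
      using that g0[of u] by (simp add: real_distribution_law(2)[OF f g] kernel_ft_def)
    show "expectation (\<lambda>y. (cmod (ft m y))\<^sup>2) \<le> b * (LINT u|lborel. (cmod (m u))\<^sup>2)" if "bc (1 / h) m" for m
      unfolding b(1)
    proof (rule moment_bound[OF real_distribution_law(1)[OF f g] _ _ gi bc_integrable[OF that] bc_square_integrable[OF that]])
      show "cmod (char (law g f) u) \<le> cmod (fourier g u)" for u
        using fourier_le_1[OF f, of u] by (simp add: real_distribution_law(2)[OF f g] norm_mult mult_left_le_one_le)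
    qed measurable
  qed (use h K b(2) fourier_le_1[OF f] fourier_cnj in auto)
qed

section \<open>The test statistic on the frequency side\<close>

lemma integral_reflect: "(LINT x|lborel. F (- x)) = integral\<^sup>L lborel F" for F :: "real \<Rightarrow> 'a::{banach, second_countable_topology}"
  using lborel_integral_real_affine[of "-1" F 0] by simp

lemma integrable_reflect: "integrable lborel F \<Longrightarrow> integrable lborel (\<lambda>x. F (- x))" for F :: "real \<Rightarrow> 'a::{banach, second_countable_topology}"
  using lborel_integrable_real_affine[of F "-1" 0] by simp

text \<open>Multiplication formula, by Fubini. It evaluates the cross terms between the
  deconvolution kernel and a density.\<close>

lemma ft_pairing:
  assumes m: "integrable lborel m" and p: "integrable lborel p"
  shows "(CLINT x|lborel. ft m (- x) * p x) = (CLINT u|lborel. m u * ft p (- u))"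
proof -
  have [measurable]: "m \<in> borel_measurable borel" "p \<in> borel_measurable borel"
    using m p by (auto dest: borel_measurable_integrable)
  define F where "F x u = iexp (- (x * u)) * (p x * m u)" for x u
  have "integrable (lborel \<Otimes>\<^sub>M lborel) (case_prod F)"
  proof (rule Bochner_Integration.integrable_bound[OF integrable_pair_mult[OF p m]])
    show "case_prod F \<in> borel_measurable (lborel \<Otimes>\<^sub>M lborel)" unfolding F_def by measurable
    show "AE w in lborel \<Otimes>\<^sub>M lborel. cmod (case_prod F w) \<le> cmod (case w of (u, v) \<Rightarrow> p u * m v)"
      by (intro AE_I2) (simp add: F_def norm_mult split: prod.splits)
  qed
  from lborel_pair.Fubini_integral[OF this]
  have "(CLINT u|lborel. CLINT x|lborel. F x u) = (CLINT x|lborel. CLINT u|lborel. F x u)" .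
  moreover have "(CLINT u|lborel. F x u) = ft m (- x) * p x" for x
  proof -
    have "(CLINT u|lborel. F x u) = (CLINT u|lborel. iexp (- x * u) * m u * p x)"
      unfolding F_def by (rule Bochner_Integration.integral_cong[OF refl]) (simp add: ac_simps)
    then show ?thesis unfolding ft_def by (simp only: integral_mult_left_zero)
  qed
  moreover have "(CLINT x|lborel. F x u) = m u * ft p (- u)" for u
  proof -
    have "(CLINT x|lborel. F x u) = (CLINT x|lborel. m u * (iexp (- u * x) * p x))"
      unfolding F_def by (rule Bochner_Integration.integral_cong[OF refl]) (simp add: ac_simps)
    then show ?thesis unfolding ft_def by (simp only: integral_mult_right_zero)
  qed
  ultimately show ?thesis by simp
qed

lemma fourier_L2:
  assumes d: "integrable lborel d" and d2: "integrable lborel (\<lambda>x. (d x)\<^sup>2)"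
  shows "integrable lborel (\<lambda>u. (cmod (fourier d u))\<^sup>2)"
    and "(LINT u|lborel. (cmod (fourier d u))\<^sup>2) = 2 * pi * (LINT x|lborel. (d x)\<^sup>2)"
proof -
  have c: "integrable lborel (\<lambda>x. complex_of_real (d x))" using d by simp
  have c2: "integrable lborel (\<lambda>x. (cmod (complex_of_real (d x)))\<^sup>2)" using d2 by simp
  show "integrable lborel (\<lambda>u. (cmod (fourier d u))\<^sup>2)" unfolding fourier_ft by (rule ft_L2_integrable[OF c c2])
  show "(LINT u|lborel. (cmod (fourier d u))\<^sup>2) = 2 * pi * (LINT x|lborel. (d x)\<^sup>2)"
    unfolding fourier_ft plancherel_norm[OF c c2] by simp
qed

text \<open>The product is expanded into four integrals because they pass to the frequency side for
  different reasons: \<open>plancherel\<close> for two kernels, \<open>ft_pairing\<close> for a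
  kernel and the density, \<open>fourier_L2\<close> for the density alone. The kernel is an inverse
  transform, hence the reflected argument in \<open>k\<close>.\<close>

lemma L2_inner_kernel:
  assumes \<kappa>: "bc T (kernel_ft g h)" and f: "is_prob_density f" and f2: "integrable lborel (\<lambda>x. (f x)\<^sup>2)"
  shows "L2_inner (\<lambda>x. kernel g h (x - s) - complex_of_real (f x)) (\<lambda>x. kernel g h (x - t) - complex_of_real (f x))
    = complex_of_real (1 / (2 * pi)) * (CLINT u|lborel. (iexp (u * s) * kernel_ft g h u - fourier f u) * cnj (iexp (u * t) * kernel_ft g h u - fourier f u))"
proof -
  note fd = prob_densityD[OF f]
  have [measurable]: "f \<in> borel_measurable borel" "kernel_ft g h \<in> borel_measurable borel" "fourier f \<in> borel_measurable borel"
    using fd(2) bc_measurable[OF \<kappa>] fourier_measurable[OF f] by auto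
  define m where "m s u = iexp (u * s) * kernel_ft g h u" for s u
  have mi: "integrable lborel (m s)" for s
    unfolding m_def by (intro integrable_iexp_mult bc_integrable[OF \<kappa>]) measurable
  have m2: "integrable lborel (\<lambda>u. (cmod (m s u))\<^sup>2)" for s
    using bc_square_integrable[OF \<kappa>] by (simp add: m_def norm_mult)
  have [measurable]: "m s \<in> borel_measurable borel" for s using mi[of s] by (auto dest: borel_measurable_integrable)
  define k where "k s x = complex_of_real (1 / (2 * pi)) * ft (m s) (- x)" for s x
  have k: "kernel g h (x - s) = k s x" for s x
  proof -
    have "iexp (- (u * (x - s))) * kernel_ft g h u = iexp (- x * u) * (iexp (u * s) * kernel_ft g h u)" for u
    proof -
      have "\<i> * complex_of_real (- (u * (x - s))) = \<i> * complex_of_real (- x * u) + \<i> * complex_of_real (u * s)"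
        by (simp add: algebra_simps)
      then show ?thesis by (simp only: exp_add mult.assoc)
    qed
    then show ?thesis unfolding kernel_def k_def ft_def m_def by (simp only:)
  qed
  have [measurable]: "k s \<in> borel_measurable borel" for s unfolding k_def by measurable
  have ft2: "integrable lborel (\<lambda>x. (cmod (ft (m s) x))\<^sup>2)" for s by (rule ft_L2_integrable[OF mi m2])
  have k2: "integrable lborel (\<lambda>x. (cmod (k s x))\<^sup>2)" for s
    using integrable_reflect[OF ft2[of s]] by (simp add: k_def norm_mult norm_divide power_mult_distrib power_divide)
  have f2': "integrable lborel (\<lambda>x. (cmod (complex_of_real (f x)))\<^sup>2)" using f2 by simp
  have Phi2: "integrable lborel (\<lambda>u. (cmod (fourier f u))\<^sup>2)" by (rule fourier_L2[OF fd(1) f2])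
  let ?c = "complex_of_real (1 / (2 * pi))" and ?f = "\<lambda>x. complex_of_real (f x)" and ?P = "fourier f"
  have kk: "(CLINT x|lborel. k s x * cnj (k t x)) = ?c * (CLINT u|lborel. m s u * cnj (m t u))" for s t
  proof -
    have "(CLINT x|lborel. k s x * cnj (k t x)) = (CLINT x|lborel. ?c * ?c * (ft (m s) (- x) * cnj (ft (m t) (- x))))"
      unfolding k_def by (rule Bochner_Integration.integral_cong[OF refl]) (simp only: complex_cnj_mult complex_cnj_complex_of_real ac_simps)
    also have "\<dots> = ?c * ?c * (CLINT x|lborel. ft (m s) x * cnj (ft (m t) x))"
      unfolding integral_mult_right_zero using integral_reflect[of "\<lambda>x. ft (m s) x * cnj (ft (m t) x)"] by simp
    also have "\<dots> = ?c * (CLINT u|lborel. m s u * cnj (m t u))"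
      unfolding plancherel[OF mi m2 mi m2] by simp
    finally show ?thesis .
  qed
  have kf: "(CLINT x|lborel. k s x * ?f x) = ?c * (CLINT u|lborel. m s u * cnj (?P u))" for s
  proof -
    have "(CLINT x|lborel. k s x * ?f x) = ?c * (CLINT x|lborel. ft (m s) (- x) * ?f x)"
      unfolding k_def mult.assoc by (rule integral_mult_right_zero)
    also have "(CLINT x|lborel. ft (m s) (- x) * ?f x) = (CLINT u|lborel. m s u * cnj (?P u))"
      unfolding ft_pairing[OF mi fd(5)] fourier_cnj[symmetric] fourier_ft[symmetric] ..
    finally show ?thesis .
  qed
  have fk: "(CLINT x|lborel. ?f x * cnj (k t x)) = ?c * (CLINT u|lborel. ?P u * cnj (m t u))" for t
  proof -
    have "(CLINT x|lborel. ?f x * cnj (k t x)) = (CLINT x|lborel. cnj (k t x * ?f x))"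
      by (rule Bochner_Integration.integral_cong[OF refl]) (simp only: complex_cnj_mult complex_cnj_complex_of_real ac_simps)
    also have "\<dots> = cnj (?c * (CLINT u|lborel. m t u * cnj (?P u)))"
      unfolding Bochner_Integration.integral_cnj kf ..
    also have "\<dots> = ?c * (CLINT u|lborel. cnj (m t u * cnj (?P u)))"
      unfolding Bochner_Integration.integral_cnj by simp
    also have "(\<lambda>u. cnj (m t u * cnj (?P u))) = (\<lambda>u. ?P u * cnj (m t u))"
      by (rule ext) (simp only: complex_cnj_mult complex_cnj_cnj mult.commute)
    finally show ?thesis .
  qed
  have ff: "(CLINT x|lborel. ?f x * ?f x) = ?c * (CLINT u|lborel. ?P u * cnj (?P u))"
  proof -
    have "(CLINT u|lborel. ?P u * cnj (?P u)) = complex_of_real (2 * pi * (LINT x|lborel. (f x)\<^sup>2))"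
      unfolding cmod_square_integral[symmetric] fourier_L2(2)[OF fd(1) f2] ..
    moreover have "(CLINT x|lborel. ?f x * ?f x) = complex_of_real (LINT x|lborel. (f x)\<^sup>2)"
      unfolding integral_complex_of_real[symmetric] by (simp add: power2_eq_square)
    ultimately show ?thesis by simp
  qed
  have cn: "integrable lborel (\<lambda>x. (cmod (cnj (F x)))\<^sup>2) = integrable lborel (\<lambda>x. (cmod (F x))\<^sup>2)" for F :: "real \<Rightarrow> complex"
    by simp
  have expand: "(a - c) * cnj (b - d) = a * cnj b - a * cnj d - c * cnj b + c * cnj d" for a b c d
    by (simp add: algebra_simps)
  have i: "integrable lborel (\<lambda>x. k s x * cnj (k t x))" "integrable lborel (\<lambda>x. k s x * ?f x)"
    "integrable lborel (\<lambda>x. ?f x * cnj (k t x))" "integrable lborel (\<lambda>x. ?f x * ?f x)"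
    by (intro integrable_mult_L2 k2 f2' cn[THEN iffD2]; measurable)+
  have j: "integrable lborel (\<lambda>u. m s u * cnj (m t u))" "integrable lborel (\<lambda>u. m s u * cnj (?P u))"
    "integrable lborel (\<lambda>u. ?P u * cnj (m t u))" "integrable lborel (\<lambda>u. ?P u * cnj (?P u))"
    by (intro integrable_mult_L2 m2 Phi2 cn[THEN iffD2]; measurable)+
  have "L2_inner (\<lambda>x. kernel g h (x - s) - ?f x) (\<lambda>x. kernel g h (x - t) - ?f x)
    = (CLINT x|lborel. k s x * cnj (k t x) - k s x * ?f x - ?f x * cnj (k t x) + ?f x * ?f x)"
    unfolding L2_inner_def k
    by (simp only: expand complex_cnj_complex_of_real)
  also have "\<dots> = (CLINT x|lborel. k s x * cnj (k t x)) - (CLINT x|lborel. k s x * ?f x)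
      - (CLINT x|lborel. ?f x * cnj (k t x)) + (CLINT x|lborel. ?f x * ?f x)"
    using i by simp
  also have "\<dots> = ?c * ((CLINT u|lborel. m s u * cnj (m t u)) - (CLINT u|lborel. m s u * cnj (?P u))
      - (CLINT u|lborel. ?P u * cnj (m t u)) + (CLINT u|lborel. ?P u * cnj (?P u)))"
    unfolding kk kf fk ff by (simp only: right_diff_distrib distrib_left)
  also have "\<dots> = ?c * (CLINT u|lborel. m s u * cnj (m t u) - m s u * cnj (?P u) - ?P u * cnj (m t u) + ?P u * cnj (?P u))"
    using j by simp
  also have "(\<lambda>u. m s u * cnj (m t u) - m s u * cnj (?P u) - ?P u * cnj (m t u) + ?P u * cnj (?P u))
    = (\<lambda>u. (m s u - ?P u) * cnj (m t u - ?P u))"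
    by (simp only: expand)
  finally show ?thesis unfolding m_def .
qed

text \<open>Each index lies in n - 1 of the n * (n - 1) / 2 pairs.\<close>

lemma sum_pairs:
  fixes e :: "nat \<Rightarrow> real"
  shows "(\<Sum>j=1..n. \<Sum>k=1..<j. c + e k + e j) = c * (real n * (real n - 1) / 2) + (real n - 1) * (\<Sum>j=1..n. e j)"
proof (induction n)
  case (Suc n)
  have "(\<Sum>k=1..<Suc n. c + e k + e (Suc n)) = real n * c + (\<Sum>k=1..n. e k) + real n * e (Suc n)"
    by (simp add: sum.distrib atLeastLessThanSuc_atLeastAtMost algebra_simps)
  then show ?case using Suc by (simp add: field_simps)
qed simp

context deconvolution
begin

text \<open>On the band each factor is a + \<delta>, centred noise plus signal; off the band
  \<kappa> vanishes and only - \<Phi>0 remains. The product thus yields the kernel of the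
  U-statistic, two linear terms, the signal energy and the bias, and Hermitian symmetry makes the
  first three real.\<close>

lemma pairing_decomp:
  assumes \<kappa>0: "\<forall>u. u \<notin> {-T..T} \<longrightarrow> \<kappa> u = 0"
    and [measurable]: "\<Phi>0 \<in> borel_measurable borel" and P1: "\<And>u. cmod (\<Phi>0 u) \<le> 1"
    and Pc: "\<And>u. \<Phi>0 (- u) = cnj (\<Phi>0 u)" and P2: "integrable lborel (\<lambda>u. (cmod (\<Phi>0 u))\<^sup>2)"
    and \<delta>: "\<And>u. \<delta> u = indicator {-T..T} u * (\<Phi> u - \<Phi>0 u)"
  shows "bc T \<delta>"
    and "(CLINT u|lborel. (iexp (u * s) * \<kappa> u - \<Phi>0 u) * cnj (iexp (u * t) * \<kappa> u - \<Phi>0 u))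
     = complex_of_real (2 * pi * ((LINT u|lborel. indicator (- {-T..T}) u * (cmod (\<Phi>0 u))\<^sup>2) / (2 * pi)
        + (LINT u|lborel. (cmod (\<delta> u))\<^sup>2) / (2 * pi) + ell \<delta> s + ell \<delta> t + H s t))"
proof -
  have \<delta>': "\<delta> = (\<lambda>u. indicator {-T..T} u * (\<Phi> u - \<Phi>0 u))" using \<delta> by (rule ext)
  show d: "bc T \<delta>"
  proof (rule bcI[of _ 2])
    show "\<delta> \<in> borel_measurable borel" unfolding \<delta>' by measurable
    show "cmod (\<delta> u) \<le> 2 * indicator {-T..T} u" for u
      using order_trans[OF norm_triangle_ineq4 add_mono[OF \<Phi>_bound P1]] by (cases "u \<in> {-T..T}") (simp_all add: \<delta>)
  qed
  have dc: "\<delta> (- u) = cnj (\<delta> u)" for u by (auto simp: \<delta> \<Phi>_cnj Pc indicator_def)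
  define w where "w u = (indicator (- {-T..T}) u * (cmod (\<Phi>0 u))\<^sup>2 :: real)" for u
  have wi: "integrable lborel w"
    using integrable_real_mult_indicator[OF _ P2, of "- {-T..T}"] unfolding w_def by (simp add: mult.commute)
  have ell: "(CLINT u|lborel. a y u * cnj (\<delta> u)) = complex_of_real (2 * pi * ell \<delta> y)" for y
  proof (rule complex_eqI)
    show "Im (CLINT u|lborel. a y u * cnj (\<delta> u)) = Im (complex_of_real (2 * pi * ell \<delta> y))"
      unfolding Im_complex_of_real by (rule integral_reflect_cnj) (simp add: a_cnj dc)
  qed (simp add: ell_def)
  have ell': "(CLINT u|lborel. \<delta> u * cnj (a y u)) = complex_of_real (2 * pi * ell \<delta> y)" for y
  proof -
    have "(\<lambda>u. \<delta> u * cnj (a y u)) = (\<lambda>u. cnj (a y u * cnj (\<delta> u)))"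
      by (rule ext) (simp only: complex_cnj_mult complex_cnj_cnj mult.commute)
    then have "(CLINT u|lborel. \<delta> u * cnj (a y u)) = cnj (CLINT u|lborel. a y u * cnj (\<delta> u))"
      by (simp only: Bochner_Integration.integral_cnj)
    then show ?thesis unfolding ell by simp
  qed
  have pw: "(iexp (u * s) * \<kappa> u - \<Phi>0 u) * cnj (iexp (u * t) * \<kappa> u - \<Phi>0 u)
    = a s u * cnj (a t u) + a s u * cnj (\<delta> u) + \<delta> u * cnj (a t u) + \<delta> u * cnj (\<delta> u) + complex_of_real (w u)" for u
  proof (cases "u \<in> {-T..T}")
    case True
    have "iexp (u * r) * \<kappa> u - \<Phi>0 u = a r u + \<delta> u" for r using True by (simp add: a_def \<delta>)
    then show ?thesis using True by (simp add: w_def algebra_simps)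
  next
    case False
    then show ?thesis by (simp add: w_def a_def \<delta> \<kappa>0 complex_norm_square[symmetric] del: of_real_power)
  qed
  have i: "integrable lborel (\<lambda>u. a s u * cnj (a t u))" "integrable lborel (\<lambda>u. a s u * cnj (\<delta> u))"
     "integrable lborel (\<lambda>u. \<delta> u * cnj (a t u))" "integrable lborel (\<lambda>u. \<delta> u * cnj (\<delta> u))" "integrable lborel (\<lambda>u. complex_of_real (w u))"
    using wi by (auto intro!: bc_integrable bc_mult a_bc bc_cnj d)
  have "(CLINT u|lborel. (iexp (u * s) * \<kappa> u - \<Phi>0 u) * cnj (iexp (u * t) * \<kappa> u - \<Phi>0 u))
    = (CLINT u|lborel. a s u * cnj (a t u)) + (CLINT u|lborel. a s u * cnj (\<delta> u)) + (CLINT u|lborel. \<delta> u * cnj (a t u))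
      + (CLINT u|lborel. \<delta> u * cnj (\<delta> u)) + (CLINT u|lborel. complex_of_real (w u))"
    unfolding pw using i by simp
  also have "\<dots> = complex_of_real (2 * pi * H s t) + complex_of_real (2 * pi * ell \<delta> s) + complex_of_real (2 * pi * ell \<delta> t)
      + complex_of_real (LINT u|lborel. (cmod (\<delta> u))\<^sup>2) + complex_of_real (integral\<^sup>L lborel w)"
    unfolding H_complex ell ell' cmod_square_integral[symmetric] integral_complex_of_real ..
  also have "\<dots> = complex_of_real (2 * pi * (integral\<^sup>L lborel w / (2 * pi)
        + (LINT u|lborel. (cmod (\<delta> u))\<^sup>2) / (2 * pi) + ell \<delta> s + ell \<delta> t + H s t))"
    unfolding of_real_add[symmetric] by (rule arg_cong[where f=complex_of_real]) (simp add: field_simps)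
  finally show "(CLINT u|lborel. (iexp (u * s) * \<kappa> u - \<Phi>0 u) * cnj (iexp (u * t) * \<kappa> u - \<Phi>0 u))
     = complex_of_real (2 * pi * ((LINT u|lborel. indicator (- {-T..T}) u * (cmod (\<Phi>0 u))\<^sup>2) / (2 * pi)
        + (LINT u|lborel. (cmod (\<delta> u))\<^sup>2) / (2 * pi) + ell \<delta> s + ell \<delta> t + H s t))"
    unfolding w_def .
qed

end

text \<open>For the null density this is the bias of the statistic: the energy that the band does
  not see. The factor 1 / (2 * pi) makes it a squared L2 norm on the side of densities.\<close>

definition tail_energy :: "(real \<Rightarrow> real) \<Rightarrow> real \<Rightarrow> real" where
  "tail_energy f h = (LINT u|lborel. indicator (- {-(1/h)..1/h}) u * (cmod (fourier f u))\<^sup>2) / (2 * pi)"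

definition core_energy :: "(real \<Rightarrow> real) \<Rightarrow> (real \<Rightarrow> real) \<Rightarrow> real \<Rightarrow> real" where
  "core_energy f f0 h = (LINT u|lborel. (cmod (indicator {-(1/h)..1/h} u * (fourier f u - fourier f0 u)))\<^sup>2) / (2 * pi)"

lemma test_stat_decomp:
  fixes f f0 g h
  defines "\<delta> \<equiv> \<lambda>u. indicator {-(1/h)..1/h} u * (fourier f u - fourier f0 u)"
  assumes D: "deconvolution (law g f) (fourier f) (kernel_ft g h) (1 / h) K b"
    and f0: "is_prob_density f0" "integrable lborel (\<lambda>x. (f0 x)\<^sup>2)" and n: "n \<ge> 2"
  shows "bc (1 / h) \<delta>"
    and "test_stat g f0 n h Y = complex_of_real (tail_energy f0 h + core_energy f f0 h
      + 2 / real n * (\<Sum>j=1..n. deconvolution.ell (fourier f) (kernel_ft g h) (1 / h) \<delta> (Y j))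
      + 2 / (real n * (real n - 1)) * degenerate_kernel.U (deconvolution.H (fourier f) (kernel_ft g h) (1 / h)) n Y)"
proof -
  interpret deconvolution "law g f" "fourier f" "kernel_ft g h" "1 / h" K b by (rule D)
  have k0: "\<forall>u. u \<notin> {-(1/h)..1/h} \<longrightarrow> kernel_ft g h u = 0"
    by (auto simp: kernel_ft_def indicator_def abs_le_iff)
  have "cmod (kernel_ft g h u) \<le> K * indicator {-(1/h)..1/h} u" for u
    using \<kappa>_bound[of u] k0 by (cases "u \<in> {-(1/h)..1/h}") (auto simp: abs_le_iff)
  then have kb: "bc (1 / h) (kernel_ft g h)" by (intro bcI[of _ K]) auto
  have \<delta>: "\<delta> u = indicator {-(1/h)..1/h} u * (fourier f u - fourier f0 u)" for u by (simp add: \<delta>_def)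
  have \<delta>2: "(LINT u|lborel. (cmod (\<delta> u))\<^sup>2) / (2 * pi) = core_energy f f0 h"
    unfolding core_energy_def \<delta> ..
  note p = pairing_decomp[OF k0 fourier_measurable[OF f0(1)] fourier_le_1[OF f0(1)] fourier_cnj
      fourier_L2(1)[OF prob_densityD(1)[OF f0(1)] f0(2)] \<delta>]
  show "bc (1 / h) \<delta>" by (rule p(1))
  let ?c = "tail_energy f0 h + core_energy f f0 h"
  have L: "L2_inner (\<lambda>x. kernel g h (x - s) - complex_of_real (f0 x)) (\<lambda>x. kernel g h (x - t) - complex_of_real (f0 x))
    = complex_of_real (?c + ell \<delta> s + ell \<delta> t + H s t)" for s t
  proof -
    have "complex_of_real (1 / (2 * pi)) * complex_of_real (2 * pi * x) = complex_of_real x" for x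
      unfolding of_real_mult[symmetric] by simp
    then show ?thesis
      unfolding L2_inner_kernel[OF kb f0] p(2)[of s t] \<delta>2 tail_energy_def[symmetric] by (simp only:)
  qed
  have n0: "real n * (real n - 1) \<noteq> 0" using n by auto
  have "(\<Sum>j=1..n. \<Sum>k=1..<j. ?c + ell \<delta> (Y k) + ell \<delta> (Y j) + H (Y k) (Y j))
    = (\<Sum>j=1..n. \<Sum>k=1..<j. ?c + ell \<delta> (Y k) + ell \<delta> (Y j)) + H.U n Y"
    unfolding H.U_def H.D_def by (simp only: sum.distrib)
  also have "\<dots> = ?c * (real n * (real n - 1) / 2) + (real n - 1) * (\<Sum>j=1..n. ell \<delta> (Y j)) + H.U n Y"
    unfolding sum_pairs[where e="\<lambda>j. ell \<delta> (Y j)"] ..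
  finally have sum_eq: "(\<Sum>j=1..n. \<Sum>k=1..<j. ?c + ell \<delta> (Y k) + ell \<delta> (Y j) + H (Y k) (Y j))
    = ?c * (real n * (real n - 1) / 2) + (real n - 1) * (\<Sum>j=1..n. ell \<delta> (Y j)) + H.U n Y" .
  have S: "2 / (real n * (real n - 1)) * (\<Sum>j=1..n. \<Sum>k=1..<j. ?c + ell \<delta> (Y k) + ell \<delta> (Y j) + H (Y k) (Y j))
    = ?c + 2 / real n * (\<Sum>j=1..n. ell \<delta> (Y j)) + 2 / (real n * (real n - 1)) * H.U n Y"
  proof -
    have alg: "2 / (N * M) * (c * (N * M / 2) + M * E + V) = c + 2 / N * E + 2 / (N * M) * V"
      if "N \<noteq> 0" "M \<noteq> 0" for N M c E V :: real
      using that by (simp add: field_simps)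
    show ?thesis unfolding sum_eq by (rule alg) (use n0 in auto)
  qed
  show "test_stat g f0 n h Y = complex_of_real (?c + 2 / real n * (\<Sum>j=1..n. ell \<delta> (Y j)) + 2 / (real n * (real n - 1)) * H.U n Y)"
    unfolding test_stat_def L S[symmetric] of_real_mult of_real_sum ..
qed

section \<open>Level and power of a single test\<close>

lemma obs_law_iid: "obs_law g n f = iid (law g f) n"
  unfolding obs_law_def ..

lemma core_energy_self: "core_energy f f h = 0"
  unfolding core_energy_def by simp

lemma tail_energy_nonneg: "0 \<le> tail_energy f h"
  unfolding tail_energy_def by (auto intro!: divide_nonneg_pos integral_nonneg_AE)

text \<open>Under the null hypothesis signal and linear term vanish, and by \<open>B0\<close> the
  bias uses at most half of the critical value; a rejection therefore forces the U-statistic beyond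
  the other half.\<close>

lemma single_test_level:
  assumes D: "deconvolution (law g f0) (fourier f0) (kernel_ft g h) (1 / h) K b"
    and f0: "is_prob_density f0" "integrable lborel (\<lambda>x. (f0 x)\<^sup>2)" and n: "n \<ge> 2"
    and t: "t > 0" and C: "C > 0" and B0: "tail_energy f0 h \<le> C * t / 2"
  shows "{Y \<in> space (obs_law g n f0). cmod (test_stat g f0 n h Y) * inverse t > C} \<in> sets (obs_law g n f0)" (is "?A \<in> _")
    and "measure (obs_law g n f0) {Y \<in> space (obs_law g n f0). cmod (test_stat g f0 n h Y) * inverse t > C}
    \<le> 2 * (exp (- (C * t)\<^sup>2 * (real n)\<^sup>2 / (384 * (b * (1 / h) * K ^ 4)))
        + (4 * b * h + 4 / (9 * (real n)\<^sup>2 * b * h) + 1 / (3 * real n)))"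
proof -
  interpret deconvolution "law g f0" "fourier f0" "kernel_ft g h" "1 / h" K b by (rule D)
  interpret Y: prob_space "iid (law g f0) n" by (rule prob_space_iid)
  have n0: "real n > 0" "real n - 1 \<ge> real n / 2" "real n - 1 > 0" using n by auto
  let ?\<delta> = "\<lambda>u. indicator {-(1/h)..1/h} u * (fourier f0 u - fourier f0 u)"
  have "ell ?\<delta> y = 0" for y unfolding ell_def by simp
  then have ts: "test_stat g f0 n h Y = complex_of_real (tail_energy f0 h + 2 / (real n * (real n - 1)) * H.U n Y)" for Y
    unfolding test_stat_decomp(2)[OF D f0 n] core_energy_self by simp
  have [measurable]: "H.U n \<in> borel_measurable (iid (law g f0) n)" by (rule H.U_measurable)
  show "?A \<in> sets (obs_law g n f0)"
    unfolding ts norm_of_real obs_law_iid by measurable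
  \<comment> \<open>The value at which the normalised U-statistic equals C * t / 2. Bounding n - 1
    below by n / 2 then gives 384 = 6 * 8^2 in the exponent.\<close>
  define x where "x = C * t * (real n * (real n - 1)) / 4"
  have x: "x > 0" using C t n0 by (simp add: x_def)
  have S: "b * (1 / h) * K ^ 4 > 0" using b T K by simp
  have m: "{Y \<in> space (iid (law g f0) n). \<bar>H.U n Y\<bar> \<ge> x} \<in> sets (iid (law g f0) n)" by measurable
  have "measure (obs_law g n f0) ?A \<le> measure (iid (law g f0) n) {Y \<in> space (iid (law g f0) n). \<bar>H.U n Y\<bar> \<ge> x}"
    unfolding obs_law_iid
  proof (rule Y.finite_measure_mono[OF subsetI m])
    fix Y assume Y: "Y \<in> {Y \<in> space (iid (law g f0) n). C < cmod (test_stat g f0 n h Y) * inverse t}"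
    have "x \<le> \<bar>H.U n Y\<bar>"
    proof (rule ccontr)
      assume "\<not> ?thesis"
      then have u: "\<bar>H.U n Y\<bar> < x" by simp
      have "C * t < cmod (test_stat g f0 n h Y)" using Y t by (simp add: field_simps)
      also have "\<dots> \<le> tail_energy f0 h + 2 / (real n * (real n - 1)) * \<bar>H.U n Y\<bar>"
        unfolding ts norm_of_real using tail_energy_nonneg[of f0 h] n0
        by (intro order_trans[OF abs_triangle_ineq]) (simp add: abs_mult)
      also have "\<dots> < C * t / 2 + 2 / (real n * (real n - 1)) * x"
        using B0 u n0 by (intro add_le_less_mono mult_strict_left_mono) auto
      also have "\<dots> = C * t" using n0 by (simp add: x_def)
      finally show False by simp
    qed
    then show "Y \<in> {Y \<in> space (iid (law g f0) n). \<bar>H.U n Y\<bar> \<ge> x}" using Y by simp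
  qed
  also have "\<dots> \<le> 2 * (exp (- x\<^sup>2 / (6 * (real n)\<^sup>2 * (b * (1 / h) * K ^ 4)))
      + (4 * b / (1 / h) + 4 * (1 / h) / (9 * (real n)\<^sup>2 * b) + 1 / (3 * real n)))"
    using n by (intro H_tail x) auto
  also have "\<dots> \<le> 2 * (exp (- (C * t)\<^sup>2 * (real n)\<^sup>2 / (384 * (b * (1 / h) * K ^ 4)))
      + (4 * b * h + 4 / (9 * (real n)\<^sup>2 * b * h) + 1 / (3 * real n)))"
  proof -
    have "C * t * (real n * (real n / 2)) / 4 \<le> x"
      unfolding x_def using C t n0 by (intro divide_right_mono mult_left_mono) auto
    then have "(C * t * (real n * (real n / 2)) / 4)\<^sup>2 / (6 * (real n)\<^sup>2 * (b * (1 / h) * K ^ 4)) \<le> x\<^sup>2 / (6 * (real n)\<^sup>2 * (b * (1 / h) * K ^ 4))"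
      using C t n0 less_imp_le[OF S] by (intro divide_right_mono power_mono mult_nonneg_nonneg[of _ "b * (1 / h) * K ^ 4"]) auto
    moreover have "(C * t * (real n * (real n / 2)) / 4)\<^sup>2 / (6 * (real n)\<^sup>2 * (b * (1 / h) * K ^ 4)) = (C * t)\<^sup>2 * (real n)\<^sup>2 / (384 * (b * (1 / h) * K ^ 4))"
      using n0 b T K by (simp add: field_simps power2_eq_square)
    ultimately show ?thesis using b T by (simp add: field_simps)
  qed
  finally show "measure (obs_law g n f0) ?A \<le> 2 * (exp (- (C * t)\<^sup>2 * (real n)\<^sup>2 / (384 * (b * (1 / h) * K ^ 4)))
      + (4 * b * h + 4 / (9 * (real n)\<^sup>2 * b * h) + 1 / (3 * real n)))" .
qed

text \<open>The bias is nonnegative and adds to the signal, so acceptance forces the random part to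
  be at least half of the core energy in modulus. The bound of \<open>deviation\<close> decreases in
  that energy, which may thus be replaced by its lower bound \<mu>.\<close>

lemma single_test_power:
  assumes D: "deconvolution (law g f) (fourier f) (kernel_ft g h) (1 / h) K b"
    and f0: "is_prob_density f0" "integrable lborel (\<lambda>x. (f0 x)\<^sup>2)" and n: "n \<ge> 2"
    and t: "t > 0" and C: "C > 0" and \<mu>: "core_energy f f0 h \<ge> \<mu>" "\<mu> > 0" "C * t < \<mu> / 2"
  shows "{Y \<in> space (obs_law g n f). cmod (test_stat g f0 n h Y) * inverse t \<le> C} \<in> sets (obs_law g n f)" (is "?A \<in> _")
    and "measure (obs_law g n f) {Y \<in> space (obs_law g n f). cmod (test_stat g f0 n h Y) * inverse t \<le> C}
    \<le> 64 * (b * K\<^sup>2) / (real n * \<mu>) + 256 * (b * (1 / h) * K ^ 4) / ((real n)\<^sup>2 * \<mu>\<^sup>2)"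
proof -
  interpret deconvolution "law g f" "fourier f" "kernel_ft g h" "1 / h" K b by (rule D)
  interpret Y: prob_space "iid (law g f) n" by (rule prob_space_iid)
  define \<delta> where "\<delta> u = indicator {-(1/h)..1/h} u * (fourier f u - fourier f0 u)" for u
  have \<delta>': "(\<lambda>u. indicator {-(1/h)..1/h} u * (fourier f u - fourier f0 u)) = \<delta>" by (rule ext) (simp add: \<delta>_def)
  note dec = test_stat_decomp[OF D f0 n, unfolded \<delta>']
  define X where "X Y = 2 / real n * (\<Sum>j=1..n. ell \<delta> (Y j)) + 2 / (real n * (real n - 1)) * H.U n Y" for Y
  let ?m = "core_energy f f0 h"
  have ts: "test_stat g f0 n h Y = complex_of_real (tail_energy f0 h + ?m + X Y)" for Y
    unfolding dec(2) X_def by (simp only: add.assoc)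
  have pm: "ell \<delta> \<in> borel_measurable (law g f)" using ell_props(1)[OF dec(1)] by (simp add: measurable_cong_sets[OF sets_M refl])
  have Xm[measurable]: "X \<in> borel_measurable (iid (law g f) n)"
    unfolding X_def by (intro borel_measurable_add borel_measurable_times borel_measurable_const sum_measurable_iid pm H.U_measurable)
  show "?A \<in> sets (obs_law g n f)" unfolding ts norm_of_real obs_law_iid by measurable
  have m: "{Y \<in> space (iid (law g f) n). \<bar>X Y\<bar> \<ge> ?m / 2} \<in> sets (iid (law g f) n)" by measurable
  have m0: "?m > 0" using \<mu> by simp
  have "measure (obs_law g n f) ?A \<le> measure (iid (law g f) n) {Y \<in> space (iid (law g f) n). \<bar>X Y\<bar> \<ge> ?m / 2}"
    unfolding obs_law_iid
  proof (rule Y.finite_measure_mono[OF subsetI m])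
    fix Y assume Y: "Y \<in> {Y \<in> space (iid (law g f) n). cmod (test_stat g f0 n h Y) * inverse t \<le> C}"
    have "?m / 2 \<le> \<bar>X Y\<bar>"
    proof (rule ccontr)
      assume "\<not> ?thesis"
      then have u: "\<bar>X Y\<bar> < ?m / 2" by simp
      have "\<bar>tail_energy f0 h + ?m + X Y\<bar> \<le> C * t"
        using Y t unfolding ts norm_of_real by (simp add: field_simps)
      then show False using u tail_energy_nonneg[of f0 h] \<mu> by linarith
    qed
    then show "Y \<in> {Y \<in> space (iid (law g f) n). \<bar>X Y\<bar> \<ge> ?m / 2}" using Y by simp
  qed
  also have "\<dots> \<le> 64 * (b * K\<^sup>2) / (real n * ?m) + 256 * (b * (1 / h) * K ^ 4) / ((real n)\<^sup>2 * ?m\<^sup>2)"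
    unfolding X_def by (rule deviation[OF dec(1) n _ m0]) (simp add: core_energy_def \<delta>_def)
  also have "\<dots> \<le> 64 * (b * K\<^sup>2) / (real n * \<mu>) + 256 * (b * (1 / h) * K ^ 4) / ((real n)\<^sup>2 * \<mu>\<^sup>2)"
    using \<mu> n b K T by (intro add_mono divide_left_mono mult_left_mono power_mono mult_pos_pos mult_nonneg_nonneg zero_less_power) auto
  finally show "measure (obs_law g n f) ?A \<le> 64 * (b * K\<^sup>2) / (real n * \<mu>) + 256 * (b * (1 / h) * K ^ 4) / ((real n)\<^sup>2 * \<mu>\<^sup>2)" .
qed

section \<open>Integrability and lower bounds for the noise transform\<close>

lemma integrable_powr_tail:
  assumes e: "e < -1" and R: "R > (0::real)"
  shows "integrable lborel (\<lambda>x. indicator {R..} x * x powr e)"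
proof -
  have "(\<lambda>x. x powr e) absolutely_integrable_on {R..}"
    by (rule nonnegative_absolutely_integrable_1)
      (use has_integral_powr_to_inf[OF e R] in \<open>auto simp: integrable_on_def\<close>)
  then have "integrable lebesgue (\<lambda>x. indicator {R..} x * x powr e)"
    by (simp add: set_integrable_def)
  then show ?thesis by (subst (asm) integrable_completion) auto
qed

lemma decay_integrable:
  fixes F :: "real \<Rightarrow> complex"
  assumes [measurable]: "F \<in> borel_measurable borel" and F1: "\<And>u. cmod (F u) \<le> 1"
    and \<sigma>: "1 < \<sigma>" and c: "c \<ge> 0" and R: "R > 0" and dec: "\<And>u. \<bar>u\<bar> \<ge> R \<Longrightarrow> cmod (F u) \<le> c * \<bar>u\<bar> powr (- \<sigma>)"
  shows "integrable lborel (\<lambda>u. cmod (F u))"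
proof -
  define p where "p x = indicator {R..} x * x powr (- \<sigma>)" for x :: real
  have p: "integrable lborel p" unfolding p_def using integrable_powr_tail[of "- \<sigma>" R] \<sigma> R by simp
  have p': "integrable lborel (\<lambda>x. p (- x))" by (rule integrable_reflect[OF p])
  have "integrable lborel (\<lambda>u. indicator {-R..R} u + c * p u + c * p (- u))"
    using p p' integrable_indicator_mult[of 1 R] by (intro Bochner_Integration.integrable_add integrable_mult_right) auto
  then show ?thesis
  proof (rule Bochner_Integration.integrable_bound)
    show "AE u in lborel. norm (cmod (F u)) \<le> norm (indicator {-R..R} u + c * p u + c * p (- u))"
    proof (intro AE_I2)
      fix u :: real
      have p0: "0 \<le> c * p x" for x using c by (simp add: p_def)
      consider "\<bar>u\<bar> \<le> R" | "u \<ge> R" | "- u \<ge> R" by linarith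
      then have "cmod (F u) \<le> indicator {-R..R} u + c * p u + c * p (- u)"
      proof cases
        case 1
        then have "u \<in> {-R..R}" by auto
        then show ?thesis using F1[of u] p0[of u] p0[of "- u"] by simp
      next
        case 2
        then have "c * p u = c * \<bar>u\<bar> powr (- \<sigma>)" using R by (simp add: p_def)
        then show ?thesis using dec[of u] 2 R p0[of "- u"] indicator_pos_le[of "{-R..R}" u, where 'a=real] by linarith
      next
        case 3
        then have "c * p (- u) = c * \<bar>u\<bar> powr (- \<sigma>)" using R by (simp add: p_def)
        then show ?thesis using dec[of u] 3 R p0[of u] indicator_pos_le[of "{-R..R}" u, where 'a=real] by linarith
      qed
      then show "norm (cmod (F u)) \<le> norm (indicator {-R..R} u + c * p u + c * p (- u))" by simp
    qed
  qed measurable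
qed

text \<open>Asymptotic equivalence bounds the transform on both sides by multiples of |u| powr (-
  \<sigma>) for large |u|. The upper bound gives integrability, as \<sigma> > 1. The lower bound
  controls the inverse for large |u|; elsewhere compactness does, since \<open>fourier g\<close> is
  continuous without zeros.\<close>

lemma noise_constants:
  assumes g: "is_prob_density g" and \<sigma>: "1 < \<sigma>" and cg: "0 < cg" and g0: "\<And>u. fourier g u \<noteq> 0"
    and eq: "(\<lambda>u. cmod (fourier g u)) \<sim>[at_infinity] (\<lambda>u. cg * \<bar>u\<bar> powr (- \<sigma>))"
  shows "integrable lborel (\<lambda>u. cmod (fourier g u))"
    and "\<exists>C\<ge>1. \<forall>T\<ge>1. \<forall>u. \<bar>u\<bar> \<le> T \<longrightarrow> 1 / cmod (fourier g u) \<le> C * T powr \<sigma>"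
proof -
  have th: "(\<lambda>u. cmod (fourier g u)) \<in> \<Theta>[at_infinity](\<lambda>u. cg * \<bar>u\<bar> powr (- \<sigma>))"
    using eq by (rule asymp_equiv_imp_bigtheta)
  obtain c1 where c1: "c1 > 0" and "\<forall>\<^sub>F u in at_infinity. norm (cmod (fourier g u)) \<le> c1 * norm (cg * \<bar>u\<bar> powr (- \<sigma>))"
    using bigthetaD1[OF th] by (elim landau_o.bigE)
  then obtain R1 where R1: "\<And>u. \<bar>u\<bar> \<ge> R1 \<Longrightarrow> cmod (fourier g u) \<le> (c1 * cg) * \<bar>u\<bar> powr (- \<sigma>)"
    unfolding eventually_at_infinity using cg by (auto simp: abs_mult mult.assoc)
  obtain c2 where c2: "c2 > 0" and "\<forall>\<^sub>F u in at_infinity. norm (cmod (fourier g u)) \<ge> c2 * norm (cg * \<bar>u\<bar> powr (- \<sigma>))"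
    using bigthetaD2[OF th] by (elim landau_omega.bigE)
  then obtain R2 where R2: "\<And>u. \<bar>u\<bar> \<ge> R2 \<Longrightarrow> (c2 * cg) * \<bar>u\<bar> powr (- \<sigma>) \<le> cmod (fourier g u)"
    unfolding eventually_at_infinity using cg by (auto simp: abs_mult mult.assoc)
  show "integrable lborel (\<lambda>u. cmod (fourier g u))"
    by (rule decay_integrable[where R="max 1 R1" and c="c1 * cg" and \<sigma>=\<sigma>])
      (use fourier_measurable[OF g] fourier_le_1[OF g] \<sigma> c1 cg R1 in auto)
  define R where "R = max 1 R2"
  have "continuous_on {-R..R} (\<lambda>u. 1 / cmod (fourier g u))"
    using isCont_fourier[OF g] g0 by (intro continuous_at_imp_continuous_on ballI continuous_intros) auto
  then have "bounded ((\<lambda>u. 1 / cmod (fourier g u)) ` {-R..R})"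
    by (intro compact_imp_bounded compact_continuous_image) auto
  then obtain B where B: "\<And>u. u \<in> {-R..R} \<Longrightarrow> 1 / cmod (fourier g u) \<le> B"
    unfolding bounded_iff by force
  define C where "C = max 1 (max B (1 / (c2 * cg)))"
  have "1 / cmod (fourier g u) \<le> C * T powr \<sigma>" if "T \<ge> 1" "\<bar>u\<bar> \<le> T" for T u
  proof (cases "\<bar>u\<bar> \<le> R")
    case True
    then have "1 / cmod (fourier g u) \<le> C" using B[of u] by (auto simp: C_def abs_le_iff)
    also have "\<dots> \<le> C * T powr \<sigma>"
    proof -
      have "1 \<le> T powr \<sigma>" using that \<sigma> by (intro ge_one_powr_ge_zero) auto
      moreover have "0 \<le> C" by (simp add: C_def)
      ultimately show ?thesis using mult_left_mono[of 1 "T powr \<sigma>" C] by simp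
    qed
    finally show ?thesis .
  next
    case False
    then have u: "\<bar>u\<bar> \<ge> R2" "\<bar>u\<bar> > 0" by (auto simp: R_def)
    have "1 / cmod (fourier g u) \<le> 1 / ((c2 * cg) * \<bar>u\<bar> powr (- \<sigma>))"
      using R2[OF u(1)] c2 cg u(2) g0[of u] by (intro divide_left_mono) auto
    also have "\<dots> = 1 / (c2 * cg) * \<bar>u\<bar> powr \<sigma>" by (simp add: powr_minus field_simps)
    also have "\<dots> \<le> C * T powr \<sigma>"
      using that \<sigma> c2 cg by (intro mult_mono powr_mono2) (auto simp: C_def)
    finally show ?thesis .
  qed
  moreover have "C \<ge> 1" by (simp add: C_def)
  ultimately show "\<exists>C\<ge>1. \<forall>T\<ge>1. \<forall>u. \<bar>u\<bar> \<le> T \<longrightarrow> 1 / cmod (fourier g u) \<le> C * T powr \<sigma>" by blast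
qed

lemma noise_mass_pos:
  assumes g: "is_prob_density g" and g0: "\<And>u. fourier g u \<noteq> 0" and gi: "integrable lborel (\<lambda>u. cmod (fourier g u))"
  shows "(LINT u|lborel. cmod (fourier g u)) > 0"
proof -
  have "(LINT u|lborel. cmod (fourier g u)) \<noteq> 0"
  proof
    assume "(LINT u|lborel. cmod (fourier g u)) = 0"
    then have "AE u in lborel. cmod (fourier g u) = 0"
      by (subst (asm) integral_nonneg_eq_0_iff_AE[OF gi]) auto
    then have "AE u in (lborel :: real measure). False" by eventually_elim (use g0 in auto)
    then show False by (simp add: eventually_False ae_filter_eq_bot_iff)
  qed
  moreover have "(LINT u|lborel. cmod (fourier g u)) \<ge> 0" by (intro integral_nonneg_AE) auto
  ultimately show ?thesis by linarith
qed

section \<open>Bias and separation in terms of the smoothness classes\<close>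

lemma smooth_classD:
  assumes "f \<in> smooth_class \<alpha> r \<beta> L"
  shows "is_prob_density f" "integrable lborel (\<lambda>x. (f x)\<^sup>2)"
  using assms unfolding smooth_class_def by auto

text \<open>Markov's inequality for the energy, with the weight of the smoothness class. It is run
  on extended nonnegative integrals, the form in which the class is defined.\<close>

lemma tail_energy_le:
  assumes f: "f \<in> smooth_class \<alpha> r \<beta> L" and L: "L \<ge> 0" and w: "w > 0" and h: "h > 0"
    and weight: "\<And>u. \<bar>u\<bar> > 1 / h \<Longrightarrow> w \<le> \<bar>u\<bar> powr (2 * \<beta>) * exp (2 * \<alpha> * \<bar>u\<bar> powr r)"
  shows "tail_energy f h \<le> L / w"
proof -
  note fd = smooth_classD[OF f]
  note [measurable] = fourier_measurable[OF fd(1)]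
  let ?W = "\<lambda>u. (cmod (fourier f u))\<^sup>2 * \<bar>u\<bar> powr (2 * \<beta>) * exp (2 * \<alpha> * \<bar>u\<bar> powr r)"
  define v where "v u = (indicator (- {-(1/h)..1/h}) u * (cmod (fourier f u))\<^sup>2 :: real)" for u
  have vi: "integrable lborel v"
    using integrable_real_mult_indicator[OF _ fourier_L2(1)[OF prob_densityD(1)[OF fd(1)] fd(2)], of "- {-(1/h)..1/h}"]
    unfolding v_def by (simp add: mult.commute)
  have v0: "v u \<ge> 0" for u by (simp add: v_def)
  have [measurable]: "v \<in> borel_measurable borel" unfolding v_def by measurable
  have "ennreal (tail_energy f h * w) = ennreal (w / (2 * pi)) * ennreal (integral\<^sup>L lborel v)"
    using w by (subst ennreal_mult[symmetric]) (auto simp: tail_energy_def v_def[abs_def] integral_nonneg_AE)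
  also have "ennreal (integral\<^sup>L lborel v) = (\<integral>\<^sup>+u. ennreal (v u) \<partial>lborel)"
    using vi v0 by (intro nn_integral_eq_integral[symmetric]) auto
  also have "ennreal (w / (2 * pi)) * (\<integral>\<^sup>+u. ennreal (v u) \<partial>lborel) = ennreal (1 / (2 * pi)) * (\<integral>\<^sup>+u. ennreal (w * v u) \<partial>lborel)"
  proof -
    have "ennreal (w / (2 * pi)) = ennreal (1 / (2 * pi)) * ennreal w" using w by (subst ennreal_mult[symmetric]) auto
    moreover have "(\<integral>\<^sup>+u. ennreal (w * v u) \<partial>lborel) = ennreal w * (\<integral>\<^sup>+u. ennreal (v u) \<partial>lborel)"
      using w v0 by (subst nn_integral_cmult[symmetric]) (auto simp: ennreal_mult)
    ultimately show ?thesis by (simp only: mult.assoc)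
  qed
  also have "\<dots> \<le> ennreal (1 / (2 * pi)) * (\<integral>\<^sup>+u. ennreal (?W u) \<partial>lborel)"
  proof (intro mult_left_mono nn_integral_mono ennreal_leI)
    fix u
    show "w * v u \<le> ?W u"
    proof (cases "u \<in> {-(1/h)..1/h}")
      case False
      then have "w \<le> \<bar>u\<bar> powr (2 * \<beta>) * exp (2 * \<alpha> * \<bar>u\<bar> powr r)" by (intro weight) auto
      from mult_left_mono[OF this, of "(cmod (fourier f u))\<^sup>2"] show ?thesis using False by (simp add: v_def mult.commute mult.assoc mult.left_commute)
    qed (simp add: v_def)
  qed auto
  also have "\<dots> \<le> ennreal L" using f unfolding smooth_class_def by auto
  finally have "tail_energy f h * w \<le> L" using L by (subst (asm) ennreal_le_iff) auto
  then show ?thesis using w by (simp add: field_simps)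
qed

text \<open>Plancherel's theorem for the difference; off the band its energy is at most twice the
  sum of the two energies.\<close>

lemma energy_split:
  assumes f: "is_prob_density f" "integrable lborel (\<lambda>x. (f x)\<^sup>2)"
    and f0: "is_prob_density f0" "integrable lborel (\<lambda>x. (f0 x)\<^sup>2)"
  shows "(L2_norm (\<lambda>x. f x - f0 x))\<^sup>2 \<le> core_energy f f0 h + 2 * tail_energy f h + 2 * tail_energy f0 h"
proof -
  note fd = prob_densityD[OF f(1)] and fd0 = prob_densityD[OF f0(1)]
  note [measurable] = fd(2) fd0(2) fourier_measurable[OF f(1)] fourier_measurable[OF f0(1)]
  let ?d = "\<lambda>x. f x - f0 x" and ?I = "{-(1/h)..1/h}"
  have d: "integrable lborel ?d" using fd(1) fd0(1) by simp
  have d2: "integrable lborel (\<lambda>x. (?d x)\<^sup>2)"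
    using integrable_square_diff[of "\<lambda>x. complex_of_real (f x)" lborel "\<lambda>x. complex_of_real (f0 x)"] f(2) f0(2)
    by (simp flip: of_real_diff)
  have fo: "fourier ?d u = fourier f u - fourier f0 u" for u
    unfolding fourier_ft using ft_diff[OF fd(5) fd0(5), of u] by simp
  have pf: "integrable lborel (\<lambda>u. (cmod (fourier f u))\<^sup>2)" "integrable lborel (\<lambda>u. (cmod (fourier f0 u))\<^sup>2)"
    "integrable lborel (\<lambda>u. (cmod (fourier ?d u))\<^sup>2)"
    by (rule fourier_L2(1)[OF fd(1) f(2)] fourier_L2(1)[OF fd0(1) f0(2)] fourier_L2(1)[OF d d2])+
  have ti: "integrable lborel (\<lambda>u. indicator (- ?I) u * (cmod (fourier f u))\<^sup>2)"
      "integrable lborel (\<lambda>u. indicator (- ?I) u * (cmod (fourier f0 u))\<^sup>2)"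
    using integrable_real_mult_indicator[OF _ pf(1), of "- ?I"] integrable_real_mult_indicator[OF _ pf(2), of "- ?I"]
    by (simp_all add: mult.commute)
  have ci: "integrable lborel (\<lambda>u. (cmod (indicator ?I u * (fourier f u - fourier f0 u)))\<^sup>2)"
    using integrable_real_mult_indicator[OF _ pf(3), of ?I] unfolding fo
    by (rule Bochner_Integration.integrable_bound) (auto intro!: AE_I2 simp: norm_mult indicator_def)
  have pw: "(cmod (fourier ?d u))\<^sup>2 \<le> (cmod (indicator ?I u * (fourier f u - fourier f0 u)))\<^sup>2
    + 2 * (indicator (- ?I) u * (cmod (fourier f u))\<^sup>2) + 2 * (indicator (- ?I) u * (cmod (fourier f0 u))\<^sup>2)" for u
    unfolding fo using cmod_add_square_le[of "fourier f u" "- fourier f0 u"] by (cases "u \<in> ?I") auto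
  have "(L2_norm ?d)\<^sup>2 = (LINT u|lborel. (cmod (fourier ?d u))\<^sup>2) / (2 * pi)"
    unfolding fourier_L2(2)[OF d d2] L2_norm_def by (simp add: integral_nonneg_AE)
  also have "\<dots> \<le> (LINT u|lborel. (cmod (indicator ?I u * (fourier f u - fourier f0 u)))\<^sup>2
    + 2 * (indicator (- ?I) u * (cmod (fourier f u))\<^sup>2) + 2 * (indicator (- ?I) u * (cmod (fourier f0 u))\<^sup>2)) / (2 * pi)"
    by (intro divide_right_mono integral_mono pw pf Bochner_Integration.integrable_add integrable_mult_right ti ci) simp
  also have "\<dots> = core_energy f f0 h + 2 * tail_energy f h + 2 * tail_energy f0 h"
    unfolding core_energy_def tail_energy_def using ti ci by (simp add: add_divide_distrib)
  finally show ?thesis .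
qed

text \<open>With y = v powr r and B = A / r the left side is y powr B, and the claim follows from ln
  (e * y) \<le> e * y for a small factor \<open>e\<close>.\<close>

lemma powr_le_exp:
  fixes A a r :: real
  assumes "A \<ge> 0" "a > 0" "r > 0"
  shows "\<exists>K\<ge>1. \<forall>v\<ge>1. v powr A \<le> K * exp (a * v powr r)"
proof -
  define B where "B = A / r"
  have B: "B \<ge> 0" using assms by (simp add: B_def)
  \<comment> \<open>Small enough for B * e \<le> a; the + 1 keeps the quotient meaningful when B =
    0.\<close>
  define e where "e = a / (B + 1)"
  have e: "e > 0" using assms B by (simp add: e_def)
  have "v powr A \<le> exp \<bar>B * ln e\<bar> * exp (a * v powr r)" if "v \<ge> 1" for v
  proof -
    define y where "y = v powr r"
    have y: "y > 0" using that by (simp add: y_def)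
    have "ln (e * y) \<le> e * y" using ln_le_minus_one[of "e * y"] e y by simp
    then have "ln y \<le> e * y - ln e" using e y by (simp add: ln_mult)
    then have "B * ln y \<le> B * (e * y - ln e)" using B by (rule mult_left_mono)
    also have "\<dots> \<le> a * y + \<bar>B * ln e\<bar>"
    proof -
      have "B * e \<le> a" using B assms by (simp add: e_def field_simps)
      then have "B * e * y \<le> a * y" using y by (intro mult_right_mono) auto
      then show ?thesis by (simp add: algebra_simps)
    qed
    finally have "exp (B * ln y) \<le> exp (a * y + \<bar>B * ln e\<bar>)" by simp
    moreover have "exp (B * ln y) = v powr A" using that assms by (simp add: y_def B_def ln_powr powr_def)
    ultimately show ?thesis by (simp add: y_def exp_add mult.commute)
  qed
  then show ?thesis by (intro exI[of _ "exp \<bar>B * ln e\<bar>"]) auto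
qed

lemma equidistant_grid:
  fixes a s x :: real
  assumes "N \<ge> 2" "a \<le> x" "x \<le> a + (real N - 1) * s" "s \<ge> 0"
  shows "\<exists>i\<in>{1..N}. a + (real i - 1) * s \<le> x \<and> x \<le> a + (real i - 1) * s + s"
proof (cases "s = 0")
  case True
  then show ?thesis using assms by (intro bexI[of _ 1]) auto
next
  case False
  then have s: "s > 0" using assms by simp
  define k where "k = nat \<lfloor>(x - a) / s\<rfloor>"
  have q0: "0 \<le> (x - a) / s" using assms s by simp
  have k: "real k \<le> (x - a) / s" "(x - a) / s < real k + 1"
    unfolding k_def using q0 by (simp_all add: of_nat_nat)
  have "(x - a) / s \<le> real N - 1" using assms s by (simp add: field_simps)
  then have "real k \<le> real N - 1" using k by linarith
  then have kN: "k + 1 \<le> N" using assms by linarith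
  have "a + real k * s \<le> x" "x \<le> a + real k * s + s" using k s by (simp_all add: field_simps)
  then show ?thesis using kN by (intro bexI[of _ "k + 1"]) auto
qed

section \<open>The adaptive test\<close>

text \<open>The supremum of a nonempty finite set exceeds a bound only if a member does; over the
  empty set it would have no such meaning.\<close>

lemma adaptive_test_1:
  assumes "N1 n + N2 rl ru n \<ge> 1" and "adaptive_test g f0 \<sigma> rl ru \<beta>l \<beta>u c Cs n Y = 1"
  shows "\<exists>i\<in>{1..N1 n + N2 rl ru n}. cmod (test_stat g f0 n (bandwidth \<sigma> rl ru \<beta>l \<beta>u c n i) Y)
    * inverse (threshold_sq \<sigma> rl ru \<beta>l \<beta>u n i) > Cs"
proof -
  let ?S = "\<lambda>i. cmod (test_stat g f0 n (bandwidth \<sigma> rl ru \<beta>l \<beta>u c n i) Y) * inverse (threshold_sq \<sigma> rl ru \<beta>l \<beta>u n i)"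
  have "Cs < (SUP i\<in>{1..N1 n + N2 rl ru n}. ?S i)"
    using assms(2) unfolding adaptive_test_def by (rule contrapos_pp) (simp only: if_False zero_neq_one not_False_eq_True)
  moreover have "{1..N1 n + N2 rl ru n} \<noteq> {}" using assms(1) by simp
  moreover have "bdd_above (?S ` {1..N1 n + N2 rl ru n})" by (intro bdd_above_finite finite_imageI finite_atLeastAtMost)
  ultimately show ?thesis using less_cSUP_iff[of "{1..N1 n + N2 rl ru n}" ?S Cs] by blast
qed

lemma adaptive_test_0:
  assumes "i \<in> {1..N1 n + N2 rl ru n}" and "adaptive_test g f0 \<sigma> rl ru \<beta>l \<beta>u c Cs n Y = 0"
  shows "cmod (test_stat g f0 n (bandwidth \<sigma> rl ru \<beta>l \<beta>u c n i) Y)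
    * inverse (threshold_sq \<sigma> rl ru \<beta>l \<beta>u n i) \<le> Cs"
proof -
  let ?S = "\<lambda>i. cmod (test_stat g f0 n (bandwidth \<sigma> rl ru \<beta>l \<beta>u c n i) Y) * inverse (threshold_sq \<sigma> rl ru \<beta>l \<beta>u n i)"
  have "?S i \<le> (SUP i\<in>{1..N1 n + N2 rl ru n}. ?S i)"
    by (rule cSUP_upper[OF assms(1)]) (intro bdd_above_finite finite_imageI finite_atLeastAtMost)
  also have "\<dots> \<le> Cs" using assms(2) unfolding adaptive_test_def
    by (rule contrapos_pp) (simp only: not_le if_True one_neq_zero not_False_eq_True)
  finally show ?thesis .
qed

text \<open>The constants \<open>C\<close> and \<open>b\<close> depend on the noise alone and
  therefore serve all densities at once.\<close>

locale noise =
  fixes g :: "real \<Rightarrow> real" and \<sigma> C b :: real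
  assumes g: "is_prob_density g" and g0: "\<And>u. fourier g u \<noteq> 0"
    and gi: "integrable lborel (\<lambda>u. cmod (fourier g u))"
    and \<sigma>: "1 < \<sigma>" and C: "C \<ge> 1"
    and gK: "\<And>T u. T \<ge> 1 \<Longrightarrow> \<bar>u\<bar> \<le> T \<Longrightarrow> 1 / cmod (fourier g u) \<le> C * T powr \<sigma>"
    and b: "b = (LINT u|lborel. cmod (fourier g u))" "b > 0"
begin

lemma deconv:
  assumes f: "is_prob_density f" and h: "h > 0" "1 / h \<ge> 1"
  shows "deconvolution (law g f) (fourier f) (kernel_ft g h) (1 / h) (C * (1 / h) powr \<sigma>) b"
proof (rule deconvolution_law[OF f g g0 gi h(1) _ gK[OF h(2)] b])
  show "1 \<le> C * (1 / h) powr \<sigma>"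
    using mult_mono[of 1 C 1 "(1 / h) powr \<sigma>"] ge_one_powr_ge_zero[of "1 / h" \<sigma>] C h \<sigma> by simp
qed

text \<open>Source of the exponent 4 * \<sigma> + 1 in the rates: one power of the cut-off from the
  length of the band, four from the multiplier.\<close>

lemma K4: "T > 0 \<Longrightarrow> b * T * (C * T powr \<sigma>) ^ 4 = b * C ^ 4 * T powr (4 * \<sigma> + 1)"
proof -
  assume T: "T > 0"
  have "(T powr \<sigma>) ^ 4 = (T powr \<sigma>) powr real 4" using T by (subst powr_realpow) auto
  also have "\<dots> = T powr (4 * \<sigma>)" by (simp add: powr_powr mult.commute)
  finally have "(T powr \<sigma>) ^ 4 = T powr (4 * \<sigma>)" .
  moreover have "T powr (4 * \<sigma> + 1) = T powr (4 * \<sigma>) * T" using T by (simp add: powr_add)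
  ultimately show ?thesis by (simp only: power_mult_distrib ac_simps)
qed

text \<open>Condition \<open>k\<close> compares the threshold with the standard deviation: n * t is
  at least (1 / h) powr ((4 * \<sigma> + 1) / 2) times sqrt (\<kappa> * \<rho>), with \<rho> an
  iterated logarithm. Condition \<gamma> on the critical value then makes the Gaussian exponent at
  least 2 * \<rho>; the factor 2 leaves room for the union over the grid.\<close>

lemma level_bound:
  assumes f0: "is_prob_density f0" "integrable lborel (\<lambda>x. (f0 x)\<^sup>2)" and n: "n \<ge> 2"
    and h: "h > 0" "1 / h \<ge> 1" "1 / h \<le> real n" and t: "t > 0" and Cs: "Cs > 0" and B0: "tail_energy f0 h \<le> Cs * t / 2"
    and k: "\<kappa> * (1 / h) powr (4 * \<sigma> + 1) * \<rho> \<le> (real n)\<^sup>2 * t\<^sup>2"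
    and \<gamma>: "2 * (384 * b * C ^ 4) \<le> Cs\<^sup>2 * \<kappa>" and \<rho>: "\<rho> \<ge> 0"
  shows "emeasure (obs_law g n f0) {Y \<in> space (obs_law g n f0). cmod (test_stat g f0 n h Y) * inverse t > Cs}
    \<le> ennreal (2 * (exp (- 2 * \<rho>) + (4 * b / (1 / h) + (4 / (9 * real n * b) + 1 / (3 * real n)))))"
    and "{Y \<in> space (obs_law g n f0). cmod (test_stat g f0 n h Y) * inverse t > Cs} \<in> sets (obs_law g n f0)"
proof -
  note D = deconv[OF f0(1) h(1,2)]
  note lev = single_test_level[OF D f0 n t Cs B0]
  interpret D: deconvolution "law g f0" "fourier f0" "kernel_ft g h" "1 / h" "C * (1 / h) powr \<sigma>" b by (rule D)
  interpret Y: prob_space "obs_law g n f0" unfolding obs_law_iid by (rule D.prob_space_iid)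
  have T: "1 / h > 0" using h by simp
  have n0: "real n > 0" using n by simp
  have P: "(1 / h) powr (4 * \<sigma> + 1) > 0" using T by simp
  have e: "2 * \<rho> \<le> (Cs * t)\<^sup>2 * (real n)\<^sup>2 / (384 * (b * (1 / h) * (C * (1 / h) powr \<sigma>) ^ 4))"
  proof -
    have "2 * \<rho> * (384 * (b * C ^ 4 * (1 / h) powr (4 * \<sigma> + 1))) = 2 * (384 * b * C ^ 4) * (\<rho> * (1 / h) powr (4 * \<sigma> + 1))"
      by (simp only: ac_simps)
    also have "\<dots> \<le> Cs\<^sup>2 * \<kappa> * (\<rho> * (1 / h) powr (4 * \<sigma> + 1))"
      using \<rho> P by (intro mult_right_mono \<gamma>) auto
    also have "\<dots> = Cs\<^sup>2 * (\<kappa> * (1 / h) powr (4 * \<sigma> + 1) * \<rho>)" by (simp only: ac_simps)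
    also have "\<dots> \<le> Cs\<^sup>2 * ((real n)\<^sup>2 * t\<^sup>2)" by (intro mult_left_mono k) auto
    finally have "2 * \<rho> * (384 * (b * C ^ 4 * (1 / h) powr (4 * \<sigma> + 1))) \<le> (Cs * t)\<^sup>2 * (real n)\<^sup>2"
      by (simp add: power_mult_distrib ac_simps)
    moreover have "384 * (b * C ^ 4 * (1 / h) powr (4 * \<sigma> + 1)) > 0" using b C P by simp
    ultimately show ?thesis unfolding K4[OF T] by (simp only: pos_le_divide_eq)
  qed
  \<comment> \<open>The cut-off is at most n, that is n * h \<ge> 1, which turns the term with n^2 *
    h into one of order 1 / n.\<close>
  have hn: "4 / (9 * (real n)\<^sup>2 * b * h) \<le> 4 / (9 * real n * b)"
  proof -
    have "1 \<le> real n * h" using h n0 by (simp add: field_simps)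
    then have "9 * real n * b * 1 \<le> 9 * real n * b * (real n * h)" using b n0 by (intro mult_left_mono) auto
    then have "4 / (9 * real n * b * (real n * h)) \<le> 4 / (9 * real n * b)"
      using b(2) n0 h(1) by (intro divide_left_mono) simp_all
    moreover have "9 * real n * b * (real n * h) = 9 * (real n)\<^sup>2 * b * h"
      by (simp only: power2_eq_square ac_simps)
    ultimately show ?thesis by (simp only:)
  qed
  have "measure (obs_law g n f0) {Y \<in> space (obs_law g n f0). cmod (test_stat g f0 n h Y) * inverse t > Cs}
    \<le> 2 * (exp (- (Cs * t)\<^sup>2 * (real n)\<^sup>2 / (384 * (b * (1 / h) * (C * (1 / h) powr \<sigma>) ^ 4)))
        + (4 * b * h + 4 / (9 * (real n)\<^sup>2 * b * h) + 1 / (3 * real n)))" by (rule lev(2))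
  also have "\<dots> \<le> 2 * (exp (- 2 * \<rho>) + (4 * b / (1 / h) + (4 / (9 * real n * b) + 1 / (3 * real n))))"
  proof -
    have A: "exp (- (Cs * t)\<^sup>2 * (real n)\<^sup>2 / (384 * (b * (1 / h) * (C * (1 / h) powr \<sigma>) ^ 4))) \<le> exp (- 2 * \<rho>)"
      unfolding exp_le_cancel_iff minus_mult_left[symmetric] minus_divide_left[symmetric] neg_le_iff_le using e .
    have E: "4 * b / (1 / h) = 4 * b * h" by simp
    show ?thesis unfolding E add.assoc by (intro mult_left_mono add_mono order_refl A hn) simp
  qed
  finally show "emeasure (obs_law g n f0) {Y \<in> space (obs_law g n f0). cmod (test_stat g f0 n h Y) * inverse t > Cs}
    \<le> ennreal (2 * (exp (- 2 * \<rho>) + (4 * b / (1 / h) + (4 / (9 * real n * b) + 1 / (3 * real n)))))"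
    unfolding Y.emeasure_eq_measure by (rule ennreal_leI)
qed (rule single_test_level(1)[OF deconv[OF f0(1) h(1,2)] f0 n t Cs B0])

text \<open>Since t \<le> \<mu>, condition \<open>k\<close> gives n * \<mu> \<ge> sqrt (\<kappa> * P
  * \<rho>) with P = (1 / h) powr (4 * \<sigma> + 1). The squared multiplier bound is at most C^2 *
  sqrt P because 2 * \<sigma> \<le> (4 * \<sigma> + 1) / 2, so P cancels in both terms of
  \<open>single_test_power\<close>.\<close>

lemma power_bound:
  assumes f: "is_prob_density f" and f0: "is_prob_density f0" "integrable lborel (\<lambda>x. (f0 x)\<^sup>2)" and n: "n \<ge> 2"
    and h: "h > 0" "1 / h \<ge> 1" and t: "t > 0" and Cs: "Cs > 0"
    and \<mu>: "core_energy f f0 h \<ge> \<mu>" "\<mu> > 0" "Cs * t < \<mu> / 2" "t \<le> \<mu>"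
    and k: "\<kappa> * (1 / h) powr (4 * \<sigma> + 1) * \<rho> \<le> (real n)\<^sup>2 * t\<^sup>2" "\<kappa> > 0" and \<rho>: "\<rho> > 0"
  shows "emeasure (obs_law g n f) {Y \<in> space (obs_law g n f). cmod (test_stat g f0 n h Y) * inverse t \<le> Cs}
    \<le> ennreal (64 * (b * C\<^sup>2) / sqrt (\<kappa> * \<rho>) + 256 * (b * C ^ 4) / (\<kappa> * \<rho>))"
    and "{Y \<in> space (obs_law g n f). cmod (test_stat g f0 n h Y) * inverse t \<le> Cs} \<in> sets (obs_law g n f)"
proof -
  note D = deconv[OF f h]
  note pow = single_test_power[OF D f0 n t Cs \<mu>(1-3)]
  interpret D: deconvolution "law g f" "fourier f" "kernel_ft g h" "1 / h" "C * (1 / h) powr \<sigma>" b by (rule D)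
  interpret Y: prob_space "obs_law g n f" unfolding obs_law_iid by (rule D.prob_space_iid)
  have T: "1 / h > 0" using h by simp
  have n0: "real n > 0" using n by simp
  define P where "P = (1 / h) powr (4 * \<sigma> + 1)"
  have P: "P > 0" using T by (simp add: P_def)
  have q: "\<kappa> * P * \<rho> \<le> (real n * \<mu>)\<^sup>2"
  proof -
    have "\<kappa> * P * \<rho> \<le> (real n)\<^sup>2 * t\<^sup>2" using k by (simp add: P_def)
    also have "\<dots> \<le> (real n)\<^sup>2 * \<mu>\<^sup>2" using t \<mu>(4) by (intro mult_left_mono power_mono) auto
    finally show ?thesis by (simp add: power_mult_distrib)
  qed
  have kp: "\<kappa> * P * \<rho> > 0" using k P \<rho> by simp
  have sq: "sqrt (\<kappa> * P * \<rho>) \<le> real n * \<mu>"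
    using real_sqrt_le_mono[OF q] n0 \<mu>(2) by (simp add: abs_mult)
  have K2: "(C * (1 / h) powr \<sigma>)\<^sup>2 \<le> C\<^sup>2 * sqrt P"
  proof -
    have "((1 / h) powr \<sigma>)\<^sup>2 = (1 / h) powr (2 * \<sigma>)" using T by (simp add: powr_power mult.commute)
    also have "\<dots> \<le> (1 / h) powr ((4 * \<sigma> + 1) / 2)" using h by (intro powr_mono) auto
    also have "\<dots> = sqrt P" using T unfolding P_def by (simp add: powr_half_sqrt[symmetric] powr_powr)
    finally show ?thesis by (simp add: power_mult_distrib mult_left_mono)
  qed
  have 1: "64 * (b * (C * (1 / h) powr \<sigma>)\<^sup>2) / (real n * \<mu>) \<le> 64 * (b * C\<^sup>2) / sqrt (\<kappa> * \<rho>)"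
  proof -
    have "64 * (b * (C * (1 / h) powr \<sigma>)\<^sup>2) / (real n * \<mu>) \<le> 64 * (b * (C\<^sup>2 * sqrt P)) / sqrt (\<kappa> * P * \<rho>)"
      using K2 b sq kp P n0 \<mu> by (intro frac_le mult_left_mono) auto
    also have "\<dots> = 64 * (b * C\<^sup>2) / sqrt (\<kappa> * \<rho>)"
      using P k \<rho> by (simp add: real_sqrt_mult field_simps)
    finally show ?thesis .
  qed
  have 2: "256 * (b * (1 / h) * (C * (1 / h) powr \<sigma>) ^ 4) / ((real n)\<^sup>2 * \<mu>\<^sup>2) \<le> 256 * (b * C ^ 4) / (\<kappa> * \<rho>)"
  proof -
    have "256 * (b * (1 / h) * (C * (1 / h) powr \<sigma>) ^ 4) / ((real n)\<^sup>2 * \<mu>\<^sup>2) \<le> 256 * (b * C ^ 4 * P) / (\<kappa> * P * \<rho>)"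
      unfolding K4[OF T] P_def[symmetric] power_mult_distrib[symmetric] using b(2) C P
      by (intro divide_left_mono q mult_pos_pos[OF order_less_le_trans[OF kp q] kp]) simp
    also have "\<dots> = 256 * (b * C ^ 4) / (\<kappa> * \<rho>)" using P by simp
    finally show ?thesis .
  qed
  show "emeasure (obs_law g n f) {Y \<in> space (obs_law g n f). cmod (test_stat g f0 n h Y) * inverse t \<le> Cs}
    \<le> ennreal (64 * (b * C\<^sup>2) / sqrt (\<kappa> * \<rho>) + 256 * (b * C ^ 4) / (\<kappa> * \<rho>))"
    unfolding Y.emeasure_eq_measure by (rule ennreal_leI) (use pow(2) 1 2 in linarith)
qed (rule single_test_power(1)[OF deconv[OF f h] f0 n t Cs \<mu>(1-3)])

end

text \<open>Collects what is asked of a single n: iterated logarithms at least 1, cut-offs between 1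
  and n, and enough points on the r-grid for its spacing to be defined. The estimates on the grids
  are then made for a fixed n.\<close>

definition large :: "real \<Rightarrow> real \<Rightarrow> real \<Rightarrow> nat \<Rightarrow> bool" where
  "large rl ru c n \<longleftrightarrow> n \<ge> 3 \<and> ln n \<ge> 2 \<and> ln (ln n) \<ge> 1 \<and> ln (ln (ln n)) \<ge> 1 \<and> ln (ln n) \<le> n
     \<and> ln n / (2 * c) \<ge> 1 \<and> (ln n / (2 * c)) powr (1 / rl) \<le> n \<and> (rl < ru \<longrightarrow> ln (ln n) / (ru - rl) \<ge> 2)"

lemma eventually_large:
  assumes "rl > 0" "c > 0"
  shows "eventually (large rl ru c) at_top"
proof -
  have "\<forall>\<^sub>F n::nat in at_top. n \<ge> 3" by real_asymp
  moreover have "\<forall>\<^sub>F n::nat in at_top. ln (real n) \<ge> 2" by real_asymp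
  moreover have "\<forall>\<^sub>F n::nat in at_top. ln (ln (real n)) \<ge> 1" by real_asymp
  moreover have "\<forall>\<^sub>F n::nat in at_top. ln (ln (ln (real n))) \<ge> 1" by real_asymp
  moreover have "\<forall>\<^sub>F n::nat in at_top. ln (ln (real n)) \<le> real n" by real_asymp
  moreover have "\<forall>\<^sub>F n::nat in at_top. ln (real n) / (2 * c) \<ge> 1" using assms by real_asymp
  moreover have "\<forall>\<^sub>F n::nat in at_top. (ln (real n) / (2 * c)) powr (1 / rl) \<le> real n" using assms by real_asymp
  moreover have "\<forall>\<^sub>F n::nat in at_top. rl < ru \<longrightarrow> ln (ln (real n)) / (ru - rl) \<ge> 2"
  proof (cases "rl < ru")
    case True
    have "\<forall>\<^sub>F n::nat in at_top. ln (ln (real n)) / d \<ge> 2" if "d > 0" for d :: real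
      using that by real_asymp
    from this[of "ru - rl"] True show ?thesis by (auto elim: eventually_mono)
  qed simp
  ultimately show ?thesis by eventually_elim (simp add: large_def)
qed

section \<open>Bandwidths, thresholds and the choice of a grid point\<close>

lemma powr_square: "(x powr a)\<^sup>2 = x powr (2 * a)" for x a :: real
  by (simp add: power2_eq_square flip: powr_add)

locale grid =
  fixes \<sigma> rl ru \<beta>l \<beta>u c :: real and n :: nat
  assumes \<sigma>: "1 < \<sigma>" and r: "0 < rl" "rl \<le> ru" "ru \<le> 2" and \<beta>: "0 \<le> \<beta>l" "\<beta>l \<le> \<beta>u" and c: "c > 0"
    and large: "large rl ru c n"
begin

abbreviation "ll \<equiv> ln (ln (real n))"
abbreviation "lll \<equiv> ln (ln (ln (real n)))"
abbreviation "h \<equiv> bandwidth \<sigma> rl ru \<beta>l \<beta>u c n"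
abbreviation "t \<equiv> threshold_sq \<sigma> rl ru \<beta>l \<beta>u n"
text \<open>Lower bound for (2 * c) powr ((4 * \<sigma> + 1) / R), valid for all R \<ge> rl. It
  makes up for the thresholds of the r-grid being powers of ln n, while the bandwidths are powers of
  ln n / (2 * c).\<close>

abbreviation "\<kappa> \<equiv> min 1 (2 * c) powr ((4 * \<sigma> + 1) / rl)"

lemma big: "real n \<ge> 3" "ln (real n) \<ge> 2" "ll \<ge> 1" "lll \<ge> 1" "ll \<le> real n" "ln (real n) / (2 * c) \<ge> 1"
  "(ln (real n) / (2 * c)) powr (1 / rl) \<le> real n" "rl < ru \<Longrightarrow> ll / (ru - rl) \<ge> 2"
  using large unfolding large_def by auto

lemma lll_le: "lll \<le> ll"
  using ln_le_minus_one[of ll] big(3) by linarith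

lemma N1: "N1 n \<ge> 2" "ln (real n) \<le> real (N1 n)" "real (N1 n) \<le> ln (real n) + 1"
  using big(2) unfolding N1_def by linarith+

lemma \<kappa>_pos: "\<kappa> > 0" "\<kappa> \<le> 1"
  using c r \<sigma> by (auto intro!: powr_le1 divide_nonneg_pos)

definition "\<rho> = real n / sqrt ll"

lemma \<rho>: "\<rho> \<ge> 1" "\<rho>\<^sup>2 \<ge> real n" "\<rho> \<le> real n" "(real n)\<^sup>2 = ll * \<rho>\<^sup>2"
proof -
  have s: "sqrt ll \<ge> 1" using big(3) by simp
  have l0: "ll > 0" using big(3) by simp
  show 1: "(real n)\<^sup>2 = ll * \<rho>\<^sup>2" using l0 by (simp add: \<rho>_def power_divide)
  show "\<rho> \<le> real n" using s by (simp add: \<rho>_def divide_le_eq mult_le_cancel_left1)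
  have "real n * ll \<le> real n * real n" using big(5) by (intro mult_left_mono) auto
  then have "real n * ll \<le> \<rho>\<^sup>2 * ll" using 1 by (simp add: power2_eq_square mult.commute)
  then show 2: "\<rho>\<^sup>2 \<ge> real n" using l0 by simp
  have "1\<^sup>2 \<le> \<rho>\<^sup>2" using 2 big(1) by simp
  then show "\<rho> \<ge> 1" by (rule power2_le_imp_le) (auto simp: \<rho>_def big intro!: divide_nonneg_nonneg order_trans[OF zero_le_one big(3)])
qed

lemma \<beta>_grid_bounds: "i \<in> {1..N1 n} \<Longrightarrow> \<beta>_grid \<beta>l \<beta>u n i \<in> {\<beta>l..\<beta>u}"
proof -
  assume i: "i \<in> {1..N1 n}"
  have N: "real (N1 n) - 1 > 0" using N1(1) by simp
  have "(real i - 1) * ((\<beta>u - \<beta>l) / (real (N1 n) - 1)) \<le> (real (N1 n) - 1) * ((\<beta>u - \<beta>l) / (real (N1 n) - 1))"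
    using i N \<beta> by (intro mult_right_mono divide_nonneg_pos) auto
  moreover have "0 \<le> (real i - 1) * ((\<beta>u - \<beta>l) / (real (N1 n) - 1))"
    using i N \<beta> by (intro mult_nonneg_nonneg divide_nonneg_pos) auto
  ultimately show ?thesis using N unfolding \<beta>_grid_def by auto
qed

text \<open>The bandwidth balances bias and noise: t is the squared bias (1 / h) powr (- 2 * B), and
  by the last identity n * t equals (1 / h) powr ((4 * \<sigma> + 1) / 2), the order of the noise,
  times sqrt (ln (ln n)). The lower bound on the cut-off uses \<rho>^2 \<ge> n.\<close>

lemma \<beta>_facts:
  assumes i: "i \<in> {1..N1 n}"
  defines "B \<equiv> \<beta>_grid \<beta>l \<beta>u n i"
  shows "h i > 0" "1 / h i = \<rho> powr (2 / (4 * B + 4 * \<sigma> + 1))" "1 / h i \<ge> 1" "1 / h i \<le> real n"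
    "1 / h i \<ge> real n powr (1 / (4 * \<beta>u + 4 * \<sigma> + 1))" "t i > 0" "t i = (1 / h i) powr (- 2 * B)"
    "(1 / h i) powr (4 * \<sigma> + 1) * ll = (real n)\<^sup>2 * (t i)\<^sup>2"
proof -
  let ?D = "4 * B + 4 * \<sigma> + 1"
  have B: "0 \<le> B" "B \<le> \<beta>u" using \<beta>_grid_bounds[OF i] \<beta> by (auto simp: B_def)
  have D: "?D > 5" using B \<sigma> by simp
  have h: "h i = \<rho> powr (- 2 / ?D)" using i by (simp add: bandwidth_def \<rho>_def B_def)
  have t: "t i = \<rho> powr (- 4 * B / ?D)" using i by (simp add: threshold_sq_def \<rho>_def B_def)
  have r0: "\<rho> > 0" using \<rho>(1) by simp
  show "h i > 0" using r0 by (simp add: h)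
  show 1: "1 / h i = \<rho> powr (2 / ?D)" unfolding h by (simp add: powr_minus divide_inverse flip: powr_minus)
  show "1 / h i \<ge> 1" unfolding 1 using \<rho>(1) D by (intro ge_one_powr_ge_zero) auto
  have "\<rho> powr (2 / ?D) \<le> \<rho> powr 1" using \<rho>(1) D by (intro powr_mono) auto
  then show "1 / h i \<le> real n" unfolding 1 using \<rho> r0 by simp
  have "real n powr (1 / (4 * \<beta>u + 4 * \<sigma> + 1)) \<le> real n powr (1 / ?D)"
    using big(1) B D by (intro powr_mono divide_left_mono mult_pos_pos) auto
  also have "\<dots> \<le> (\<rho>\<^sup>2) powr (1 / ?D)" using D \<rho>(2) by (intro powr_mono2) auto
  also have "\<rho>\<^sup>2 = \<rho> powr 2" using r0 by simp
  also have "(\<rho> powr 2) powr (1 / ?D) = \<rho> powr (2 / ?D)" by (simp add: powr_powr)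
  finally show "1 / h i \<ge> real n powr (1 / (4 * \<beta>u + 4 * \<sigma> + 1))" unfolding 1 .
  show "t i > 0" using r0 by (simp add: t)
  show "t i = (1 / h i) powr (- 2 * B)" unfolding 1 t powr_powr by simp
  have "(1 / h i) powr (4 * \<sigma> + 1) = \<rho> powr (2 / ?D * (4 * \<sigma> + 1))" unfolding 1 by (rule powr_powr)
  moreover have "\<rho>\<^sup>2 * (t i)\<^sup>2 = \<rho> powr (2 + 2 * (- 4 * B / ?D))"
  proof -
    have "\<rho>\<^sup>2 = \<rho> powr 2" using r0 by simp
    then show ?thesis unfolding t powr_square powr_add by (simp only:)
  qed
  moreover have "2 + 2 * (- 4 * B / ?D) = 2 / ?D * (4 * \<sigma> + 1)"
    using D by (simp add: field_simps)
  ultimately show "(1 / h i) powr (4 * \<sigma> + 1) * ll = (real n)\<^sup>2 * (t i)\<^sup>2"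
    unfolding \<rho>(4) by (simp add: ac_simps)
qed

lemma N2_ge1: "N2 rl ru n \<ge> 1"
  unfolding N2_def using big(8) r(2) by (cases "rl = ru") (auto, linarith)

lemma N2_gt: "rl < ru \<Longrightarrow> N2 rl ru n \<ge> 2" "rl < ru \<Longrightarrow> ll / (ru - rl) \<le> real (N2 rl ru n)"
  "rl < ru \<Longrightarrow> real (N2 rl ru n) \<le> ll / (ru - rl) + 1"
  using big(8) unfolding N2_def by (auto) linarith+

lemma r_grid_bounds: "i \<in> {1..N2 rl ru n} \<Longrightarrow> r_grid rl ru n i \<in> {rl..ru}"
proof (cases "rl = ru")
  case True
  then show ?thesis by (simp add: r_grid_def)
next
  case False
  then have lt: "rl < ru" using r by simp
  assume i: "i \<in> {1..N2 rl ru n}"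
  have N: "real (N2 rl ru n) - 1 > 0" using N2_gt(1)[OF lt] by simp
  have "(real i - 1) * ((ru - rl) / (real (N2 rl ru n) - 1)) \<le> (real (N2 rl ru n) - 1) * ((ru - rl) / (real (N2 rl ru n) - 1))"
    using i N lt by (intro mult_right_mono divide_nonneg_pos) auto
  moreover have "0 \<le> (real i - 1) * ((ru - rl) / (real (N2 rl ru n) - 1))"
    using i N lt by (intro mult_nonneg_nonneg divide_nonneg_pos) auto
  ultimately show ?thesis using N unfolding r_grid_def by auto
qed

text \<open>The bandwidth solves exp (2 * c * (1 / h) powr R) = n, which makes biases of order 1 /
  n. As R \<le> 2, the cut-off is at least the square root of ln n / (2 * c).\<close>

lemma r_facts:
  assumes i: "i \<in> {1..N2 rl ru n}"
  defines "R \<equiv> r_grid rl ru n i" and "j \<equiv> N1 n + i" and "y \<equiv> ln (real n) / (2 * c)"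
  shows "h j > 0" "1 / h j = y powr (1 / R)" "1 / h j \<ge> 1" "1 / h j \<le> real n"
    "1 / h j \<ge> y powr (1 / 2)" "(1 / h j) powr R = y" "t j > 0"
    "t j = ln (real n) powr ((4 * \<sigma> + 1) / (2 * R)) / real n * sqrt lll"
    "\<kappa> * (1 / h j) powr (4 * \<sigma> + 1) * lll \<le> (real n)\<^sup>2 * (t j)\<^sup>2" "sqrt lll / real n \<le> t j"
proof -
  have R: "rl \<le> R" "R \<le> ru" "R > 0" "R \<le> 2" using r_grid_bounds[OF i] r by (auto simp: R_def)
  have y: "y \<ge> 1" using big(6) by (simp add: y_def)
  have j: "\<not> j \<le> N1 n" "j - N1 n = i" using i by (auto simp: j_def)
  have h: "h j = y powr (- 1 / R)" using j by (simp add: bandwidth_def y_def R_def)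
  show t: "t j = ln (real n) powr ((4 * \<sigma> + 1) / (2 * R)) / real n * sqrt lll"
    using j by (simp add: threshold_sq_def R_def)
  show "h j > 0" using y by (simp add: h)
  show 1: "1 / h j = y powr (1 / R)" unfolding h by (simp add: powr_minus divide_inverse flip: powr_minus)
  show "1 / h j \<ge> 1" unfolding 1 using y R by (intro ge_one_powr_ge_zero) auto
  have "y powr (1 / R) \<le> y powr (1 / rl)" using y R r by (intro powr_mono divide_left_mono mult_pos_pos) auto
  then show "1 / h j \<le> real n" unfolding 1 using big(7) by (simp add: y_def)
  show "1 / h j \<ge> y powr (1 / 2)" unfolding 1 using y R by (intro powr_mono divide_left_mono) auto
  show "(1 / h j) powr R = y" unfolding 1 powr_powr using R y by simp
  have ln0: "ln (real n) > 0" "real n > 0" "lll > 0" using big(1,2,4) by linarith+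
  show "t j > 0" unfolding t using ln0 by (intro mult_pos_pos divide_pos_pos) auto
  have ge1: "ln (real n) powr ((4 * \<sigma> + 1) / (2 * R)) \<ge> 1"
    using big(2) R \<sigma> by (intro ge_one_powr_ge_zero) auto
  show "sqrt lll / real n \<le> t j"
    unfolding t using mult_right_mono[OF divide_right_mono[OF ge1, of "real n"], of "sqrt lll"] ln0 by simp
  have "(real n)\<^sup>2 * (t j)\<^sup>2 = (ln (real n) powr ((4 * \<sigma> + 1) / (2 * R)))\<^sup>2 * lll"
    unfolding t using ln0 by (simp add: power_mult_distrib power_divide)
  also have "(ln (real n) powr ((4 * \<sigma> + 1) / (2 * R)))\<^sup>2 = ln (real n) powr ((4 * \<sigma> + 1) / R)"
    unfolding powr_square using R(3) by (intro arg_cong2[where f="(powr)"]) (simp_all add: field_simps)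
  also have "ln (real n) powr ((4 * \<sigma> + 1) / R) = ((2 * c) * y) powr ((4 * \<sigma> + 1) / R)" using c by (simp add: y_def)
  also have "((2 * c) * y) powr ((4 * \<sigma> + 1) / R) = (2 * c) powr ((4 * \<sigma> + 1) / R) * (1 / h j) powr (4 * \<sigma> + 1)"
    unfolding 1 powr_powr using c y by (simp add: powr_mult)
  finally have e: "(real n)\<^sup>2 * (t j)\<^sup>2 = (2 * c) powr ((4 * \<sigma> + 1) / R) * (1 / h j) powr (4 * \<sigma> + 1) * lll" .
  have "\<kappa> \<le> min 1 (2 * c) powr ((4 * \<sigma> + 1) / R)"
    using c R r \<sigma> by (intro powr_mono' divide_left_mono mult_pos_pos) auto
  also have "\<dots> \<le> (2 * c) powr ((4 * \<sigma> + 1) / R)"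
    using c R \<sigma> by (intro powr_mono2) auto
  finally show "\<kappa> * (1 / h j) powr (4 * \<sigma> + 1) * lll \<le> (real n)\<^sup>2 * (t j)\<^sup>2"
    unfolding e using ln0 by (intro mult_right_mono) auto
qed

text \<open>For a grid point at most one spacing below \<beta> the exponents of the two thresholds
  differ by at most the spacing, and n to the power of the spacing is bounded because the grid has
  at least ln n points.\<close>

lemma \<beta>_select:
  assumes "\<beta> \<in> {\<beta>l..\<beta>u}"
  shows "\<exists>i\<in>{1..N1 n}. \<beta>_grid \<beta>l \<beta>u n i \<le> \<beta> \<and> t i \<le> exp (2 * (\<beta>u - \<beta>l)) * \<rho> powr (- 4 * \<beta> / (4 * \<beta> + 4 * \<sigma> + 1))"
proof -
  let ?s = "(\<beta>u - \<beta>l) / (real (N1 n) - 1)"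
  have N: "real (N1 n) - 1 > 0" using N1(1) by simp
  have s0: "?s \<ge> 0" using N local.\<beta> by (intro divide_nonneg_pos) auto
  obtain i where i: "i \<in> {1..N1 n}" "\<beta>_grid \<beta>l \<beta>u n i \<le> \<beta>" "\<beta> \<le> \<beta>_grid \<beta>l \<beta>u n i + ?s"
    using equidistant_grid[of "N1 n" \<beta>l \<beta> ?s] N1(1) N s0 assms unfolding \<beta>_grid_def by auto
  define B where "B = \<beta>_grid \<beta>l \<beta>u n i"
  have B: "0 \<le> B" "B \<le> \<beta>" "\<beta> - B \<le> ?s" using \<beta>_grid_bounds[OF i(1)] local.\<beta> i by (auto simp: B_def)
  let ?D = "4 * B + 4 * \<sigma> + 1" and ?E = "4 * \<beta> + 4 * \<sigma> + 1"
  have D: "?D > 5" "?E > 5" using B \<sigma> by auto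
  have r0: "\<rho> > 0" using \<rho>(1) by simp
  have "4 * \<beta> / ?E - 4 * B / ?D = 4 * (\<beta> - B) * (4 * \<sigma> + 1) / (?E * ?D)"
    using D by (simp add: field_simps)
  \<comment> \<open>The first denominator exceeds 5, as \<sigma> > 1, and the second is at least 4 *
    \<sigma> + 1.\<close>
  also have "\<dots> \<le> 4 * (\<beta> - B) * (4 * \<sigma> + 1) / (5 * (4 * \<sigma> + 1))"
    using D B \<sigma> by (intro divide_left_mono mult_mono mult_nonneg_nonneg mult_pos_pos) auto
  also have "\<dots> = 4 / 5 * (\<beta> - B)" using \<sigma> by (simp add: field_simps)
  also have "\<dots> \<le> 1 * (\<beta> - B)" using B by (intro mult_right_mono) auto
  also have "\<dots> \<le> ?s" using B by simp
  finally have d: "4 * \<beta> / ?E - 4 * B / ?D \<le> ?s" .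
  have "t i = \<rho> powr ((4 * \<beta> / ?E - 4 * B / ?D) + (- 4 * \<beta> / ?E))"
    using i(1) by (simp add: threshold_sq_def \<rho>_def B_def)
  also have "\<dots> = \<rho> powr (4 * \<beta> / ?E - 4 * B / ?D) * \<rho> powr (- 4 * \<beta> / ?E)" by (rule powr_add)
  also have "\<rho> powr (4 * \<beta> / ?E - 4 * B / ?D) \<le> real n powr ?s"
    using d \<rho> s0 by (intro order_trans[OF powr_mono powr_mono2]) auto
  also have "real n powr ?s = exp (?s * ln (real n))" using big(1) by (simp add: powr_def)
  also have "?s * ln (real n) \<le> 2 * (\<beta>u - \<beta>l)"
  proof -
    have "ln (real n) \<le> 2 * (real (N1 n) - 1)" using N1(2) big(2) by argo
    then have "(\<beta>u - \<beta>l) * ln (real n) \<le> (\<beta>u - \<beta>l) * (2 * (real (N1 n) - 1))"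
      using local.\<beta> by (intro mult_left_mono) auto
    then show ?thesis using N by (simp add: field_simps)
  qed
  finally have "t i \<le> exp (2 * (\<beta>u - \<beta>l)) * \<rho> powr (- 4 * \<beta> / ?E)" by (simp add: mult_right_mono)
  then show ?thesis using i by blast
qed

text \<open>(ln n) powr z is exp (z * ln (ln n)), so moving r by a spacing of order 1 / ln (ln n)
  costs a bounded factor. If rl = ru, the single grid point is exact.\<close>

lemma r_select:
  assumes "x \<in> {rl..ru}"
  shows "\<exists>i\<in>{1..N2 rl ru n}. r_grid rl ru n i \<le> x \<and>
    t (N1 n + i) \<le> exp ((4 * \<sigma> + 1) * (ru - rl)\<^sup>2 / rl\<^sup>2) * (ln (real n) powr ((4 * \<sigma> + 1) / (2 * x)) / real n * sqrt lll)"
proof -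
  have "\<exists>i\<in>{1..N2 rl ru n}. r_grid rl ru n i \<le> x \<and> ll * (x - r_grid rl ru n i) \<le> 2 * (ru - rl)\<^sup>2"
  proof (cases "rl = ru")
    case True
    then show ?thesis using assms N2_ge1 by (intro bexI[of _ 1]) (auto simp: r_grid_def)
  next
    case False
    then have lt: "rl < ru" using r by simp
    let ?s = "(ru - rl) / (real (N2 rl ru n) - 1)"
    have N: "real (N2 rl ru n) - 1 > 0" using N2_gt(1)[OF lt] by simp
    have s0: "?s \<ge> 0" using N lt by (intro divide_nonneg_pos) auto
    obtain i where i: "i \<in> {1..N2 rl ru n}" "r_grid rl ru n i \<le> x" "x \<le> r_grid rl ru n i + ?s"
      using equidistant_grid[of "N2 rl ru n" rl x ?s] N2_gt(1)[OF lt] N s0 assms unfolding r_grid_def by auto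
    have "ll / (ru - rl) \<le> 2 * (real (N2 rl ru n) - 1)" proof -
      have "y \<le> 2 * (N - 1)" if "y \<le> N" "2 \<le> y" for y N :: real using that by argo
      from this[OF N2_gt(2)[OF lt] big(8)[OF lt]] show ?thesis .
    qed
    then have "ll \<le> 2 * (real (N2 rl ru n) - 1) * (ru - rl)" using lt by (simp add: pos_divide_le_eq)
    then have "ll * (ru - rl) \<le> 2 * (real (N2 rl ru n) - 1) * (ru - rl) * (ru - rl)" using lt by (intro mult_right_mono) auto
    then have "ll * ?s \<le> 2 * (ru - rl)\<^sup>2" using N by (simp add: field_simps power2_eq_square)
    moreover have "ll * (x - r_grid rl ru n i) \<le> ll * ?s" using i big(3) by (intro mult_left_mono) auto
    ultimately show ?thesis using i by (intro bexI[of _ i]) auto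
  qed
  then obtain i where i: "i \<in> {1..N2 rl ru n}" "r_grid rl ru n i \<le> x" "ll * (x - r_grid rl ru n i) \<le> 2 * (ru - rl)\<^sup>2" by blast
  define R where "R = r_grid rl ru n i"
  have R: "rl \<le> R" "R > 0" "R \<le> x" using r_grid_bounds[OF i(1)] r i by (auto simp: R_def)
  have ln0: "ln (real n) > 0" "real n > 0" "lll > 0" using big(1,2,4) by linarith+
  let ?a = "4 * \<sigma> + 1"
  have "(?a / (2 * R) - ?a / (2 * x)) * ll = ?a / 2 * (ll * (x - R)) / (R * x)"
    using R by (simp add: field_simps)
  also have "\<dots> \<le> ?a / 2 * (2 * (ru - rl)\<^sup>2) / (rl * rl)"
  proof (rule frac_le)
    show "?a / 2 * (ll * (x - R)) \<le> ?a / 2 * (2 * (ru - rl)\<^sup>2)"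
      using i(3) \<sigma> unfolding R_def[symmetric] by (intro mult_left_mono) auto
    show "rl * rl \<le> R * x" using R r by (intro mult_mono) auto
  qed (use r \<sigma> in auto)
  finally have d: "(?a / (2 * R) - ?a / (2 * x)) * ll \<le> ?a * (ru - rl)\<^sup>2 / rl\<^sup>2" by (simp add: power2_eq_square)
  have "ln (real n) powr (?a / (2 * R)) = ln (real n) powr ((?a / (2 * R) - ?a / (2 * x)) + ?a / (2 * x))" by simp
  also have "\<dots> = ln (real n) powr (?a / (2 * R) - ?a / (2 * x)) * ln (real n) powr (?a / (2 * x))" by (rule powr_add)
  also have "ln (real n) powr (?a / (2 * R) - ?a / (2 * x)) = exp ((?a / (2 * R) - ?a / (2 * x)) * ll)" using ln0 by (simp add: powr_def)
  also have "\<dots> \<le> exp (?a * (ru - rl)\<^sup>2 / rl\<^sup>2)" using d by simp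
  finally have "ln (real n) powr (?a / (2 * R)) \<le> exp (?a * (ru - rl)\<^sup>2 / rl\<^sup>2) * ln (real n) powr (?a / (2 * x))"
    by (simp add: mult_right_mono)
  then have "ln (real n) powr (?a / (2 * R)) / real n * sqrt lll \<le> exp (?a * (ru - rl)\<^sup>2 / rl\<^sup>2) * ln (real n) powr (?a / (2 * x)) / real n * sqrt lll"
    using ln0 by (intro mult_right_mono divide_right_mono) auto
  then have "t (N1 n + i) \<le> exp (?a * (ru - rl)\<^sup>2 / rl\<^sup>2) * (ln (real n) powr (?a / (2 * x)) / real n * sqrt lll)"
    unfolding r_facts(8)[OF i(1)] R_def by (simp add: mult.assoc)
  then show ?thesis using i(1,2) by blast
qed

end

text \<open>Meant for the null density: its class is exponential, so \<open>KA\<close> gives it a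
  polynomial bias of any order up to \<open>A\<close>. This lets the tests of the \<beta>-grid,
  designed for less smooth densities, keep their level.\<close>

lemma tail_energy_smoother:
  assumes f: "f \<in> smooth_class \<alpha> r \<beta> L" and L: "L \<ge> 0" and \<beta>: "\<beta> \<ge> 0" and K: "K \<ge> 1"
    and KA: "\<And>v. v \<ge> 1 \<Longrightarrow> v powr A \<le> K * exp (2 * \<alpha> * v powr r)"
    and B: "0 \<le> B" "B \<le> A" and h: "h > 0" "1 / h \<ge> 1"
  shows "tail_energy f h \<le> L * K * (1 / h) powr (- B)"
proof -
  have T: "(1 / h) powr B > 0" using h by simp
  have "tail_energy f h \<le> L / ((1 / h) powr B / K)"
  proof (rule tail_energy_le[OF f L _ h(1)])
    fix u :: real assume u': "\<bar>u\<bar> > 1 / h"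
    then have u: "\<bar>u\<bar> > 1 / h" "\<bar>u\<bar> \<ge> 1" using h(2) by linarith+
    have "(1 / h) powr B \<le> \<bar>u\<bar> powr B" using u h B by (intro powr_mono2) auto
    also have "\<dots> \<le> \<bar>u\<bar> powr A" by (intro powr_mono B u(2))
    also have "\<dots> \<le> K * exp (2 * \<alpha> * \<bar>u\<bar> powr r)" by (rule KA[OF u(2)])
    finally have "(1 / h) powr B / K \<le> 1 * exp (2 * \<alpha> * \<bar>u\<bar> powr r)" using K by (simp add: field_simps)
    also have "\<dots> \<le> \<bar>u\<bar> powr (2 * \<beta>) * exp (2 * \<alpha> * \<bar>u\<bar> powr r)"
      using \<beta> by (intro mult_right_mono ge_one_powr_ge_zero u(2)) auto
    finally show "(1 / h) powr B / K \<le> \<bar>u\<bar> powr (2 * \<beta>) * exp (2 * \<alpha> * \<bar>u\<bar> powr r)" .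
  qed (use T K in simp)
  also have "\<dots> = L * K * (1 / h) powr (- B)" using T by (simp add: powr_minus field_simps)
  finally show ?thesis .
qed

text \<open>As R \<le> r and c \<le> \<alpha>, the weight of the class beyond 1 / h is at least exp
  (2 * c * (1 / h) powr R), which is x by the choice of the bandwidth. One bandwidth thus serves all
  smoother densities.\<close>

lemma tail_energy_exp:
  assumes f: "f \<in> smooth_class \<alpha> r \<beta> L" and L: "L \<ge> 0" and \<beta>: "\<beta> \<ge> 0" and c: "0 < c" "c \<le> \<alpha>"
    and R: "0 \<le> R" "R \<le> r" and h: "h > 0" "1 / h \<ge> 1" and y: "(1 / h) powr R = ln x / (2 * c)" and x: "x > 0"
  shows "tail_energy f h \<le> L / x"
proof (rule tail_energy_le[OF f L x h(1)])
  fix u :: real assume u': "\<bar>u\<bar> > 1 / h"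
  then have u: "\<bar>u\<bar> > 1 / h" "\<bar>u\<bar> \<ge> 1" using h(2) by linarith+
  have "(1 / h) powr R \<le> \<bar>u\<bar> powr R" using u h R by (intro powr_mono2) auto
  also have "\<dots> \<le> \<bar>u\<bar> powr r" by (intro powr_mono R u(2))
  finally have 1: "(1 / h) powr R \<le> \<bar>u\<bar> powr r" .
  have "x = exp (2 * c * (1 / h) powr R)" unfolding y using c x by simp
  also have "\<dots> \<le> 1 * exp (2 * \<alpha> * \<bar>u\<bar> powr r)"
  proof -
    have "2 * c * (1 / h) powr R \<le> 2 * \<alpha> * \<bar>u\<bar> powr r" using 1 c by (intro mult_mono) auto
    then show ?thesis by simp
  qed
  also have "\<dots> \<le> \<bar>u\<bar> powr (2 * \<beta>) * exp (2 * \<alpha> * \<bar>u\<bar> powr r)"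
    using \<beta> by (intro mult_right_mono ge_one_powr_ge_zero u(2)) auto
  finally show "x \<le> \<bar>u\<bar> powr (2 * \<beta>) * exp (2 * \<alpha> * \<bar>u\<bar> powr r)" .
qed

lemma tail_energy_poly:
  assumes f: "f \<in> smooth_class \<alpha> r \<beta> L" and L: "L \<ge> 0" and \<beta>: "\<beta> \<ge> 0" and \<alpha>: "0 \<le> \<alpha>"
    and h: "h > 0"
  shows "tail_energy f h \<le> L * (1 / h) powr (- 2 * \<beta>)"
proof -
  have "tail_energy f h \<le> L / ((1 / h) powr (2 * \<beta>))"
  proof (rule tail_energy_le[OF f L _ h])
    fix u :: real assume u: "\<bar>u\<bar> > 1 / h"
    have "(1 / h) powr (2 * \<beta>) * 1 \<le> \<bar>u\<bar> powr (2 * \<beta>) * exp (2 * \<alpha> * \<bar>u\<bar> powr r)"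
      using u h \<beta> \<alpha> by (intro mult_mono powr_mono2) auto
    then show "(1 / h) powr (2 * \<beta>) \<le> \<bar>u\<bar> powr (2 * \<beta>) * exp (2 * \<alpha> * \<bar>u\<bar> powr r)" by simp
  qed (use h in simp)
  also have "\<dots> = L * (1 / h) powr (- 2 * \<beta>)" by (simp add: powr_minus field_simps)
  finally show ?thesis .
qed

text \<open>Among the conditions on \<open>Cs\<close>, the second keeps the bias of
  \<open>f0\<close> on the \<beta>-grid below half of the critical value and the third yields the
  exponents of \<open>level_bound\<close>; \<open>lll_large\<close> does for the bias L / n on the
  r-grid what the second does on the \<beta>-grid.\<close>

locale testing = noise g \<sigma> C b + grid \<sigma> rl ru \<beta>l \<beta>u c n
  for g \<sigma> C b rl ru \<beta>l \<beta>u c n +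
  fixes f0 :: "real \<Rightarrow> real" and L \<alpha>u \<beta>0 Kf Cs :: real
  assumes L: "L > 0" and \<alpha>u: "c \<le> \<alpha>u" and \<beta>0: "\<beta>0 \<ge> 0" and f0: "f0 \<in> smooth_class \<alpha>u ru \<beta>0 L"
    and Kf: "Kf \<ge> 1" "\<And>v. v \<ge> 1 \<Longrightarrow> v powr (2 * \<beta>u) \<le> Kf * exp (2 * \<alpha>u * v powr ru)"
    and Cs: "Cs > 0" "2 * (L * Kf) \<le> Cs" "2 * (384 * b * C ^ 4) \<le> Cs\<^sup>2 * min 1 (2 * c) powr ((4 * \<sigma> + 1) / rl)"
    and lll_large: "2 * L \<le> Cs * sqrt (ln (ln (ln (real n))))"
begin

lemma f0_density: "is_prob_density f0" "integrable lborel (\<lambda>x. (f0 x)\<^sup>2)"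
  by (rule smooth_classD[OF f0])+

lemma tail_f0_poly:
  assumes "0 \<le> B" "B \<le> \<beta>u" "h' > 0" "1 / h' \<ge> 1"
  shows "tail_energy f0 h' \<le> L * Kf * (1 / h') powr (- 2 * B)"
  using tail_energy_smoother[OF f0 less_imp_le[OF L] \<beta>0 Kf, of "2 * B" h'] assms by simp

lemma tail_f0_exp:
  assumes i: "i \<in> {1..N2 rl ru n}"
  shows "tail_energy f0 (h (N1 n + i)) \<le> L / real n"
proof -
  have R: "0 \<le> r_grid rl ru n i" "r_grid rl ru n i \<le> ru" using r_grid_bounds[OF i] r by auto
  show ?thesis
    by (rule tail_energy_exp[OF f0 less_imp_le[OF L] \<beta>0 c \<alpha>u R r_facts(1)[OF i] r_facts(3)[OF i] r_facts(6)[OF i]])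
      (use big(1) in simp)
qed

text \<open>Bounds for the level of a single test in the \<open>\<beta>\<close>-grid and in the \<open>r\<close>-grid.\<close>

definition err\<beta> :: real where
  "err\<beta> = 2 * (exp (- 2 * ll) + (4 * b * real n powr (- (1 / (4 * \<beta>u + 4 * \<sigma> + 1))) + (4 / (9 * real n * b) + 1 / (3 * real n))))"

definition errr :: real where
  "errr = 2 * (exp (- 2 * lll) + (4 * b * (ln (real n) / (2 * c)) powr (- (1 / 2)) + (4 / (9 * real n * b) + 1 / (3 * real n))))"

abbreviation "reject i \<equiv> {Y \<in> space (obs_law g n f0). cmod (test_stat g f0 n (h i) Y) * inverse (t i) > Cs}"

lemma n2: "n \<ge> 2" using big(1) by simp

lemma inverse_le_powr:
  assumes "0 < (x::real)" "x powr p \<le> T"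
  shows "4 * b / T \<le> 4 * b * x powr (- p)"
proof -
  have "x powr p > 0" using assms by simp
  moreover have "T > 0" using \<open>x powr p > 0\<close> assms(2) by linarith
  ultimately have "4 * b / T \<le> 4 * b / x powr p" using assms(2) b(2) by (intro divide_left_mono mult_pos_pos) auto
  then show ?thesis by (simp add: powr_minus field_simps)
qed

lemma level_\<beta>:
  assumes i: "i \<in> {1..N1 n}"
  shows "emeasure (obs_law g n f0) (reject i) \<le> ennreal err\<beta>" "reject i \<in> sets (obs_law g n f0)"
proof -
  note bf = \<beta>_facts[OF i]
  define B where "B = \<beta>_grid \<beta>l \<beta>u n i"
  have B: "0 \<le> B" "B \<le> \<beta>u" using \<beta>_grid_bounds[OF i] \<beta> by (auto simp: B_def)
  have "tail_energy f0 (h i) \<le> L * Kf * t i"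
    using tail_f0_poly[OF B bf(1) bf(3)] bf(7) by (simp add: B_def)
  also have "\<dots> \<le> Cs / 2 * t i" using Cs(2) bf(6) by (intro mult_right_mono) auto
  finally have B0: "tail_energy f0 (h i) \<le> Cs * t i / 2" by simp
  have k: "1 * (1 / h i) powr (4 * \<sigma> + 1) * ll \<le> (real n)\<^sup>2 * (t i)\<^sup>2" using bf(8) by simp
  have cs: "2 * (384 * b * C ^ 4) \<le> Cs\<^sup>2 * 1" using Cs(3) mult_left_mono[OF \<kappa>_pos(2), of "Cs\<^sup>2"] by simp
  have l0: "0 \<le> ll" using big(3) by linarith
  note lev = level_bound[OF f0_density n2 bf(1) bf(3) bf(4) bf(6) Cs(1) B0 k cs l0]
  show "reject i \<in> sets (obs_law g n f0)" by (rule lev(2))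
  have "real n powr (1 / (4 * \<beta>u + 4 * \<sigma> + 1)) \<le> 1 / h i" using bf(5) .
  from inverse_le_powr[OF _ this] have I: "4 * b / (1 / h i) \<le> 4 * b * real n powr (- (1 / (4 * \<beta>u + 4 * \<sigma> + 1)))"
    using big(1) by linarith
  show "emeasure (obs_law g n f0) (reject i) \<le> ennreal err\<beta>"
    unfolding err\<beta>_def
    by (rule order_trans[OF lev(1)], rule ennreal_leI, intro mult_left_mono add_mono order_refl I) simp
qed

lemma level_r:
  assumes i: "i \<in> {1..N2 rl ru n}"
  shows "emeasure (obs_law g n f0) (reject (N1 n + i)) \<le> ennreal errr" "reject (N1 n + i) \<in> sets (obs_law g n f0)"
proof -
  note rf = r_facts[OF i]
  have n0: "real n > 0" using big(1) by simp
  have "tail_energy f0 (h (N1 n + i)) \<le> L / real n" by (rule tail_f0_exp[OF i])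
  also have "\<dots> \<le> Cs / 2 * (sqrt lll / real n)" using lll_large n0 by (simp add: field_simps)
  also have "\<dots> \<le> Cs / 2 * t (N1 n + i)" using rf(10) Cs(1) by (intro mult_left_mono) auto
  finally have B0: "tail_energy f0 (h (N1 n + i)) \<le> Cs * t (N1 n + i) / 2" by simp
  have l0: "0 \<le> lll" using big(4) by linarith
  note lev = level_bound[OF f0_density n2 rf(1) rf(3) rf(4) rf(7) Cs(1) B0 rf(9) Cs(3) l0]
  show "reject (N1 n + i) \<in> sets (obs_law g n f0)" by (rule lev(2))
  have "ln (real n) / (2 * c) > 0" using big(6) by linarith
  from inverse_le_powr[OF this rf(5)]
  have I: "4 * b / (1 / h (N1 n + i)) \<le> 4 * b * (ln (real n) / (2 * c)) powr (- (1 / 2))" .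
  show "emeasure (obs_law g n f0) (reject (N1 n + i)) \<le> ennreal errr"
    unfolding errr_def
    by (rule order_trans[OF lev(1)], rule ennreal_leI, intro mult_left_mono add_mono order_refl I) simp
qed

text \<open>Union bound over both grids. Measurability is shown for the covering union, which is
  what monotonicity of \<open>emeasure\<close> asks for.\<close>

lemma type_I_error:
  "emeasure (obs_law g n f0) {Y \<in> space (obs_law g n f0). adaptive_test g f0 \<sigma> rl ru \<beta>l \<beta>u c Cs n Y = 1}
    \<le> ennreal (real (N1 n) * err\<beta> + real (N2 rl ru n) * errr)"
proof -
  have e0: "0 \<le> err\<beta>" "0 \<le> errr" using b(2) by (auto simp: err\<beta>_def errr_def)
  have N: "N1 n + N2 rl ru n \<ge> 1" using N2_ge1 by simp
  let ?A1 = "\<Union>i\<in>{1..N1 n}. reject i" and ?A2 = "\<Union>i\<in>{1..N2 rl ru n}. reject (N1 n + i)"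
  have m: "?A1 \<in> sets (obs_law g n f0)" "?A2 \<in> sets (obs_law g n f0)"
    using level_\<beta>(2) level_r(2) by (intro sets.finite_UN; simp)+
  have "{Y \<in> space (obs_law g n f0). adaptive_test g f0 \<sigma> rl ru \<beta>l \<beta>u c Cs n Y = 1} \<subseteq> ?A1 \<union> ?A2"
  proof
    fix Y assume Y: "Y \<in> {Y \<in> space (obs_law g n f0). adaptive_test g f0 \<sigma> rl ru \<beta>l \<beta>u c Cs n Y = 1}"
    then obtain i where i: "i \<in> {1..N1 n + N2 rl ru n}" "Y \<in> reject i"
      using adaptive_test_1[OF N, of g f0 \<sigma> \<beta>l \<beta>u c Cs Y] by blast
    show "Y \<in> ?A1 \<union> ?A2"
    proof (cases "i \<le> N1 n")
      case True
      then show ?thesis using i by (intro UnI1 UN_I[of i]) auto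
    next
      case False
      then have "i - N1 n \<in> {1..N2 rl ru n}" "N1 n + (i - N1 n) = i" using i(1) by auto
      then show ?thesis using i(2) by (intro UnI2 UN_I[of "i - N1 n"]) simp_all
    qed
  qed
  then have "emeasure (obs_law g n f0) {Y \<in> space (obs_law g n f0). adaptive_test g f0 \<sigma> rl ru \<beta>l \<beta>u c Cs n Y = 1}
    \<le> emeasure (obs_law g n f0) (?A1 \<union> ?A2)" by (rule emeasure_mono) (use m in blast)
  also have "\<dots> \<le> emeasure (obs_law g n f0) ?A1 + emeasure (obs_law g n f0) ?A2"
    by (rule emeasure_subadditive[OF m])
  also have "\<dots> \<le> (\<Sum>i\<in>{1..N1 n}. emeasure (obs_law g n f0) (reject i)) + (\<Sum>i\<in>{1..N2 rl ru n}. emeasure (obs_law g n f0) (reject (N1 n + i)))"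
    using level_\<beta>(2) level_r(2) by (intro add_mono emeasure_subadditive_finite) auto
  also have "\<dots> \<le> (\<Sum>i\<in>{1..N1 n}. ennreal err\<beta>) + (\<Sum>i\<in>{1..N2 rl ru n}. ennreal errr)"
    by (intro add_mono sum_mono level_\<beta>(1) level_r(1))
  also have "\<dots> = ennreal (real (N1 n) * err\<beta> + real (N2 rl ru n) * errr)"
    using e0 by (simp add: ennreal_mult ennreal_of_nat_eq_real_of_nat)
  finally show ?thesis .
qed

text \<open>A bound free of \<open>f\<close>, so that it passes to the supremum over the
  alternative; it decays like the inverse square root of ln (ln (ln n)).\<close>

definition err_power :: real where
  "err_power = 64 * (b * C\<^sup>2) / sqrt (\<kappa> * lll) + 256 * (b * C ^ 4) / (\<kappa> * lll)"

text \<open>\<psi> stands for the squared rate. Half of the separation C1 * \<psi> absorbs the two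
  biases, and the other half, \<mu>, remains as core energy; the further conditions on
  \<open>C1\<close> put the critical value below \<mu> / 2 and the threshold at most at \<mu>.
  Acceptance by the adaptive test implies acceptance by the i-th test.\<close>

lemma type_II_error:
  assumes f: "is_prob_density f" "integrable lborel (\<lambda>x. (f x)\<^sup>2)" and i: "i \<in> {1..N1 n + N2 rl ru n}"
    and h: "h i > 0" "1 / h i \<ge> 1" and t: "t i > 0" "t i \<le> K * \<psi>"
    and k: "\<kappa> * (1 / h i) powr (4 * \<sigma> + 1) * lll \<le> (real n)\<^sup>2 * (t i)\<^sup>2"
    and tails: "tail_energy f (h i) \<le> B * \<psi>" "tail_energy f0 (h i) \<le> B * \<psi>"
    and sep: "C1 * \<psi> \<le> (L2_norm (\<lambda>x. f x - f0 x))\<^sup>2" and \<psi>: "\<psi> > 0"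
    and C1: "8 * B \<le> C1" "4 * (Cs * K) < C1" "2 * K \<le> C1" "0 < C1"
  shows "emeasure (obs_law g n f) {Y \<in> space (obs_law g n f). adaptive_test g f0 \<sigma> rl ru \<beta>l \<beta>u c Cs n Y = 0} \<le> ennreal err_power"
proof -
  define \<mu> where "\<mu> = C1 / 2 * \<psi>"
  have m0: "\<mu> > 0" using C1 \<psi> by (simp add: \<mu>_def)
  have "C1 * \<psi> \<le> core_energy f f0 (h i) + 2 * tail_energy f (h i) + 2 * tail_energy f0 (h i)"
    using sep energy_split[OF f f0_density, of "h i"] by linarith
  also have "\<dots> \<le> core_energy f f0 (h i) + 4 * B * \<psi>" using tails by linarith
  also have "4 * B * \<psi> \<le> \<mu>" unfolding \<mu>_def using C1(1) \<psi> by (intro mult_right_mono) auto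
  finally have m1: "core_energy f f0 (h i) \<ge> \<mu>" by (simp add: \<mu>_def)
  have "Cs * t i \<le> Cs * (K * \<psi>)" using t Cs(1) by (intro mult_left_mono) auto
  also have "\<dots> = (Cs * K) * \<psi>" by simp
  also have "\<dots> < C1 / 4 * \<psi>" using C1(2) \<psi> by (intro mult_strict_right_mono) auto
  finally have m2: "Cs * t i < \<mu> / 2" by (simp add: \<mu>_def)
  have "K * \<psi> \<le> \<mu>" unfolding \<mu>_def using C1(3) \<psi> by (intro mult_right_mono) auto
  then have m3: "t i \<le> \<mu>" using t(2) by linarith
  have l0: "0 < lll" using big(4) by linarith
  note pow = power_bound[OF f(1) f0_density n2 h t(1) Cs(1) m1 m0 m2 m3 k \<kappa>_pos(1) l0]
  have "emeasure (obs_law g n f) {Y \<in> space (obs_law g n f). adaptive_test g f0 \<sigma> rl ru \<beta>l \<beta>u c Cs n Y = 0}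
    \<le> emeasure (obs_law g n f) {Y \<in> space (obs_law g n f). cmod (test_stat g f0 n (h i) Y) * inverse (t i) \<le> Cs}"
    using adaptive_test_0[OF i] by (intro emeasure_mono[OF _ pow(2)]) blast
  also have "\<dots> \<le> ennreal err_power" unfolding err_power_def by (rule pow(1))
  finally show ?thesis .
qed

lemma test_rate_r:
  assumes x: "x \<in> {rl..ru}"
  shows "(test_rate \<sigma> rl ru n (\<alpha>, x, \<beta>))\<^sup>2 = ln (real n) powr ((4 * \<sigma> + 1) / (2 * x)) / real n * sqrt lll"
proof -
  have x0: "x > 0" "x \<noteq> 0" using x r by auto
  have l0: "lll > 0" "real n > 0" using big(1,4) by linarith+
  have "test_rate \<sigma> rl ru n (\<alpha>, x, \<beta>) = ln (real n) powr ((4 * \<sigma> + 1) / (4 * x)) / sqrt (real n) * lll powr (1 / 4)"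
    using x x0 by (simp add: test_rate_def)
  moreover have "(lll powr (1 / 4))\<^sup>2 = sqrt lll"
    unfolding powr_square using l0(1) by (simp only: powr_half_sqrt[symmetric]) simp
  moreover have "(ln (real n) powr ((4 * \<sigma> + 1) / (4 * x)))\<^sup>2 = ln (real n) powr ((4 * \<sigma> + 1) / (2 * x))"
    unfolding powr_square using x0 by (intro arg_cong2[where f="(powr)"]) (simp_all add: field_simps)
  ultimately show ?thesis using l0 by (simp only: power_mult_distrib power_divide) simp
qed

text \<open>Since rl > 0, the indicator of the range [rl, ru] vanishes at 0 and only the polynomial
  rate remains.\<close>

lemma test_rate_0: "(test_rate \<sigma> rl ru n (\<alpha>, 0, \<beta>))\<^sup>2 = \<rho> powr (- 4 * \<beta> / (4 * \<beta> + 4 * \<sigma> + 1))"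
proof -
  have "test_rate \<sigma> rl ru n (\<alpha>, 0, \<beta>) = \<rho> powr (- 2 * \<beta> / (4 * \<beta> + 4 * \<sigma> + 1))"
    using r by (simp add: test_rate_def \<rho>_def)
  then show ?thesis unfolding powr_square by (simp only: powr_square) simp
qed

text \<open>The selected grid point is at most x, so \<open>tail_energy_exp\<close> bounds both
  biases by L / n, which is at most L times the squared rate.\<close>

lemma power_r:
  assumes f: "f \<in> smooth_class \<alpha> x \<beta> L" and par: "c \<le> \<alpha>" "x \<in> {rl..ru}" "\<beta> \<ge> 0"
    and sep: "C1 * (test_rate \<sigma> rl ru n (\<alpha>, x, \<beta>))\<^sup>2 \<le> (L2_norm (\<lambda>x. f x - f0 x))\<^sup>2"
    and K: "K = exp ((4 * \<sigma> + 1) * (ru - rl)\<^sup>2 / rl\<^sup>2)"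
    and C1: "8 * L \<le> C1" "4 * (Cs * K) < C1" "2 * K \<le> C1" "0 < C1"
  shows "emeasure (obs_law g n f) {Y \<in> space (obs_law g n f). adaptive_test g f0 \<sigma> rl ru \<beta>l \<beta>u c Cs n Y = 0} \<le> ennreal err_power"
proof -
  let ?p = "(test_rate \<sigma> rl ru n (\<alpha>, x, \<beta>))\<^sup>2"
  obtain i where i: "i \<in> {1..N2 rl ru n}" "r_grid rl ru n i \<le> x" "t (N1 n + i) \<le> K * ?p"
    using r_select[OF par(2)] unfolding test_rate_r[OF par(2)] K by blast
  note rf = r_facts[OF i(1)]
  have n0: "real n > 0" "ln (real n) \<ge> 1" using big(1,2) by linarith+
  have x0: "x > 0" using par(2) r by auto
  have p: "1 / real n \<le> ?p"
  proof -
    have "1 \<le> ln (real n) powr ((4 * \<sigma> + 1) / (2 * x))" using n0 x0 \<sigma> by (intro ge_one_powr_ge_zero) auto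
    moreover have "1 \<le> sqrt lll" using big(4) by simp
    ultimately have "1 * 1 \<le> ln (real n) powr ((4 * \<sigma> + 1) / (2 * x)) * sqrt lll" by (intro mult_mono) auto
    from divide_right_mono[OF this, of "real n"] show ?thesis unfolding test_rate_r[OF par(2)] using n0 by simp
  qed
  have "1 / real n > 0" using n0 by simp
  then have p0: "?p > 0" using p by (rule order_less_le_trans)
  have L1: "L / real n \<le> L * ?p" using mult_left_mono[OF p, of L] L by simp
  have R: "0 \<le> r_grid rl ru n i" using r_grid_bounds[OF i(1)] r by auto
  have "tail_energy f (h (N1 n + i)) \<le> L / real n"
    by (rule tail_energy_exp[OF f less_imp_le[OF L] par(3) c par(1) R i(2) rf(1) rf(3) rf(6) n0(1)])
  then have tf: "tail_energy f (h (N1 n + i)) \<le> L * ?p" using L1 by linarith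
  have tf0: "tail_energy f0 (h (N1 n + i)) \<le> L * ?p" using tail_f0_exp[OF i(1)] L1 by linarith
  have j: "N1 n + i \<in> {1..N1 n + N2 rl ru n}" using i(1) by auto
  show ?thesis
    by (rule type_II_error[OF smooth_classD[OF f] j rf(1) rf(3) rf(7) i(3) rf(9) tf tf0 sep p0 C1])
qed

text \<open>The selected grid point is at most the true smoothness, so its cut-off is at least the
  one belonging to the true smoothness, and the bias of \<open>f\<close> is at most L times the
  squared rate. The bias of \<open>f0\<close> loses the factor \<open>Kf\<close>.\<close>

lemma power_0:
  assumes f: "f \<in> smooth_class \<alpha> 0 \<beta>' L" and par: "0 \<le> \<alpha>" "\<beta>' \<in> {\<beta>l..\<beta>u}"
    and sep: "C1 * (test_rate \<sigma> rl ru n (\<alpha>, 0, \<beta>'))\<^sup>2 \<le> (L2_norm (\<lambda>x. f x - f0 x))\<^sup>2"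
    and K: "K = exp (2 * (\<beta>u - \<beta>l))"
    and C1: "8 * (L * Kf) \<le> C1" "4 * (Cs * K) < C1" "2 * K \<le> C1" "0 < C1"
  shows "emeasure (obs_law g n f) {Y \<in> space (obs_law g n f). adaptive_test g f0 \<sigma> rl ru \<beta>l \<beta>u c Cs n Y = 0} \<le> ennreal err_power"
proof -
  let ?p = "(test_rate \<sigma> rl ru n (\<alpha>, 0, \<beta>'))\<^sup>2"
  obtain i where i: "i \<in> {1..N1 n}" "\<beta>_grid \<beta>l \<beta>u n i \<le> \<beta>'" "t i \<le> K * ?p"
    using \<beta>_select[OF par(2)] unfolding test_rate_0 K by blast
  note bf = \<beta>_facts[OF i(1)]
  define B where "B = \<beta>_grid \<beta>l \<beta>u n i"
  have B: "0 \<le> B" "B \<le> \<beta>'" using \<beta>_grid_bounds[OF i(1)] \<beta> i(2) by (auto simp: B_def)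
  have b': "0 \<le> \<beta>'" "\<beta>' \<le> \<beta>u" using par(2) \<beta> by auto
  have r0: "\<rho> > 0" using \<rho>(1) by simp
  have p0: "?p > 0" unfolding test_rate_0 using r0 by simp
  have T: "(1 / h i) powr (- 2 * \<beta>') \<le> ?p"
  proof -
    have "(1 / h i) powr (- 2 * \<beta>') = \<rho> powr (- 4 * \<beta>' / (4 * B + 4 * \<sigma> + 1))"
      unfolding bf(2) powr_powr B_def by simp
    also have "\<dots> \<le> \<rho> powr (- 4 * \<beta>' / (4 * \<beta>' + 4 * \<sigma> + 1))"
    proof (rule powr_mono[OF _ \<rho>(1)])
      have "4 * \<beta>' / (4 * \<beta>' + 4 * \<sigma> + 1) \<le> 4 * \<beta>' / (4 * B + 4 * \<sigma> + 1)"
        using B b' \<sigma> by (intro divide_left_mono mult_pos_pos) auto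
      then show "- 4 * \<beta>' / (4 * B + 4 * \<sigma> + 1) \<le> - 4 * \<beta>' / (4 * \<beta>' + 4 * \<sigma> + 1)" by simp
    qed
    finally show ?thesis unfolding test_rate_0 .
  qed
  have "tail_energy f (h i) \<le> L * (1 / h i) powr (- 2 * \<beta>')"
    by (rule tail_energy_poly[OF f less_imp_le[OF L] b'(1) par(1) bf(1)])
  also have "\<dots> \<le> (L * Kf) * ?p" using mult_left_mono[OF Kf(1), of L] L T p0 by (intro mult_mono) auto
  finally have tf: "tail_energy f (h i) \<le> (L * Kf) * ?p" .
  have "tail_energy f0 (h i) \<le> L * Kf * (1 / h i) powr (- 2 * \<beta>')"
    by (rule tail_f0_poly[OF b' bf(1) bf(3)])
  also have "\<dots> \<le> (L * Kf) * ?p" using L Kf(1) T by (intro mult_left_mono) auto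
  finally have tf0: "tail_energy f0 (h i) \<le> (L * Kf) * ?p" .
  have j: "i \<in> {1..N1 n + N2 rl ru n}" using i(1) by auto
  \<comment> \<open>Weakens the relation of the \<beta>-grid, with ln (ln n), to that of the r-grid,
    with \<kappa> and ln (ln (ln n)), so that both cases share \<open>err_power\<close>.\<close>
  have "\<kappa> * (1 / h i) powr (4 * \<sigma> + 1) * lll \<le> 1 * (1 / h i) powr (4 * \<sigma> + 1) * ll"
    using \<kappa>_pos lll_le big(4) by (intro mult_mono mult_right_mono) auto
  then have k: "\<kappa> * (1 / h i) powr (4 * \<sigma> + 1) * lll \<le> (real n)\<^sup>2 * (t i)\<^sup>2" using bf(8) by simp
  show ?thesis
    by (rule type_II_error[OF smooth_classD[OF f] j bf(1) bf(3) bf(6) i(3) k tf tf0 sep p0 C1])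
qed

end

section \<open>Convergence of the error bound and conclusion\<close>

lemma N2_le:
  assumes "rl \<le> ru" and "ln (ln (real n)) \<ge> 0"
  shows "real (N2 rl ru n) \<le> (if rl < ru then 1 / (ru - rl) else 1) * ln (ln (real n)) + 2"
proof (cases "rl < ru")
  case True
  then have "ln (ln (real n)) / (ru - rl) \<ge> 0" using assms by simp
  then have "real (N2 rl ru n) \<le> ln (ln (real n)) / (ru - rl) + 1"
    using True unfolding N2_def by simp
  then show ?thesis using True by simp
qed (use assms in \<open>simp add: N2_def\<close>)

text \<open>Expanded into summands with elementary rates: (ln n + 1) * exp (- 2 * ln (ln n)) is of
  order 1 / ln n, its analogue on the r-grid of order 1 / ln (ln n), and the slowest is the error of
  the second kind.\<close>

lemma error_vanishes:
  fixes b d k c \<kappa> A B :: real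
  assumes "b > 0" "d > 0" "k > 0" "c > 0" "\<kappa> > 0" "A > 0" "B > 0"
  shows "(\<lambda>n::nat. (ln (real n) + 1) * (2 * (exp (- 2 * ln (ln (real n))) + (4 * b * real n powr (- d) + (4 / (9 * real n * b) + 1 / (3 * real n)))))
     + (k * ln (ln (real n)) + 2) * (2 * (exp (- 2 * ln (ln (ln (real n)))) + (4 * b * (ln (real n) / (2 * c)) powr (- (1 / 2)) + (4 / (9 * real n * b) + 1 / (3 * real n)))))
     + (64 * A / sqrt (\<kappa> * ln (ln (ln (real n)))) + 256 * B / (\<kappa> * ln (ln (ln (real n)))))) \<longlonglongrightarrow> 0"
proof -
  have 1: "(\<lambda>n::nat. 2 * ((ln (real n) + 1) * exp (- 2 * ln (ln (real n))))) \<longlonglongrightarrow> 0" by real_asymp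
  have 2: "(\<lambda>n::nat. 8 * b * ((ln (real n) + 1) * real n powr (- d))) \<longlonglongrightarrow> 0" using assms by real_asymp
  have 3: "(\<lambda>n::nat. (ln (real n) + 1) * (2 * (4 / (9 * real n * b) + 1 / (3 * real n)))) \<longlonglongrightarrow> 0" using assms by real_asymp
  have 4: "(\<lambda>n::nat. (k * ln (ln (real n)) + 2) * (2 * exp (- 2 * ln (ln (ln (real n)))))) \<longlonglongrightarrow> 0" using assms by real_asymp
  have 5: "(\<lambda>n::nat. (k * ln (ln (real n)) + 2) * (8 * b * (ln (real n) / (2 * c)) powr (- (1 / 2)))) \<longlonglongrightarrow> 0" using assms by real_asymp
  have 6: "(\<lambda>n::nat. (k * ln (ln (real n)) + 2) * (2 * (4 / (9 * real n * b) + 1 / (3 * real n)))) \<longlonglongrightarrow> 0" using assms by real_asymp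
  have 7: "(\<lambda>n::nat. 64 * A / sqrt (\<kappa> * ln (ln (ln (real n)))) + 256 * B / (\<kappa> * ln (ln (ln (real n))))) \<longlonglongrightarrow> 0" using assms by real_asymp
  have "(\<lambda>n::nat. 2 * ((ln (real n) + 1) * exp (- 2 * ln (ln (real n)))) + 8 * b * ((ln (real n) + 1) * real n powr (- d))
      + (ln (real n) + 1) * (2 * (4 / (9 * real n * b) + 1 / (3 * real n)))
      + (k * ln (ln (real n)) + 2) * (2 * exp (- 2 * ln (ln (ln (real n)))))
      + (k * ln (ln (real n)) + 2) * (8 * b * (ln (real n) / (2 * c)) powr (- (1 / 2)))
      + (k * ln (ln (real n)) + 2) * (2 * (4 / (9 * real n * b) + 1 / (3 * real n)))
      + (64 * A / sqrt (\<kappa> * ln (ln (ln (real n)))) + 256 * B / (\<kappa> * ln (ln (ln (real n)))))) \<longlonglongrightarrow> 0 + 0 + 0 + 0 + 0 + 0 + 0"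
    by (intro tendsto_add 1 2 3 4 5 6 7)
  moreover have "x * (2 * (e + (4 * b * p + q))) + y * (2 * (e' + (4 * b * p' + q))) + z
    = 2 * (x * e) + 8 * b * (x * p) + x * (2 * q) + y * (2 * e') + y * (8 * b * p') + y * (2 * q) + z" for x y z e e' p p' q :: real
    by (simp add: algebra_simps)
  ultimately show ?thesis by (simp only: add_0)
qed

text \<open>Both forms of the parameter set are served by the same test, whose r-grid is built from
  rl > 0: in the exponential case the r-grid detects the alternative, in the case r = 0 the
  \<beta>-grid does.\<close>

theorem theorem2:
  fixes g f0 :: "real \<Rightarrow> real"
    and \<sigma> c\<^sub>g L \<alpha>l \<alpha>u rl ru \<beta>l \<beta>u \<beta>0 c :: real
    and \<T> :: "(real \<times> real \<times> real) set"
  assumes "1 < \<sigma>"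
    and "is_prob_density g"
    and "\<And>u. fourier g u \<noteq> 0"
    and "0 < c\<^sub>g"
    and "(\<lambda>u. cmod (fourier g u)) \<sim>[at_infinity] (\<lambda>u. c\<^sub>g * \<bar>u\<bar> powr (- \<sigma>))"
    and "0 < L"
    and "0 < \<alpha>l" "\<alpha>l \<le> \<alpha>u"
    and "0 < rl" "rl \<le> ru" "ru \<le> 2"
    and "0 \<le> \<beta>l" "\<beta>l \<le> \<beta>u"
    and "\<T> = param_set \<alpha>l \<alpha>u rl ru \<beta>l \<beta>u \<or> 0 < \<beta>l \<and> \<T> = param_set \<alpha>l \<alpha>u 0 0 \<beta>l \<beta>u"
    and "\<beta>0 \<in> {\<beta>l..\<beta>u}" "f0 \<in> smooth_class \<alpha>u ru \<beta>0 L"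
    and "0 < c" "c < \<alpha>l * exp (- 1 / rl)"
  shows "\<forall>\<epsilon>\<in>{0<..<1}. \<exists>Cmin. \<forall>Cstar>Cmin. \<exists>C0>0. \<forall>C>C0.
    limsup (\<lambda>n.
      emeasure (obs_law g n f0)
        {Y \<in> space (obs_law g n f0). adaptive_test g f0 \<sigma> rl ru \<beta>l \<beta>u c Cstar n Y = 1}
      + (SUP f\<in>alternative f0 L \<T> C (test_rate \<sigma> rl ru n).
          emeasure (obs_law g n f)
            {Y \<in> space (obs_law g n f). adaptive_test g f0 \<sigma> rl ru \<beta>l \<beta>u c Cstar n Y = 0}))
    \<le> ennreal \<epsilon>"
proof (rule ballI)
  fix \<epsilon> :: real assume \<epsilon>: "\<epsilon> \<in> {0<..<1}"
  have c\<alpha>: "c \<le> \<alpha>l"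
  proof -
    have "\<alpha>l * exp (- 1 / rl) \<le> \<alpha>l * 1" using assms(7,9) by (intro mult_left_mono) auto
    then show ?thesis using assms(18) by simp
  qed
  then have c\<alpha>u: "c \<le> \<alpha>u" using assms(8) by simp
  note gi = noise_constants(1)[OF assms(2,1,4,3,5)]
  obtain Cg where Cg: "Cg \<ge> 1" and "\<forall>T\<ge>1. \<forall>u. \<bar>u\<bar> \<le> T \<longrightarrow> 1 / cmod (fourier g u) \<le> Cg * T powr \<sigma>"
    using noise_constants(2)[OF assms(2,1,4,3,5)] by blast
  then have gK: "1 / cmod (fourier g u) \<le> Cg * T powr \<sigma>" if "T \<ge> 1" "\<bar>u\<bar> \<le> T" for T u using that by blast
  define b where "b = (LINT u|lborel. cmod (fourier g u))"
  have b: "b > 0" unfolding b_def by (rule noise_mass_pos[OF assms(2,3) gi])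
  interpret noise g \<sigma> Cg b
    by unfold_locales (use assms(2,3) gi assms(1) Cg gK b_def b in auto)
  have ru: "ru > 0" "\<beta>u \<ge> 0" "\<alpha>u > 0" using assms(7-13) by auto
  obtain Kf where Kf: "Kf \<ge> 1" and "\<forall>v\<ge>1. v powr (2 * \<beta>u) \<le> Kf * exp (2 * \<alpha>u * v powr ru)"
    using powr_le_exp[of "2 * \<beta>u" "2 * \<alpha>u" ru] ru by auto
  then have Kf': "v powr (2 * \<beta>u) \<le> Kf * exp (2 * \<alpha>u * v powr ru)" if "v \<ge> 1" for v using that by blast
  define \<kappa> where "\<kappa> = min 1 (2 * c) powr ((4 * \<sigma> + 1) / rl)"
  have \<kappa>: "\<kappa> > 0" using assms(17) by (simp add: \<kappa>_def)
  define k where "k = (if rl < ru then 1 / (ru - rl) else 1)"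
  have k: "k > 0" by (simp add: k_def)
  \<comment> \<open>Sum of the factors lost between neighbouring points of the two grids, so that
    one constant covers both cases.\<close>
  define K where "K = exp ((4 * \<sigma> + 1) * (ru - rl)\<^sup>2 / rl\<^sup>2) + exp (2 * (\<beta>u - \<beta>l))"
  have K: "exp ((4 * \<sigma> + 1) * (ru - rl)\<^sup>2 / rl\<^sup>2) \<le> K" "exp (2 * (\<beta>u - \<beta>l)) \<le> K" "K > 0"
    by (auto simp: K_def intro: add_pos_pos)
  \<comment> \<open>The first term dominates the bias of \<open>f0\<close> on the \<beta>-grid; the
    second makes the Gaussian exponents at least twice the iterated logarithms.\<close>
  define Cmin where "Cmin = 2 * (L * Kf) + sqrt (2 * (384 * b * Cg ^ 4) / \<kappa>)"
  show "\<exists>Cmin. \<forall>Cstar>Cmin. \<exists>C0>0. \<forall>C>C0.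
    limsup (\<lambda>n.
      emeasure (obs_law g n f0)
        {Y \<in> space (obs_law g n f0). adaptive_test g f0 \<sigma> rl ru \<beta>l \<beta>u c Cstar n Y = 1}
      + (SUP f\<in>alternative f0 L \<T> C (test_rate \<sigma> rl ru n).
          emeasure (obs_law g n f)
            {Y \<in> space (obs_law g n f). adaptive_test g f0 \<sigma> rl ru \<beta>l \<beta>u c Cstar n Y = 0}))
    \<le> ennreal \<epsilon>"
  proof (rule exI[of _ Cmin], intro allI impI)
    fix Cs assume "Cs > Cmin"
    have s0: "0 \<le> sqrt (2 * (384 * b * Cg ^ 4) / \<kappa>)" using b Cg \<kappa> by simp
    have LK: "L * Kf > 0" "L \<le> L * Kf" using assms(6) Kf by auto
    have Cs: "Cs > 0" "2 * (L * Kf) \<le> Cs" "sqrt (2 * (384 * b * Cg ^ 4) / \<kappa>) \<le> Cs"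
      using \<open>Cs > Cmin\<close> s0 LK unfolding Cmin_def by linarith+
    have Cs2: "2 * (384 * b * Cg ^ 4) \<le> Cs\<^sup>2 * \<kappa>"
    proof -
      have "(sqrt (2 * (384 * b * Cg ^ 4) / \<kappa>))\<^sup>2 \<le> Cs\<^sup>2" using Cs(3) s0 by (rule power_mono)
      moreover have "(sqrt (2 * (384 * b * Cg ^ 4) / \<kappa>))\<^sup>2 = 2 * (384 * b * Cg ^ 4) / \<kappa>"
        using b Cg \<kappa> by (intro real_sqrt_pow2) auto
      ultimately show ?thesis using \<kappa> by (simp add: pos_divide_le_eq)
    qed
    \<comment> \<open>Adds up the demands of \<open>type_II_error\<close>: biases, critical value
      and threshold.\<close>
    define C0 where "C0 = 8 * (L * Kf) + 4 * (Cs * K) + 2 * K"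
    have CsK: "Cs * K > 0" using Cs(1) K(3) by simp
    show "\<exists>C0>0. \<forall>C>C0.
      limsup (\<lambda>n.
        emeasure (obs_law g n f0)
          {Y \<in> space (obs_law g n f0). adaptive_test g f0 \<sigma> rl ru \<beta>l \<beta>u c Cs n Y = 1}
        + (SUP f\<in>alternative f0 L \<T> C (test_rate \<sigma> rl ru n).
            emeasure (obs_law g n f)
              {Y \<in> space (obs_law g n f). adaptive_test g f0 \<sigma> rl ru \<beta>l \<beta>u c Cs n Y = 0}))
      \<le> ennreal \<epsilon>"
    proof (intro exI[of _ C0] conjI allI impI)
      show "C0 > 0" using LK CsK K(3) unfolding C0_def by linarith
      fix C assume C: "C > C0"
      define E where "E n = (ln (real n) + 1) * (2 * (exp (- 2 * ln (ln (real n))) + (4 * b * real n powr (- (1 / (4 * \<beta>u + 4 * \<sigma> + 1))) + (4 / (9 * real n * b) + 1 / (3 * real n)))))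
        + (k * ln (ln (real n)) + 2) * (2 * (exp (- 2 * ln (ln (ln (real n)))) + (4 * b * (ln (real n) / (2 * c)) powr (- (1 / 2)) + (4 / (9 * real n * b) + 1 / (3 * real n)))))
        + (64 * (b * Cg\<^sup>2) / sqrt (\<kappa> * ln (ln (ln (real n)))) + 256 * (b * Cg ^ 4) / (\<kappa> * ln (ln (ln (real n)))))" for n :: nat
      have "E \<longlonglongrightarrow> 0" unfolding E_def
        by (rule error_vanishes) (use b k \<kappa> assms(1,17) ru Cg in auto)
      then have "\<forall>\<^sub>F n in sequentially. E n < \<epsilon>" using \<epsilon> by (intro order_tendstoD) auto
      moreover have "\<forall>\<^sub>F n in sequentially. large rl ru c n" by (rule eventually_large[OF assms(9,17)])
      moreover have "\<forall>\<^sub>F n::nat in sequentially. 2 * L \<le> Cs * sqrt (ln (ln (ln (real n))))"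
        using Cs(1) assms(6) by real_asymp
      ultimately have "\<forall>\<^sub>F n in sequentially. emeasure (obs_law g n f0)
          {Y \<in> space (obs_law g n f0). adaptive_test g f0 \<sigma> rl ru \<beta>l \<beta>u c Cs n Y = 1}
        + (SUP f\<in>alternative f0 L \<T> C (test_rate \<sigma> rl ru n).
            emeasure (obs_law g n f)
              {Y \<in> space (obs_law g n f). adaptive_test g f0 \<sigma> rl ru \<beta>l \<beta>u c Cs n Y = 0}) \<le> ennreal \<epsilon>"
      proof eventually_elim
        case (elim n)
        interpret testing g \<sigma> Cg b rl ru \<beta>l \<beta>u c n f0 L \<alpha>u \<beta>0 Kf Cs
          by unfold_locales (use assms elim Kf Kf' Cs Cs2 c\<alpha>u in \<open>auto simp: \<kappa>_def\<close>)
        have l0: "lll > 0" using big(4) by linarith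
        have P0: "0 \<le> err_power" unfolding err_power_def using b Cg \<kappa>_pos(1) l0 by (intro add_nonneg_nonneg divide_nonneg_nonneg) auto
        have SUP: "(SUP f\<in>alternative f0 L \<T> C (test_rate \<sigma> rl ru n).
            emeasure (obs_law g n f) {Y \<in> space (obs_law g n f). adaptive_test g f0 \<sigma> rl ru \<beta>l \<beta>u c Cs n Y = 0}) \<le> ennreal err_power"
        proof (rule SUP_least)
          fix f assume "f \<in> alternative f0 L \<T> C (test_rate \<sigma> rl ru n)"
          then obtain \<alpha> x \<beta> where par: "(\<alpha>, x, \<beta>) \<in> \<T>" and f: "f \<in> smooth_class \<alpha> x \<beta> L"
            and sep: "C \<le> inverse ((test_rate \<sigma> rl ru n (\<alpha>, x, \<beta>))\<^sup>2) * (L2_norm (\<lambda>x. f x - f0 x))\<^sup>2"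
            unfolding alternative_def by blast
          have C00: "C > 0" using C \<open>C0 > 0\<close> by linarith
          \<comment> \<open>If the rate were 0, its inverse would be 0 by convention and
            \<open>sep\<close> would give C \<le> 0.\<close>
          have "test_rate \<sigma> rl ru n (\<alpha>, x, \<beta>) \<noteq> 0" using sep C00 by auto
          then have "(test_rate \<sigma> rl ru n (\<alpha>, x, \<beta>))\<^sup>2 > 0" by simp
          then have sep': "C * (test_rate \<sigma> rl ru n (\<alpha>, x, \<beta>))\<^sup>2 \<le> (L2_norm (\<lambda>x. f x - f0 x))\<^sup>2"
            using mult_right_mono[OF sep, of "(test_rate \<sigma> rl ru n (\<alpha>, x, \<beta>))\<^sup>2"] by (simp add: field_simps)
          have CK: "4 * (Cs * K') < C" "2 * K' \<le> C" if "K' \<le> K" for K'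
          proof -
            have "Cs * K' \<le> Cs * K" using that Cs(1) by (intro mult_left_mono) auto
            then show "4 * (Cs * K') < C" "2 * K' \<le> C" using that C LK CsK K(3) unfolding C0_def by linarith+
          qed
          have C8: "8 * L \<le> C" "8 * (L * Kf) \<le> C" using C LK CsK K(3) unfolding C0_def by linarith+
          show "emeasure (obs_law g n f) {Y \<in> space (obs_law g n f). adaptive_test g f0 \<sigma> rl ru \<beta>l \<beta>u c Cs n Y = 0} \<le> ennreal err_power"
          proof (cases "\<T> = param_set \<alpha>l \<alpha>u rl ru \<beta>l \<beta>u")
            case True
            then have p: "c \<le> \<alpha>" "x \<in> {rl..ru}" "\<beta> \<ge> 0"
              using par c\<alpha> assms(12) unfolding param_set_def by auto
            show ?thesis by (rule power_r[OF f p sep' refl C8(1) CK[OF K(1)] C00])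
          next
            case False
            then have "\<T> = param_set \<alpha>l \<alpha>u 0 0 \<beta>l \<beta>u" using assms(14) by blast
            then have p: "x = 0" "0 \<le> \<alpha>" "\<beta> \<in> {\<beta>l..\<beta>u}"
              using par assms(7) unfolding param_set_def by auto
            show ?thesis by (rule power_0[OF f[unfolded p(1)] p(2,3) sep'[unfolded p(1)] refl C8(2) CK[OF K(2)] C00])
          qed
        qed
        have e0: "0 \<le> err\<beta>" "0 \<le> errr" using b(2) by (auto simp: err\<beta>_def errr_def)
        have l1: "0 \<le> ll" using big(3) by linarith
        have "real (N1 n) * err\<beta> + real (N2 rl ru n) * errr \<le> (ln (real n) + 1) * err\<beta> + (k * ll + 2) * errr"
          unfolding k_def by (intro add_mono mult_right_mono e0 N1(3) N2_le[OF assms(10) l1])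
        then have tot: "real (N1 n) * err\<beta> + real (N2 rl ru n) * errr + err_power \<le> E n"
          unfolding E_def err\<beta>_def errr_def err_power_def \<kappa>_def by linarith
        have "emeasure (obs_law g n f0) {Y \<in> space (obs_law g n f0). adaptive_test g f0 \<sigma> rl ru \<beta>l \<beta>u c Cs n Y = 1}
          + (SUP f\<in>alternative f0 L \<T> C (test_rate \<sigma> rl ru n).
            emeasure (obs_law g n f) {Y \<in> space (obs_law g n f). adaptive_test g f0 \<sigma> rl ru \<beta>l \<beta>u c Cs n Y = 0})
          \<le> ennreal (real (N1 n) * err\<beta> + real (N2 rl ru n) * errr) + ennreal err_power"
          by (rule add_mono[OF type_I_error SUP])
        also have "\<dots> = ennreal (real (N1 n) * err\<beta> + real (N2 rl ru n) * errr + err_power)"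
          using e0 P0 by (intro ennreal_plus[symmetric]) auto
        also have "\<dots> \<le> ennreal \<epsilon>" using tot elim(1) by (intro ennreal_leI) linarith
        finally show ?case .
      qed
      then show "limsup (\<lambda>n.
        emeasure (obs_law g n f0)
          {Y \<in> space (obs_law g n f0). adaptive_test g f0 \<sigma> rl ru \<beta>l \<beta>u c Cs n Y = 1}
        + (SUP f\<in>alternative f0 L \<T> C (test_rate \<sigma> rl ru n).
            emeasure (obs_law g n f)
              {Y \<in> space (obs_law g n f). adaptive_test g f0 \<sigma> rl ru \<beta>l \<beta>u c Cs n Y = 0}))
      \<le> ennreal \<epsilon>" by (rule Limsup_bounded)
    qed
  qed
qed

end
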